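(* Fix a graph $G\subseteq\binom{[n]}{2}$ and let $\mathcal{A}$ be either ${\sf Shi}(G)$ or ${\sf Ish}(G)$. Let $(\mathbf{a},\mathbf{b})$ be (the endpoint notation of) a partition of $[n]$ with $k$ blocks ($n-k$ arcs) and consider an integer $1\leq d\leq k$. There exists a region of $\mathcal{A}$ with ceiling partition $(\mathbf{a},\mathbf{b})$ if and only if $a_ib_i\in G$ for all $i$, in which case: (1) the number of regions of $\mathcal{A}$ with ceiling partition $(\mathbf{a},\mathbf{b})$ is $\frac{n!}{(n-k+1)!}$; (2) the number of regions of $\mathcal{A}$ with ceiling partition $(\mathbf{a},\mathbf{b})$ and $d$ degrees of freedom is $$\frac{d(n-d-1)!(k-1)!}{(n-k-1)!(k-d)!}.$$ Consequently, the number of regions of $\mathcal{A}$ with $c$ ceilings and $d$ degrees of freedom is obtained by summing $\frac{d(n-d-1)!(k-1)!}{(n-k-1)!(k-d)!}$ (with $k=n-c$) over all $G$-partitions $(\mathbf{a},\mathbf{b})$ of $[n]$ with $k=n-c$ blocks.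
   Context: For a simple graph $G\subseteq\binom{[n]}{2}$ (pairs $ij$ with $1\le i<j\le n$), ${\sf Cox}(n)=\{x_i-x_j=0: 1\le i<j\le n\}$, ${\sf Shi}(G)={\sf Cox}(n)\cup\{x_i-x_j=1: ij\in G\}$ and ${\sf Ish}(G)={\sf Cox}(n)\cup\{x_1-x_j=i: ij\in G\}$, arrangements in $\mathbb{R}^n$. Regions are connected components of the complement. A wall of a region $R$ is a hyperplane spanning a codimension-1 face of $\bar R$; it is a ceiling if it does not contain the origin and $R$ and the origin lie in the same half-space of it. The number of degrees of freedom of $R$ is the dimension of its recession cone $\{v: v+R\subseteq R\}$. A partition of $[n]$ is drawn with arcs $ij$ ($i<j$) joining consecutive elements of a block; a partition with $k$ blocks has $n-k$ arcs $a_1b_1,\dots,a_{n-k}b_{n-k}$, ordered so $a_1<\dots<a_{n-k}$, and its endpoint notation is $(\mathbf{a},\mathbf{b})=(a_1\dots a_{n-k},\,b_1\dots b_{n-k})$. A $G$-partition is a partition all of whose arcs lie in $G$. Ceiling partition: for a region $R$ of ${\sf Shi}(G)$, it is the partition of $[n]$ whose arcs are the pairs $ij$ such that $x_i-x_j=1$ is a ceiling of $R$ (equivalently, if $R$ lies in the cone $x_{w(1)}>\dots>x_{w(n)}$ and its ceilings $x_{w(i)}-x_{w(j)}=1$ are encoded as arcs $ij$ of a nonnesting partition $\pi$, the ceiling partition is $w\cdot\pi$). For a region $R$ of ${\sf Ish}(G)$, it is the partition in endpoint notation $(\mathbf{a},\mathbf{b})$ whose arcs are the pairs $a_ib_i$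 such that $x_1-x_{b_i}=a_i$ is a ceiling of $R$ (these pairs always form the arc set of a partition). In both cases the ceiling partition has $c$ arcs iff $R$ has $c$ ceilings.
   Formalization: For k=n the printed formula contains the undefined (-1)!; there the quotient (n-d-1)!/(n-k-1)! is read as the product (n-k)(n-k+1)...(n-d-1), so the count is n! for d=n and 0 for d<n. *)

theory Defs
  imports "HOL-Analysis.Analysis" "HOL-Library.Disjoint_Sets"
begin

text \<open>
  The ambient space is \<open>real ^ 'n\<close>. A bijection \<open>e\<close> from \<open>{1..CARD('n)}\<close> to \<open>'n\<close> names the
  coordinates, so the \<open>i\<close>-th coordinate of \<open>x\<close> is \<open>x $ e i\<close> for \<open>i\<close> in \<open>{1..CARD('n)}\<close>. An edge
  or arc \<open>ij\<close> is the pair \<open>(i, j)\<close> with \<open>i < j\<close>.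
\<close>

definition pairs_upto :: "nat \<Rightarrow> (nat \<times> nat) set" where
  "pairs_upto n = {(i, j). 1 \<le> i \<and> i < j \<and> j \<le> n}"

definition diff_hyperplane :: "(nat \<Rightarrow> 'n::finite) \<Rightarrow> nat \<Rightarrow> nat \<Rightarrow> real \<Rightarrow> (real ^ 'n) set" where
  "diff_hyperplane e i j c = {x. x $ e i - x $ e j = c}"

definition Cox :: "(nat \<Rightarrow> 'n::finite) \<Rightarrow> (real ^ 'n) set set" where
  "Cox e = {diff_hyperplane e i j 0 | i j. (i, j) \<in> pairs_upto CARD('n)}"

definition Shi :: "(nat \<Rightarrow> 'n::finite) \<Rightarrow> (nat \<times> nat) set \<Rightarrow> (real ^ 'n) set set" where
  "Shi e G = Cox e \<union> {diff_hyperplane e i j 1 | i j. (i, j) \<in> G}"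

definition Ish :: "(nat \<Rightarrow> 'n::finite) \<Rightarrow> (nat \<times> nat) set \<Rightarrow> (real ^ 'n) set set" where
  "Ish e G = Cox e \<union> {diff_hyperplane e 1 j (real i) | i j. (i, j) \<in> G}"

definition regions :: "(real ^ 'n::finite) set set \<Rightarrow> (real ^ 'n) set set" where
  "regions A = components (- \<Union>A)"

definition is_wall :: "(real ^ 'n::finite) set \<Rightarrow> (real ^ 'n) set \<Rightarrow> bool" where
  "is_wall R H \<longleftrightarrow> (\<exists>F. F facet_of closure R \<and> H = affine hull F)"

text \<open>Up to replacing \<open>(u, b)\<close> by \<open>(- u, - b)\<close>, every open half-space has the form used here.\<close>

definition is_ceiling :: "(real ^ 'n::finite) set \<Rightarrow> (real ^ 'n) set \<Rightarrow> bool" where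
  "is_ceiling R H \<longleftrightarrow> is_wall R H \<and> 0 \<notin> H \<and>
     (\<exists>u b. u \<noteq> 0 \<and> H = {x. u \<bullet> x = b} \<and> R \<subseteq> {x. u \<bullet> x < b} \<and> 0 \<in> {x. u \<bullet> x < b})"

definition recession_cone :: "(real ^ 'n::finite) set \<Rightarrow> (real ^ 'n) set" where
  "recession_cone R = {v. (\<lambda>x. v + x) ` R \<subseteq> R}"

definition degrees_of_freedom :: "(real ^ 'n::finite) set \<Rightarrow> nat" where
  "degrees_of_freedom R = dim (recession_cone R)"

definition arcs :: "nat set set \<Rightarrow> (nat \<times> nat) set" where
  "arcs P = {(i, j). i < j \<and> (\<exists>B\<in>P. i \<in> B \<and> j \<in> B \<and> (\<forall>m\<in>B. \<not> (i < m \<and> m < j)))}"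

definition endpoint_notation :: "nat set set \<Rightarrow> nat list \<Rightarrow> nat list \<Rightarrow> bool" where
  "endpoint_notation P a b \<longleftrightarrow>
     length a = length b \<and> sorted_wrt (<) a \<and> set (zip a b) = arcs P"

definition G_partitions :: "nat \<Rightarrow> (nat \<times> nat) set \<Rightarrow> nat set set set" where
  "G_partitions n G = {P. partition_on {1..n} P \<and> arcs P \<subseteq> G}"

definition Shi_ceiling_partition ::
    "(nat \<Rightarrow> 'n::finite) \<Rightarrow> (real ^ 'n) set \<Rightarrow> nat set set \<Rightarrow> bool" where
  "Shi_ceiling_partition e R P \<longleftrightarrow> partition_on {1..CARD('n)} P \<and>
     arcs P = {(i, j) \<in> pairs_upto CARD('n). is_ceiling R (diff_hyperplane e i j 1)}"

definition Ish_ceiling_partition ::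
    "(nat \<Rightarrow> 'n::finite) \<Rightarrow> (real ^ 'n) set \<Rightarrow> nat set set \<Rightarrow> bool" where
  "Ish_ceiling_partition e R P \<longleftrightarrow> partition_on {1..CARD('n)} P \<and>
     arcs P = {(i, j) \<in> pairs_upto CARD('n). is_ceiling R (diff_hyperplane e 1 j (real i))}"

text \<open>
  The number \<open>d (n-d-1)! (k-1)! / ((n-k-1)! (k-d)!)\<close> for \<open>1 \<le> d \<le> k \<le> n\<close>. When \<open>k = n\<close> the
  expression contains \<open>(-1)!\<close>, and the quotient \<open>(n-d-1)! / (n-k-1)!\<close> has to be read as the
  product \<open>(n-k) (n-k+1) \<dots> (n-d-1)\<close>, which is empty for \<open>d = n\<close> and has the factor \<open>0\<close> for
  \<open>d < n\<close>; see \<open>freedom_count_pochhammer\<close>.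
\<close>

definition freedom_count :: "nat \<Rightarrow> nat \<Rightarrow> nat \<Rightarrow> real" where
  "freedom_count n k d =
     (if k = n then (if d = n then fact n else 0)
      else real d * fact (n - d - 1) * fact (k - 1) / (fact (n - k - 1) * fact (k - d)))"

lemma freedom_count_pochhammer:
  assumes "1 \<le> d" "d \<le> k" "k \<le> n"
  shows "freedom_count n k d =
           real d * fact (k - 1) / fact (k - d) * pochhammer (real (n - k)) (k - d)"
proof (cases "k = n")
  case True
  show ?thesis
  proof (cases "d = n")
    case True
    with \<open>k = n\<close> assms show ?thesis
      using fact_reduce[of n, where 'a = real] by (simp add: freedom_count_def)
  next
    case False
    with \<open>k = n\<close> assms show ?thesis
      by (simp add: freedom_count_def pochhammer_0_left)
  qed
next
  case False
  with assms have "k < n" by simp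
  then obtain m where m: "n = k + Suc m"
    by (metis add_Suc_right less_imp_Suc_add)
  have "(fact (m + (k - d)) :: real) = fact m * pochhammer (real (Suc m)) (k - d)"
    using pochhammer_product'[of "1::real" m "k - d"]
    by (simp add: pochhammer_fact[symmetric] add.commute)
  moreover have "n - d - 1 = m + (k - d)" "n - k - 1 = m" "n - k = Suc m"
    using m assms by auto
  ultimately show ?thesis
    using False by (simp add: freedom_count_def field_simps)
qed

end

theory Submission
  imports Defs
begin

text \<open>
  Inside a cone \<open>x\<^bsub>w(1)\<^esub> > \<dots> > x\<^bsub>w(n)\<^esub>\<close> a region is given by the inequalities
  \<open>x\<^sub>i - x\<^sub>j < c\<close> it satisfies. If \<open>[i, j]\<close> is contained in \<open>[i', j']\<close> along \<open>w\<close> and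
  \<open>c' \<le> c\<close>, then \<open>x\<^sub>i\<^sub>' - x\<^sub>j\<^sub>' < c'\<close> implies \<open>x\<^sub>i - x\<^sub>j < c\<close>; the ceilings are the undominated
  inequalities, and every antichain of admissible inequalities occurs. So regions with a given set of
  ceilings correspond to the orders \<open>w\<close> for which this set is an antichain, and the degrees of freedom
  count the places of \<open>w\<close> that no ceiling straddles.

  For \<open>Shi\<close> the orders are those in which the arcs of the partition go forward and do not nest. For
  \<open>Ish\<close> they are those in which \<open>1, b\<^sub>1, \<dots>, b\<^sub>n\<^sub>-\<^sub>k\<close> occur in this order, that is, the nonnesting
  orders for a single path with \<open>n - k\<close> arcs. In general let \<open>k\<close> disjoint paths cover \<open>n\<close> points.
  Writing a nonnesting order from left to right, each step either starts a new path or continues the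
  path whose last written point is the oldest one that is not continued yet, so only the sequence of
  starts is free. As in the ballot problem, a state with \<open>m\<close> missing points, \<open>c\<close> of which are not starts and
  \<open>H\<close> of which lie on paths already begun, has \<open>(H + 1) m! / (c + 1)!\<close> completions, independently of the
  lengths of the paths.
\<close>

subsection \<open>Counting nonnesting orders of a system of paths\<close>

text \<open>The lengths of the paths drop out by averaging. The count with a prescribed number of
  uncrossed places must survive the same averaging, hence \<open>touch_count\<close> is affine in
  \<open>H\<close> too. This lets one theorem serve both arrangements: the blocks of the partition
  on one side, one path with \<open>n - k\<close> arcs and \<open>k - 1\<close> isolated points on
  the other. The recession cone of a region consists of the vectors that weakly decrease along
  \<open>w\<close> and agree at the two ends of every ceiling. Such a vector can drop only at a
  place that no ceiling straddles. These places, with one more for the all-ones direction, give the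
  dimension. A ceiling is certified by one point on its hyperplane that lies on the region's side of
  all others, so the geometry reduces to constructing points with prescribed signs.\<close>

definition prec :: "'a list \<Rightarrow> 'a \<Rightarrow> 'a \<Rightarrow> bool" where
  "prec xs a b \<longleftrightarrow> (\<exists>p q. p < q \<and> q < length xs \<and> xs ! p = a \<and> xs ! q = b)"

lemma prec_in_set: "prec xs a b \<Longrightarrow> a \<in> set xs \<and> b \<in> set xs"
  unfolding prec_def by (metis nth_mem order_less_trans)

lemma prec_snoc: "prec (zs @ [x]) a b \<longleftrightarrow> prec zs a b \<or> a \<in> set zs \<and> b = x"
proof
  assume "prec (zs @ [x]) a b"
  then obtain p q where pq: "p < q" "q < length (zs @ [x])" "(zs @ [x]) ! p = a" "(zs @ [x]) ! q = b"
    unfolding prec_def by blast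
  show "prec zs a b \<or> a \<in> set zs \<and> b = x"
  proof (cases "q = length zs")
    case True
    then show ?thesis using pq by (auto simp: nth_append)
  next
    case False
    then have "q < length zs" using pq by simp
    then show ?thesis using pq unfolding prec_def by (metis nth_append order_less_trans)
  qed
next
  assume "prec zs a b \<or> a \<in> set zs \<and> b = x"
  then show "prec (zs @ [x]) a b"
  proof
    assume "prec zs a b"
    then obtain p q where pq: "p < q" "q < length zs" "zs ! p = a" "zs ! q = b"
      unfolding prec_def by blast
    then have "(zs @ [x]) ! p = a" "(zs @ [x]) ! q = b" "q < length (zs @ [x])"
      by (auto simp: nth_append)
    with pq(1) show ?thesis unfolding prec_def by blast
  next
    assume a: "a \<in> set zs \<and> b = x"
    then obtain p where "p < length zs" "zs ! p = a" by (auto simp: in_set_conv_nth)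
    with a have "p < length zs" "length zs < length (zs @ [x])"
      "(zs @ [x]) ! p = a" "(zs @ [x]) ! length zs = b" by (auto simp: nth_append)
    then show ?thesis unfolding prec_def by blast
  qed
qed

lemma prec_irrefl: "distinct xs \<Longrightarrow> \<not> prec xs a a"
  unfolding prec_def by (metis nth_eq_iff_index_eq order_less_irrefl order_less_trans)

lemma prec_trans: "distinct xs \<Longrightarrow> prec xs a b \<Longrightarrow> prec xs b c \<Longrightarrow> prec xs a c"
  unfolding prec_def by (metis nth_eq_iff_index_eq order_less_trans)

lemma prec_total: "a \<in> set xs \<Longrightarrow> b \<in> set xs \<Longrightarrow> a \<noteq> b \<Longrightarrow> prec xs a b \<or> prec xs b a"
  unfolding prec_def by (metis in_set_conv_nth linorder_neqE_nat)

lemma prec_asym: "distinct xs \<Longrightarrow> prec xs a b \<Longrightarrow> \<not> prec xs b a"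
  using prec_irrefl prec_trans by metis

text \<open>First in, first out: for arcs that share neither left nor right ends, letting the right
  ends follow the order of the left ends forbids exactly one arc inside another.\<close>

definition nonnesting :: "'a set \<Rightarrow> ('a \<times> 'a) set \<Rightarrow> 'a list \<Rightarrow> bool" where
  "nonnesting V E xs \<longleftrightarrow> distinct xs \<and> set xs = V \<and> (\<forall>a b. (a, b) \<in> E \<longrightarrow> prec xs a b) \<and>
     (\<forall>a b a' b'. (a, b) \<in> E \<longrightarrow> (a', b') \<in> E \<longrightarrow> prec xs a a' \<longrightarrow> prec xs b b')"

text \<open>Place \<open>p\<close> lies just before entry \<open>p\<close>. Place \<open>0\<close>
  of a nonempty list is always counted and accounts for the all-ones direction of the recession
  cone; the place after the last entry is left out.\<close>

definition uncrossed :: "('a \<times> 'a) set \<Rightarrow> 'a list \<Rightarrow> nat set" where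
  "uncrossed E xs = {p. p < length xs \<and> (\<forall>a b. (a, b) \<in> E \<longrightarrow> a \<in> set (take p xs) \<longrightarrow> b \<in> set (take p xs))}"

text \<open>With both degrees at most one and no cycle, \<open>E\<close> is a disjoint union of
  directed paths. A vertex on no arc is a path of one point, so there are
  \<open>card V - card E\<close> paths.\<close>

locale path_system =
  fixes V :: "'a set" and E :: "('a \<times> 'a) set"
  assumes finite_V: "finite V"
    and E_sub: "E \<subseteq> V \<times> V"
    and E_right: "(a, b) \<in> E \<Longrightarrow> (a, b') \<in> E \<Longrightarrow> b = b'"
    and E_left: "(a, b) \<in> E \<Longrightarrow> (a', b) \<in> E \<Longrightarrow> a = a'"
    and E_acyclic: "acyclic E"
begin

definition starts :: "'a set" where "starts = V - Range E"

text \<open>For a prefix closed under predecessors this is the next point of every path that is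
  begun but not finished.\<close>

definition front :: "'a list \<Rightarrow> 'a set" where
  "front zs = {b. b \<notin> set zs \<and> (\<exists>a\<in>set zs. (a, b) \<in> E)}"

text \<open>Nonnesting is tested at the moment an arc closes: \<open>(a, x)\<close> may close only
  when all arcs opened before \<open>a\<close> are closed.\<close>

definition admissible :: "'a list \<Rightarrow> 'a \<Rightarrow> bool" where
  "admissible zs x \<longleftrightarrow> x \<in> V \<and> x \<notin> set zs \<and>
     (\<forall>a. (a, x) \<in> E \<longrightarrow> a \<in> set zs \<and> (\<forall>a' b'. (a', b') \<in> E \<longrightarrow> prec zs a' a \<longrightarrow> b' \<in> set zs))"

fun completion :: "'a list \<Rightarrow> 'a list \<Rightarrow> bool" where
  "completion zs [] \<longleftrightarrow> set zs = V"
| "completion zs (x # xs) \<longleftrightarrow> admissible zs x \<and> completion (zs @ [x]) xs"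

text \<open>Moments are counted before each remaining step. The initial moment counts and the final
  one does not, in agreement with \<open>p < length xs\<close> in \<open>uncrossed\<close>.\<close>

fun touches :: "'a list \<Rightarrow> 'a list \<Rightarrow> nat" where
  "touches zs [] = 0"
| "touches zs (x # xs) = (if front zs = {} then 1 else 0) + touches (zs @ [x]) xs"

text \<open>The invariant of prefixes: a constraint becomes active only when the right end of its
  arc is placed, so it passes from a list to all its prefixes
  (\<open>partial_append\<close>).\<close>

definition partial :: "'a list \<Rightarrow> bool" where
  "partial zs \<longleftrightarrow> distinct zs \<and> set zs \<subseteq> V \<and> (\<forall>a b. (a, b) \<in> E \<longrightarrow> b \<in> set zs \<longrightarrow> prec zs a b) \<and>
     (\<forall>a b a' b'. (a, b) \<in> E \<longrightarrow> (a', b') \<in> E \<longrightarrow> prec zs a a' \<longrightarrow> b' \<in> set zs \<longrightarrow> prec zs b b')"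

lemma partial_Nil: "partial []"
  by (simp add: partial_def prec_def)

text \<open>Arcs leaving \<open>x\<close> are still open when \<open>x\<close> is appended, so the
  only new constraints concern arcs ending in \<open>x\<close>, and these are the ones that
  \<open>admissible\<close> tests.\<close>

lemma partial_snoc: "partial (zs @ [x]) \<longleftrightarrow> partial zs \<and> admissible zs x"
proof
  assume P: "partial (zs @ [x])"
  then have d: "distinct zs" "x \<notin> set zs" "x \<in> V" "set zs \<subseteq> V" by (auto simp: partial_def)
  have fwd: "prec (zs @ [x]) a b" if "(a, b) \<in> E" "b \<in> set (zs @ [x])" for a b
    using P that unfolding partial_def by blast
  have nn: "prec (zs @ [x]) b b'"
    if "(a, b) \<in> E" "(a', b') \<in> E" "prec (zs @ [x]) a a'" "b' \<in> set (zs @ [x])" for a b a' b'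
    using P that unfolding partial_def by blast
  have "prec zs a b" if "(a, b) \<in> E" "b \<in> set zs" for a b
    using fwd[OF that(1)] that d by (auto simp: prec_snoc)
  moreover have "prec zs b b'"
    if "(a, b) \<in> E" "(a', b') \<in> E" "prec zs a a'" "b' \<in> set zs" for a b a' b'
    using nn[OF that(1,2)] that d by (auto simp: prec_snoc)
  ultimately have 1: "partial zs" using d unfolding partial_def by blast
  have a: "a \<in> set zs" if "(a, x) \<in> E" for a
    using fwd[OF that] d by (auto simp: prec_snoc dest: prec_in_set)
  have "b' \<in> set zs" if "(a, x) \<in> E" "(a', b') \<in> E" "prec zs a' a" for a a' b'
    using nn[OF that(2,1)] that d by (auto simp: prec_snoc dest: prec_in_set)
  with a d have "admissible zs x" unfolding admissible_def by blast
  with 1 show "partial zs \<and> admissible zs x" by blast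
next
  assume A: "partial zs \<and> admissible zs x"
  then have d: "distinct zs" "x \<notin> set zs" "x \<in> V" "set zs \<subseteq> V"
    by (auto simp: partial_def admissible_def)
  have fwd: "prec zs a b" if "(a, b) \<in> E" "b \<in> set zs" for a b
    using A that unfolding partial_def by blast
  have nn: "prec zs b b'"
    if "(a, b) \<in> E" "(a', b') \<in> E" "prec zs a a'" "b' \<in> set zs" for a b a' b'
    using A that unfolding partial_def by blast
  have ad: "a \<in> set zs \<and> (\<forall>a' b'. (a', b') \<in> E \<longrightarrow> prec zs a' a \<longrightarrow> b' \<in> set zs)"
    if "(a, x) \<in> E" for a
    using A that unfolding admissible_def by blast
  have "prec (zs @ [x]) a b" if "(a, b) \<in> E" "b \<in> set (zs @ [x])" for a b
    using that fwd ad by (auto simp: prec_snoc)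
  moreover have "prec (zs @ [x]) b b'"
    if E: "(a, b) \<in> E" "(a', b') \<in> E" and p: "prec (zs @ [x]) a a'" and b': "b' \<in> set (zs @ [x])"
    for a b a' b'
  proof (cases "b' = x")
    case True
    then have a': "a' \<in> set zs" using E ad by blast
    then have "prec zs a a'" using p d by (auto simp: prec_snoc)
    then have "b \<in> set zs" using ad E True by blast
    then show ?thesis using True by (simp add: prec_snoc)
  next
    case False
    then have b': "b' \<in> set zs" using b' by simp
    then have "a' \<in> set zs" using fwd[OF E(2)] prec_in_set by metis
    then have "prec zs a a'" using p d by (auto simp: prec_snoc)
    then show ?thesis using nn[OF E _ b'] by (simp add: prec_snoc)
  qed
  ultimately show "partial (zs @ [x])" using d unfolding partial_def by simp
qed

lemma partial_append: "partial (zs @ xs) \<Longrightarrow> partial zs"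
proof (induction xs rule: rev_induct)
  case (snoc x xs)
  then show ?case using partial_snoc[of "zs @ xs" x] by simp
qed simp

lemma completion_iff_partial:
  "partial zs \<Longrightarrow> completion zs xs \<longleftrightarrow> partial (zs @ xs) \<and> set (zs @ xs) = V"
proof (induction xs arbitrary: zs)
  case (Cons x xs)
  show ?case
  proof (cases "admissible zs x")
    case True
    then have "partial (zs @ [x])" using Cons.prems partial_snoc by blast
    from Cons.IH[OF this] True show ?thesis by simp
  next
    case False
    then have "\<not> partial (zs @ [x])" using partial_snoc by blast
    then have "\<not> partial (zs @ x # xs)" using partial_append[of "zs @ [x]" xs] by auto
    with False show ?thesis by simp
  qed
qed simp

lemma nonnesting_iff_completion: "nonnesting V E xs \<longleftrightarrow> completion [] xs"
proof -
  have "nonnesting V E xs \<longleftrightarrow> partial xs \<and> set xs = V"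
    unfolding nonnesting_def partial_def using E_sub by (auto 4 4)
  with completion_iff_partial[OF partial_Nil] show ?thesis by simp
qed

lemma touches_eq: "touches zs xs = card {p. p < length xs \<and> front (zs @ take p xs) = {}}"
proof (induction xs arbitrary: zs)
  case (Cons x xs)
  have "{p. p < length (x # xs) \<and> front (zs @ take p (x # xs)) = {}} =
     (if front zs = {} then {0} else {}) \<union> Suc ` {p. p < length xs \<and> front ((zs @ [x]) @ take p xs) = {}}"
    (is "?L = ?A \<union> Suc ` ?B")
  proof (rule set_eqI)
    fix p show "p \<in> ?L \<longleftrightarrow> p \<in> ?A \<union> Suc ` ?B" by (cases p) auto
  qed
  moreover have "card (?A \<union> Suc ` ?B) = card ?A + card (Suc ` ?B)"
    by (rule card_Un_disjoint) auto
  ultimately have "card ?L = card ?A + card ?B" by (simp add: card_image)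
  then show ?case using Cons.IH[of "zs @ [x]"] by simp
qed simp

lemma touches_eq_uncrossed: "touches [] xs = card (uncrossed E xs)"
  unfolding touches_eq uncrossed_def front_def by (rule arg_cong[where f = card]) auto

definition len :: "'a \<Rightarrow> nat" where "len x = card (E\<^sup>* `` {x})"

lemma len_rec: "x \<in> V \<Longrightarrow> len x = 1 + sum len (E `` {x})"
proof -
  assume x: "x \<in> V"
  have fin: "finite (E\<^sup>* `` {y})" if "y \<in> V" for y
  proof (rule finite_subset[OF _ finite_V])
    have "(y, z) \<in> E\<^sup>* \<Longrightarrow> z \<in> V" for z
      by (induction rule: rtrancl_induct) (use that E_sub in auto)
    then show "E\<^sup>* `` {y} \<subseteq> V" by blast
  qed
  show ?thesis
  proof (cases "E `` {x} = {}")
    case True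
    then have "E\<^sup>* `` {x} = {x}" by (auto elim: converse_rtranclE)
    with True show ?thesis by (simp add: len_def)
  next
    case False
    then obtain y where y: "(x, y) \<in> E" by blast
    then have Ex: "E `` {x} = {y}" using E_right by blast
    have "E\<^sup>* `` {x} = insert x (E\<^sup>* `` {y})"
      using y Ex by (auto elim: converse_rtranclE intro: converse_rtrancl_into_rtrancl)
    moreover have "x \<notin> E\<^sup>* `` {y}"
      using y E_acyclic unfolding acyclic_def by (meson Image_singleton_iff rtrancl_into_trancl2)
    moreover have "y \<in> V" using y E_sub by blast
    ultimately show ?thesis using Ex fin[of y] by (simp add: len_def)
  qed
qed

definition unused :: "'a list \<Rightarrow> 'a set" where "unused zs = starts - set zs"

definition height :: "'a list \<Rightarrow> nat" where "height zs = sum len (front zs)"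

lemma partial_closed: "partial zs \<Longrightarrow> (a, b) \<in> E \<Longrightarrow> b \<in> set zs \<Longrightarrow> a \<in> set zs"
  unfolding partial_def using prec_in_set by metis

lemma front_subset: "front zs \<subseteq> V" and finite_front: "finite (front zs)"
proof -
  show "front zs \<subseteq> V" using E_sub by (auto simp: front_def)
  then show "finite (front zs)" using finite_V finite_subset by blast
qed

lemma finite_unused: "finite (unused zs)"
  using finite_V by (simp add: unused_def starts_def)

lemma front_unused_disjoint: "front zs \<inter> unused zs = {}"
  by (auto simp: front_def unused_def starts_def)

lemma height_eq_0_iff: "height zs = 0 \<longleftrightarrow> front zs = {}"
proof -
  have "len x \<noteq> 0" if "x \<in> front zs" for x
    using len_rec[of x] that front_subset[of zs] by auto
  then show ?thesis using finite_front[of zs] by (auto simp: height_def)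
qed

lemma height_plus_unused:
  assumes "partial zs"
  shows "height zs + sum len (unused zs) = card (V - set zs)"
proof -
  let ?R = "V - set zs"
  have fR: "finite ?R" using finite_V by simp
  have "E `` ?R = ?R - unused zs - front zs"
  proof (intro set_eqI iffI)
    fix y assume "y \<in> E `` ?R"
    then obtain a where a: "a \<in> ?R" "(a, y) \<in> E" by blast
    then have "y \<notin> set zs" using partial_closed[OF assms] by blast
    moreover have "y \<notin> front zs" using a E_left by (auto simp: front_def)
    ultimately show "y \<in> ?R - unused zs - front zs"
      using a E_sub by (auto simp: unused_def starts_def)
  next
    fix y assume y: "y \<in> ?R - unused zs - front zs"
    then obtain a where "(a, y) \<in> E" by (auto simp: unused_def starts_def)
    then show "y \<in> E `` ?R" using y E_sub by (auto simp: front_def)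
  qed
  moreover have sub: "unused zs \<subseteq> ?R" "front zs \<subseteq> ?R"
    using front_subset by (auto simp: unused_def starts_def front_def)
  ultimately have *: "?R = E `` ?R \<union> (front zs \<union> unused zs)" "E `` ?R \<inter> (front zs \<union> unused zs) = {}"
    by blast+
  have fE: "finite (E `` ?R)" using *(1) fR by (metis finite_Un)
  have "sum len ?R = (\<Sum>x\<in>?R. 1 + sum len (E `` {x}))"
    by (rule sum.cong) (auto simp: len_rec)
  also have "\<dots> = card ?R + (\<Sum>x\<in>?R. sum len (E `` {x}))"
    unfolding sum.distrib by simp
  also have "(\<Sum>x\<in>?R. sum len (E `` {x})) = sum len (\<Union>x\<in>?R. E `` {x})"
  proof (rule sum.UNION_disjoint[symmetric])
    show "finite ?R" by fact
    show "\<forall>x\<in>?R. finite (E `` {x})" using fE by (meson Image_mono empty_subsetI finite_subset insert_subset subset_refl)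
    show "\<forall>x\<in>?R. \<forall>y\<in>?R. x \<noteq> y \<longrightarrow> E `` {x} \<inter> E `` {y} = {}" using E_left by blast
  qed
  also have "(\<Union>x\<in>?R. E `` {x}) = E `` ?R" by blast
  finally have 1: "sum len ?R = card ?R + sum len (E `` ?R)" .
  have "sum len ?R = sum len (E `` ?R) + sum len (front zs \<union> unused zs)"
    using sum.union_disjoint[OF fE _ *(2), of len] *(1) finite_front finite_unused by simp
  moreover have "sum len (front zs \<union> unused zs) = height zs + sum len (unused zs)"
    unfolding height_def using finite_front finite_unused front_unused_disjoint by (rule sum.union_disjoint)
  ultimately show ?thesis using 1 by simp
qed

lemma card_starts: "card starts = card V - card E"
proof -
  have "card (Range E) = card E"
    unfolding Range_snd
    by (rule card_image) (use E_left in \<open>auto simp: inj_on_def\<close>)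
  moreover have "Range E \<subseteq> V" using E_sub by auto
  ultimately show ?thesis unfolding starts_def
    using card_Diff_subset finite_V finite_subset by metis
qed

lemma card_unused_le: "card (unused zs) \<le> card (V - set zs)"
  using finite_V by (intro card_mono) (auto simp: unused_def starts_def)

lemma front_snoc:
  assumes "partial zs" "admissible zs x"
  shows "front (zs @ [x]) = (front zs - {x}) \<union> E `` {x}"
proof -
  have "y \<notin> set (zs @ [x])" if "(x, y) \<in> E" for y
  proof
    assume "y \<in> set (zs @ [x])"
    moreover have "y \<noteq> x" using that E_acyclic by (auto simp: acyclic_def)
    ultimately have "x \<in> set zs" using partial_closed[OF assms(1) that] by simp
    then show False using assms(2) by (simp add: admissible_def)
  qed
  then show ?thesis by (auto simp: front_def)
qed

lemma unused_snoc: "unused (zs @ [x]) = unused zs - {x}"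
  by (auto simp: unused_def)

lemma height_snoc:
  assumes "partial zs" "admissible zs x"
  shows "height (zs @ [x]) + 1 = sum len (front zs - {x}) + len x"
proof -
  have x: "x \<in> V" "x \<notin> set zs" using assms by (auto simp: admissible_def)
  have "(front zs - {x}) \<inter> E `` {x} = {}" using x E_left by (auto simp: front_def)
  moreover have "finite (E `` {x})" using front_snoc[OF assms] finite_front[of "zs @ [x]"] by simp
  ultimately have "height (zs @ [x]) = sum len (front zs - {x}) + sum len (E `` {x})"
    unfolding height_def front_snoc[OF assms] using finite_front by (intro sum.union_disjoint) auto
  then show ?thesis using len_rec[OF x(1)] by simp
qed

lemma height_snoc_front:
  assumes "partial zs" "admissible zs x" "x \<in> front zs"
  shows "height (zs @ [x]) + 1 = height zs"
  using height_snoc[OF assms(1,2)] sum.remove[OF finite_front assms(3), of len] by (simp add: height_def)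

lemma height_snoc_unused:
  assumes "partial zs" "admissible zs x" "x \<in> unused zs"
  shows "height (zs @ [x]) + 1 = height zs + len x"
proof -
  have "front zs - {x} = front zs" using assms(3) front_unused_disjoint by blast
  then show ?thesis using height_snoc[OF assms(1,2)] by (simp add: height_def)
qed

lemma card_remaining_snoc:
  assumes "admissible zs x"
  shows "card (V - set zs) = Suc (card (V - set (zs @ [x])))"
proof -
  have "V - set (zs @ [x]) = (V - set zs) - {x}" "x \<in> V - set zs"
    using assms by (auto simp: admissible_def)
  then show ?thesis using finite_V card.remove[of "V - set zs" x] by simp
qed

text \<open>The only admissible vertex of the front is the successor of the earliest placed vertex whose
  successor is still missing: arcs are closed first in, first out.\<close>

lemma admissible_set:
  assumes "partial zs"
  shows "\<exists>h. {x. admissible zs x} = unused zs \<union> h \<and> h \<subseteq> front zs \<and> card h = (if front zs = {} then 0 else 1)"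
proof -
  let ?h = "{x \<in> front zs. admissible zs x}"
  have "{x. admissible zs x} = unused zs \<union> ?h"
    by (auto simp: admissible_def unused_def starts_def front_def)
  moreover have "card ?h = (if front zs = {} then 0 else 1)"
  proof (cases "front zs = {}")
    case False
    let ?I = "{i. i < length zs \<and> (\<exists>b. (zs ! i, b) \<in> E \<and> b \<notin> set zs)}"
    obtain b0 a0 where "a0 \<in> set zs" "(a0, b0) \<in> E" "b0 \<notin> set zs"
      using False by (auto simp: front_def)
    then have "?I \<noteq> {}" by (auto simp: in_set_conv_nth)
    moreover have "finite ?I" by simp
    ultimately have I: "Min ?I \<in> ?I" "\<And>i. i \<in> ?I \<Longrightarrow> Min ?I \<le> i"
      using Min_in[of ?I] Min_le[of ?I] by blast+
    define i where "i = Min ?I"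
    obtain b where b: "i < length zs" "(zs ! i, b) \<in> E" "b \<notin> set zs" using I(1) i_def by blast
    have dz: "distinct zs" using assms by (simp add: partial_def)
    have "?h = {b}"
    proof (intro set_eqI iffI)
      fix x assume "x \<in> ?h"
      then obtain a where a: "a \<in> set zs" "(a, x) \<in> E" "x \<notin> set zs" "admissible zs x"
        by (auto simp: front_def)
      then obtain i' where i': "i' < length zs" "zs ! i' = a" by (auto simp: in_set_conv_nth)
      have "i \<le> i'" using I(2)[of i'] a i' i_def by blast
      moreover have "\<not> i < i'"
      proof
        assume "i < i'"
        then have "prec zs (zs ! i) a" using i' unfolding prec_def by blast
        then have "b \<in> set zs" using a(2,4) b(2) unfolding admissible_def by blast
        with b show False by blast
      qed
      ultimately have "zs ! i = a" using i' by simp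
      then show "x \<in> {b}" using a(2) b(2) E_right by blast
    next
      fix x assume "x \<in> {b}"
      moreover have "b \<in> front zs" using b by (auto simp: front_def)
      moreover have "admissible zs b"
        unfolding admissible_def
      proof (intro conjI allI impI)
        show "b \<in> V" using b E_sub by blast
        show "b \<notin> set zs" by fact
        fix a assume "(a, b) \<in> E"
        then have a: "a = zs ! i" using b E_left by blast
        then show "a \<in> set zs" using b by simp
        fix a' b' assume "(a', b') \<in> E" "prec zs a' a"
        then obtain p q where pq: "p < q" "q < length zs" "zs ! p = a'" "zs ! q = a"
          unfolding prec_def by blast
        then have "q = i" using a b dz nth_eq_iff_index_eq by metis
        then have "p \<notin> ?I" using I(2)[of p] pq(1) unfolding i_def by linarith
        then show "b' \<in> set zs" using pq \<open>(a', b') \<in> E\<close> by auto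
      qed
      ultimately show "x \<in> ?h" by blast
    qed
    then show ?thesis using False by simp
  qed simp
  ultimately show ?thesis by (intro exI[of _ ?h]) auto
qed

lemma finite_completion: "finite {xs. completion zs xs}"
proof (rule finite_subset)
  show "{xs. completion zs xs} \<subseteq> {xs. set xs \<subseteq> V \<and> distinct xs}"
  proof
    have "completion zs xs \<Longrightarrow> set xs \<subseteq> V \<and> distinct xs \<and> set xs \<inter> set zs = {}" for zs xs
      by (induction xs arbitrary: zs) (force simp: admissible_def)+
    then show "xs \<in> {xs. completion zs xs} \<Longrightarrow> xs \<in> {xs. set xs \<subseteq> V \<and> distinct xs}" for xs by blast
  qed
  show "finite {xs. set xs \<subseteq> V \<and> distinct xs}" by (rule finite_subset_distinct[OF finite_V])
qed

lemma card_completion_step: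
  assumes "V - set zs \<noteq> {}"
  shows "card {xs. completion zs xs \<and> Q xs} =
    (\<Sum>x\<in>{x. admissible zs x}. card {xs. completion (zs @ [x]) xs \<and> Q (x # xs)})"
proof -
  let ?S = "\<lambda>x. {xs. completion (zs @ [x]) xs \<and> Q (x # xs)}"
  have fin: "finite (?S x)" for x
    by (rule finite_subset[OF _ finite_completion[of "zs @ [x]"]]) auto
  have "{xs. completion zs xs \<and> Q xs} = (\<Union>x\<in>{x. admissible zs x}. (#) x ` ?S x)"
  proof (rule set_eqI)
    fix xs show "xs \<in> {xs. completion zs xs \<and> Q xs} \<longleftrightarrow> xs \<in> (\<Union>x\<in>{x. admissible zs x}. (#) x ` ?S x)"
      using assms by (cases xs) auto
  qed
  also have "card \<dots> = (\<Sum>x\<in>{x. admissible zs x}. card ((#) x ` ?S x))"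
  proof (rule card_UN_disjoint)
    show "finite {x. admissible zs x}"
      by (rule finite_subset[OF _ finite_V]) (auto simp: admissible_def)
  qed (use fin in auto)
  finally show ?thesis by (simp add: card_image)
qed

end

text \<open>Number of ways to finish from a state with \<open>q\<close> unused starts, \<open>c\<close> other missing vertices,
  \<open>H\<close> of them on paths already begun, so that the front is empty at exactly \<open>j\<close> of the
  remaining moments before the end.\<close>

definition touch_count :: "nat \<Rightarrow> nat \<Rightarrow> nat \<Rightarrow> nat \<Rightarrow> real" where
  "touch_count H q c j =
     (if q = 0 then if j = 0 then 1 else 0
      else if q < j then 0
      else fact (q - 1) * (real j * real (c + (q - j) - 1 choose (q - j)) +
             (if j = q then 0 else real H * real (c + (q - j) - 1 choose (q - j - 1)))))"

text \<open>The binomial identity that, together with Pascal's rule, drives both recursions of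
  \<open>touch_count\<close>; for positive \<open>c\<close> both sides are
  \<open>(c + r)! / ((c - 1)! r!)\<close>.\<close>

lemma choose_absorb: "c * (c + r choose r) = (r + 1) * (c + r choose Suc r)"
  using binomial_absorb_comp[of "c + r" r] binomial_absorption[of r "c + r"] by simp

text \<open>The step from an empty front: one moment is used up and some path is begun, with
  \<open>t x\<close> points left on it after its start. Since \<open>touch_count\<close> is affine
  in the height, the sum needs only that the \<open>t x\<close> add up to \<open>c\<close>.\<close>

lemma touch_count_push:
  assumes U: "finite U" "card U = Suc q" and t: "(\<Sum>x\<in>U. t x) = c"
  shows "touch_count 0 (Suc q) c j = (if j = 0 then 0 else \<Sum>x\<in>U. touch_count (t x) q c (j - 1))"
proof (cases j)
  case 0
  then show ?thesis by (simp add: touch_count_def)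
next
  case (Suc i)
  have tr: "(\<Sum>x\<in>U. real (t x)) = real c" using t by (metis of_nat_sum)
  show ?thesis
  proof (cases "q = 0")
    case True
    with Suc U show ?thesis by (auto simp: touch_count_def)
  next
    case q: False
    consider "i > q" | "i = q" | r where "q = i + Suc r" by (metis less_imp_Suc_add add_Suc_right linorder_neqE_nat)
    then show ?thesis
    proof cases
      case 2
      with q U Suc show ?thesis by (simp add: touch_count_def fact_reduce[of q])
    next
      case (3 r)
      have "(\<Sum>x\<in>U. touch_count (t x) q c i) =
        (\<Sum>x\<in>U. fact (q - 1) * (real i * real (c + r choose Suc r)) + (fact (q - 1) * real (c + r choose r)) * real (t x))"
        using 3 by (intro sum.cong) (auto simp: touch_count_def algebra_simps)
      also have "\<dots> = real (Suc q) * fact (q - 1) * (real i * real (c + r choose Suc r)) + fact (q - 1) * (real c * real (c + r choose r))"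
        unfolding sum.distrib sum_distrib_left[symmetric] tr using U(2) by simp
      also have "real c * real (c + r choose r) = real (r + 1) * real (c + r choose Suc r)"
        using choose_absorb[of c r] by (metis of_nat_mult)
      also have "real (Suc q) * fact (q - 1) * (real i * real (c + r choose Suc r)) +
          fact (q - 1) * (real (r + 1) * real (c + r choose Suc r)) =
          fact (q - 1) * real (c + r choose Suc r) * (real (Suc q) * real i + real (r + 1))"
        by (simp add: algebra_simps)
      \<comment> \<open>Here \<open>q = i + r + 1\<close> enters: \<open>i + r + 1\<close> on the
        left is another \<open>q\<close>.\<close>
      also have "real (Suc q) * real i + real (r + 1) = real q * real (Suc i)"
        using 3 by (simp add: algebra_simps)
      also have "fact (q - 1) * real (c + r choose Suc r) * (real q * real (Suc i)) =
          fact q * real (c + r choose Suc r) * real (Suc i)"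
        using q by (simp add: fact_reduce[of q])
      finally show ?thesis using 3 Suc by (simp add: touch_count_def)
    qed (use Suc U q in \<open>auto simp: touch_count_def\<close>)
  qed
qed

text \<open>The step from a nonempty front: either the oldest open arc closes, which lowers height
  and \<open>c\<close> by one, or a new path is begun, which leaves \<open>c\<close> unchanged
  because starts are not counted in it. No moment is used up.\<close>

lemma touch_count_pop:
  assumes U: "finite U" "card U = q" and t: "Suc H + (\<Sum>x\<in>U. t x) = Suc c"
  shows "touch_count (Suc H) q (Suc c) j =
    touch_count H q c j + (\<Sum>x\<in>U. touch_count (Suc H + t x) (q - 1) (Suc c) j)"
proof -
  have "(\<Sum>x\<in>U. real (t x)) = real (\<Sum>x\<in>U. t x)" by simp
  also have "(\<Sum>x\<in>U. t x) = c - H" using t by simp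
  also have "real (c - H) = real c - real H" using t by simp
  finally have tr: "(\<Sum>x\<in>U. real (t x)) = real c - real H" .
  consider "q = 0" | "q = 1" | p where "q = Suc (Suc p)" by (metis One_nat_def not0_implies_Suc)
  then show ?thesis
  proof cases
    case 1
    with U show ?thesis by (simp add: touch_count_def)
  next
    case 2
    with U show ?thesis by (auto simp: touch_count_def)
  next
    case (3 p)
    consider "j > q" | "j = q" | "Suc j = q" | r where "q = j + Suc (Suc r)"
      by (metis less_imp_Suc_add add_Suc_right linorder_neqE_nat nat_neq_iff add_0_right not0_implies_Suc)
    then show ?thesis
    proof cases
      case 1
      with 3 show ?thesis by (simp add: touch_count_def)
    next
      case 2
      with 3 show ?thesis by (simp add: touch_count_def)
    next
      case j: 3
      then have "j = Suc p" using 3 by simp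
      then show ?thesis using 3 U by (simp add: touch_count_def algebra_simps)
    next
      case (4 r)
      then have p: "p = j + r" and q: "q = Suc (Suc (j + r))" using 3 by auto
      \<comment> \<open>Pascal's rule turns the binomials for \<open>Suc c\<close> into
        \<open>A + B\<close> and \<open>B + C\<close>, so the claim becomes linear in
        \<open>A\<close>, \<open>B\<close>, \<open>C\<close>. Summing over \<open>U\<close> leaves a
        term \<open>(c + 1) * C\<close>, which absorption converts into a multiple of
        \<open>B\<close>.\<close>
      define A B C where "A = real (c + Suc r choose Suc (Suc r))" and "B = real (c + Suc r choose Suc r)"
        and "C = real (c + Suc r choose r)"
      have C: "(real c + 1) * C = (real r + 1) * B"
        using choose_absorb[of "Suc c" r] unfolding B_def C_def
        by (metis Suc_eq_plus1 add_Suc_right add_Suc_shift of_nat_1 of_nat_add of_nat_mult)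
      have "(\<Sum>x\<in>U. touch_count (Suc H + t x) (q - 1) (Suc c) j) =
         (\<Sum>x\<in>U. fact p * (real j * B + (real H + 1) * C) + fact p * C * real (t x))"
        using 3 4 unfolding A_def B_def C_def
        by (intro sum.cong) (auto simp: touch_count_def algebra_simps)
      also have "\<dots> = real q * fact p * (real j * B + (real H + 1) * C) + fact p * C * (real c - real H)"
        unfolding sum.distrib sum_distrib_left[symmetric] tr using U(2) by (simp add: algebra_simps)
      also have "\<dots> = fact p * (real q * real j * B + (real q * (real H + 1) - (real H + 1)) * C + (real c + 1) * C)"
        by (simp add: algebra_simps)
      also have "\<dots> = fact p * (real q * real j * B + (real q - 1) * (real H + 1) * C + (real r + 1) * B)"
        unfolding C by (simp add: algebra_simps)
      also have "\<dots> = fact p * (real q - 1) * ((real j + 1) * B + (real H + 1) * C)"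
        using 4 by (simp add: algebra_simps)
      also have "fact p * (real q - 1) = fact (Suc p)" using 3 by simp
      finally have S: "(\<Sum>x\<in>U. touch_count (Suc H + t x) (q - 1) (Suc c) j) =
        fact (Suc p) * ((real j + 1) * B + (real H + 1) * C)" .
      have "touch_count H q c j = fact (Suc p) * (real j * A + real H * B)"
        unfolding p q by (simp add: touch_count_def A_def B_def)
      moreover have "touch_count (Suc H) q (Suc c) j = fact (Suc p) * (real j * (A + B) + (real H + 1) * (B + C))"
        unfolding p q by (simp add: touch_count_def A_def B_def C_def algebra_simps)
      ultimately show ?thesis unfolding S by (simp add: algebra_simps)
    qed
  qed
qed

text \<open>At height \<open>0\<close> only the first binomial is left, giving
  \<open>d (k-1)!\<close> times \<open>n-d-1\<close> over \<open>k-d\<close>. For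
  \<open>k = n\<close> and \<open>d < n\<close> this binomial is \<open>0\<close>, which is the
  reading fixed in \<open>freedom_count\<close>.\<close>

lemma touch_count_start:
  assumes "1 \<le> d" "d \<le> k" "k \<le> n"
  shows "touch_count 0 k (n - k) d = freedom_count n k d"
proof (cases "k = n")
  case True
  show ?thesis
  proof (cases "d = n")
    case True
    then show ?thesis using \<open>k = n\<close> assms fact_reduce[of n, where 'a = real]
      by (simp add: touch_count_def freedom_count_def)
  next
    case False
    then show ?thesis using \<open>k = n\<close> assms by (simp add: touch_count_def freedom_count_def)
  qed
next
  case False
  have e: "n - k + (k - d) - 1 = n - d - 1" "n - d - 1 - (k - d) = n - k - 1" using assms False by auto
  have "real (n - d - 1 choose (k - d)) = fact (n - d - 1) / (fact (k - d) * fact (n - d - 1 - (k - d)))"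
    using assms False by (intro binomial_fact) auto
  then show ?thesis using assms False unfolding touch_count_def freedom_count_def e
    by (simp add: e field_simps)
qed

section \<open>Counting the completions of a prefix\<close>

context path_system
begin

lemma completion_full:
  assumes "partial zs" "V - set zs = {}"
  shows "completion zs xs \<longleftrightarrow> xs = []" "height zs = 0" "unused zs = {}"
proof -
  have "set zs = V" using assms by (auto simp: partial_def)
  then show "completion zs xs \<longleftrightarrow> xs = []" by (cases xs) (auto simp: admissible_def)
  show "height zs = 0" using height_plus_unused[OF assms(1)] assms(2) by simp
  show "unused zs = {}" using assms(2) by (auto simp: unused_def starts_def)
qed

lemma card_unused_snoc:
  assumes "x \<in> unused zs"
  shows "card (unused zs) = Suc (card (unused (zs @ [x])))"
  unfolding unused_snoc using assms finite_unused[of zs] by (metis card.remove)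

lemma unused_snoc_front: "x \<in> front zs \<Longrightarrow> unused (zs @ [x]) = unused zs"
  unfolding unused_snoc using front_unused_disjoint by blast

lemma sum_admissible:
  assumes "partial zs" "\<And>x. x \<in> front zs \<Longrightarrow> admissible zs x \<Longrightarrow> f x = v"
  shows "(\<Sum>x\<in>{x. admissible zs x}. f x) = (\<Sum>x\<in>unused zs. f x) + (if front zs = {} then 0 else v :: real)"
proof -
  obtain h where h: "{x. admissible zs x} = unused zs \<union> h" "h \<subseteq> front zs"
    "card h = (if front zs = {} then 0 else 1)" using admissible_set[OF assms(1)] by blast
  have fh: "finite h" using h(2) finite_front finite_subset by blast
  have "unused zs \<inter> h = {}" using h(2) front_unused_disjoint by blast
  then have "(\<Sum>x\<in>{x. admissible zs x}. f x) = sum f (unused zs) + sum f h"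
    unfolding h(1) by (rule sum.union_disjoint[OF finite_unused fh])
  moreover have "sum f h = (\<Sum>x\<in>h. v)"
    using h assms(2) by (intro sum.cong) auto
  ultimately show ?thesis using h(3) by simp
qed

lemma admissible_unused: "x \<in> unused zs \<Longrightarrow> admissible zs x"
  by (auto simp: unused_def starts_def admissible_def)

lemma card_completion:
  "partial zs \<Longrightarrow> real (card {xs. completion zs xs}) =
     real (height zs + 1) * fact (card (V - set zs)) / fact (card (V - set zs) - card (unused zs) + 1)"
proof (induction "card (V - set zs)" arbitrary: zs)
  case 0
  then have "V - set zs = {}" using finite_V by simp
  then show ?case using completion_full[OF 0(2)] 0(1) by simp
next
  case (Suc m)
  define H q c where "H = real (height zs)" and "q = card (unused zs)" and "c = Suc m - q"
  define F :: real where "F = fact m / fact (c + 1)"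
  let ?C = "\<lambda>x. real (card {xs. completion (zs @ [x]) xs})"
  have ne: "V - set zs \<noteq> {}" using Suc(2) by (metis card.empty nat.distinct(1))
  have m: "card (V - set (zs @ [x])) = m" if "admissible zs x" for x
    using card_remaining_snoc[OF that] Suc(2) by simp
  have IH: "?C x = real (height (zs @ [x]) + 1) * fact m / fact (m - card (unused (zs @ [x])) + 1)"
    if "admissible zs x" for x
    using Suc(1)[of "zs @ [x]"] m[OF that] that Suc.prems partial_snoc by auto
  have U: "?C x = (H + real (len x)) * (fact m / fact (c + 1))" if "x \<in> unused zs" for x
  proof -
    have a: "admissible zs x" using that by (rule admissible_unused)
    have "m - card (unused (zs @ [x])) = c" using card_unused_snoc[OF that] by (simp add: c_def q_def)
    then show ?thesis using IH[OF a] height_snoc_unused[OF Suc.prems a that] by (simp add: H_def)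
  qed
  have F: "?C x = H * (fact m / fact c)" if "x \<in> front zs" "admissible zs x" for x
  proof -
    have u: "unused (zs @ [x]) = unused zs" using that(1) by (rule unused_snoc_front)
    then have "q \<le> m" using card_unused_le[of "zs @ [x]"] m[OF that(2)] by (simp add: q_def)
    then have "m - card (unused (zs @ [x])) + 1 = c" unfolding u by (simp add: c_def q_def)
    then show ?thesis using IH[OF that(2)] height_snoc_front[OF Suc.prems that(2,1)] by (simp add: H_def)
  qed
  have qm: "q \<le> Suc m" using card_unused_le[of zs] Suc(2) by (simp add: q_def)
  have "real (card {xs. completion zs xs}) = (\<Sum>x\<in>{x. admissible zs x}. ?C x)"
    using card_completion_step[OF ne, of "\<lambda>_. True"] by simp
  also have "\<dots> = (\<Sum>x\<in>unused zs. ?C x) + (if front zs = {} then 0 else H * (fact m / fact c))"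
    using F by (rule sum_admissible[OF Suc.prems])
  \<comment> \<open>An empty front has height \<open>0\<close>, so one formula covers both
    cases.\<close>
  also have "(if front zs = {} then 0 else H * (fact m / fact c)) = H * (fact m / fact c)"
    using height_eq_0_iff by (simp add: H_def)
  also have "(\<Sum>x\<in>unused zs. ?C x) = (\<Sum>x\<in>unused zs. (H + real (len x)) * F)"
    using U by (simp add: F_def)
  also have "\<dots> = (real q * H + real (sum len (unused zs))) * F"
    unfolding sum_distrib_right[symmetric] sum.distrib by (simp add: q_def)
  also have "real (sum len (unused zs)) = real (Suc m) - H"
    using height_plus_unused[OF Suc.prems] Suc(2) unfolding H_def by linarith
  also have "H * (fact m / fact c) = H * real (c + 1) * F"
  proof -
    have "real (c + 1) \<noteq> 0" by linarith
    moreover have "(fact (c + 1) :: real) = real (c + 1) * fact c" by simp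
    ultimately show ?thesis unfolding F_def by (simp del: of_nat_add fact_Suc)
  qed
  also have "(real q * H + (real (Suc m) - H)) * F + \<dots> = (H * (real q + real c) + real (Suc m)) * F"
    by (simp add: algebra_simps)
  also have "real q + real c = real (Suc m)" using qm by (simp add: c_def)
  also have "(H * real (Suc m) + real (Suc m)) * F = (H + 1) * (real (Suc m) * F)"
    by (simp add: algebra_simps)
  also have "real (Suc m) * F = fact (Suc m) / fact (c + 1)" by (simp add: F_def)
  finally have "real (card {xs. completion zs xs}) = (H + 1) * (fact (Suc m) / fact (c + 1))" .
  then show ?case using Suc(2) by (simp add: c_def q_def H_def del: fact_Suc)
qed

text \<open>The same induction, with \<open>touch_count_push\<close> as the recursion at an empty
  front and \<open>touch_count_pop\<close> otherwise.\<close>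

lemma card_completion_touches:
  "partial zs \<Longrightarrow> real (card {xs. completion zs xs \<and> touches zs xs = j}) =
     touch_count (height zs) (card (unused zs)) (card (V - set zs) - card (unused zs)) j"
proof (induction "card (V - set zs)" arbitrary: zs j)
  case 0
  then have "V - set zs = {}" using finite_V by simp
  then have "{xs. completion zs xs \<and> touches zs xs = j} = (if j = 0 then {[]} else {})"
    "card (unused zs) = 0"
    using completion_full[OF 0(2)] by auto
  then show ?case by (simp add: touch_count_def)
next
  case (Suc m)
  define H q c where "H = height zs" and "q = card (unused zs)" and "c = Suc m - q"
  have ne: "V - set zs \<noteq> {}" using Suc(2) by (metis card.empty nat.distinct(1))
  have m: "card (V - set (zs @ [x])) = m" if "admissible zs x" for x
    using card_remaining_snoc[OF that] Suc(2) by simp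
  have qm: "q \<le> Suc m" using card_unused_le[of zs] Suc(2) by (simp add: q_def)
  have IH: "real (card {xs. completion (zs @ [x]) xs \<and> touches (zs @ [x]) xs = i}) =
      touch_count (height (zs @ [x])) (card (unused (zs @ [x]))) (m - card (unused (zs @ [x]))) i"
    if "admissible zs x" for x i
    using Suc(1)[of "zs @ [x]"] m[OF that] that Suc.prems partial_snoc by auto
  have len1: "len x \<ge> 1" if "x \<in> unused zs" for x
    using len_rec[of x] that by (auto simp: unused_def starts_def)
  have U: "real (card {xs. completion (zs @ [x]) xs \<and> touches (zs @ [x]) xs = i}) =
      touch_count (H + (len x - 1)) (q - 1) c i" if "x \<in> unused zs" for x i
  proof -
    have a: "admissible zs x" using that by (rule admissible_unused)
    have "height (zs @ [x]) = H + (len x - 1)"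
      using height_snoc_unused[OF Suc.prems a that] len1[OF that] by (simp add: H_def)
    then show ?thesis using IH[OF a, of i] card_unused_snoc[OF that] by (simp add: c_def q_def)
  qed
  have "sum len (unused zs) = (\<Sum>x\<in>unused zs. (len x - 1) + 1)"
    using len1 by (intro sum.cong refl) (metis le_add_diff_inverse2)
  then have "sum len (unused zs) = (\<Sum>x\<in>unused zs. len x - 1) + q"
    by (simp only: sum.distrib) (simp add: q_def)
  then have t: "H + (\<Sum>x\<in>unused zs. len x - 1) = c"
    using height_plus_unused[OF Suc.prems] Suc(2) by (simp add: c_def H_def)
  show ?case
  proof (cases "front zs = {}")
    case True
    then have H0: "H = 0" using height_eq_0_iff by (simp add: H_def)
    have q0: "q \<noteq> 0"
    proof
      assume "q = 0"
      then have "unused zs = {}" using finite_unused by (simp add: q_def)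
      then show False using t H0 \<open>q = 0\<close> by (simp add: c_def)
    qed
    then obtain p where p: "q = Suc p" using not0_implies_Suc by blast
    have "real (card {xs. completion zs xs \<and> touches zs xs = j}) =
      (\<Sum>x\<in>{x. admissible zs x}. real (card {xs. completion (zs @ [x]) xs \<and> Suc (touches (zs @ [x]) xs) = j}))"
      using card_completion_step[OF ne, of "\<lambda>xs. touches zs xs = j"] True by simp
    also have "\<dots> = (\<Sum>x\<in>unused zs. real (card {xs. completion (zs @ [x]) xs \<and> Suc (touches (zs @ [x]) xs) = j}))"
      using sum_admissible[OF Suc.prems, of _ 0] True by simp
    also have "\<dots> = (if j = 0 then 0 else \<Sum>x\<in>unused zs. touch_count (len x - 1) p c (j - 1))"
    proof (cases j)
      case (Suc i)
      have "real (card {xs. completion (zs @ [x]) xs \<and> Suc (touches (zs @ [x]) xs) = j}) =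
          touch_count (len x - 1) p c i" if "x \<in> unused zs" for x
        using U[OF that, of i] H0 p Suc by simp
      then show ?thesis using Suc by simp
    qed simp
    also have "\<dots> = touch_count 0 q c j"
      unfolding p using t H0 p by (intro touch_count_push[symmetric]) (auto simp: finite_unused q_def)
    finally show ?thesis using H0 by (simp add: H_def q_def c_def Suc(2)[symmetric])
  next
    case False
    then obtain K where K: "H = Suc K" using height_eq_0_iff not0_implies_Suc by (metis H_def)
    then obtain c' where c': "c = Suc c'" using t by (cases c) auto
    have F: "real (card {xs. completion (zs @ [x]) xs \<and> touches (zs @ [x]) xs = j}) = touch_count K q c' j"
      if "x \<in> front zs" "admissible zs x" for x
    proof -
      have u: "unused (zs @ [x]) = unused zs" using that(1) by (rule unused_snoc_front)
      have "m - q = c'" using c' by (simp add: c_def)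
      moreover have "height (zs @ [x]) = K" using height_snoc_front[OF Suc.prems that(2,1)] K by (simp add: H_def)
      ultimately show ?thesis using IH[OF that(2), of j] by (simp add: u q_def)
    qed
    have "real (card {xs. completion zs xs \<and> touches zs xs = j}) =
      (\<Sum>x\<in>{x. admissible zs x}. real (card {xs. completion (zs @ [x]) xs \<and> touches (zs @ [x]) xs = j}))"
      using card_completion_step[OF ne, of "\<lambda>xs. touches zs xs = j"] False by simp
    also have "\<dots> = (\<Sum>x\<in>unused zs. touch_count (H + (len x - 1)) (q - 1) c j) + touch_count K q c' j"
      using sum_admissible[OF Suc.prems F] False U by simp
    also have "\<dots> = touch_count H q c j"
      using t unfolding K c'
      by (subst touch_count_pop[of "unused zs" _ _ "\<lambda>x. len x - 1"]) (auto simp: finite_unused q_def)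
    finally show ?thesis by (simp add: H_def q_def c_def Suc(2)[symmetric])
  qed
qed

lemma unused_Nil: "unused [] = starts" and height_Nil: "height [] = 0"
  by (auto simp: unused_def height_def front_def)

theorem card_nonnesting:
  assumes "card V = n" "card E = n - k" "k \<le> n"
  shows "real (card {xs. nonnesting V E xs}) = fact n / fact (n - k + 1)"
    and "1 \<le> d \<Longrightarrow> d \<le> k \<Longrightarrow>
      real (card {xs. nonnesting V E xs \<and> card (uncrossed E xs) = d}) = freedom_count n k d"
proof -
  have k: "card starts = k" using card_starts assms by simp
  show "real (card {xs. nonnesting V E xs}) = fact n / fact (n - k + 1)"
    using card_completion[OF partial_Nil] k assms
    by (simp add: nonnesting_iff_completion unused_Nil height_Nil)
  assume "1 \<le> d" "d \<le> k"
  then show "real (card {xs. nonnesting V E xs \<and> card (uncrossed E xs) = d}) = freedom_count n k d"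
    using card_completion_touches[OF partial_Nil, of d] k assms touch_count_start[of d k n]
    by (simp add: nonnesting_iff_completion unused_Nil height_Nil touches_eq_uncrossed)
qed

end

subsection \<open>Arcs of set partitions\<close>

lemma arcs_less: "(i, j) \<in> arcs P \<Longrightarrow> i < j"
  by (simp add: arcs_def)

lemma arcs_subset_pairs:
  assumes "partition_on {1..n} P"
  shows "arcs P \<subseteq> pairs_upto n"
proof -
  have "B \<subseteq> {1..n}" if "B \<in> P" for B using assms that by (auto simp: partition_on_def)
  then show ?thesis by (force simp: arcs_def pairs_upto_def)
qed

lemma finite_pairs_upto: "finite (pairs_upto n)"
  by (rule finite_subset[of _ "{1..n} \<times> {1..n}"]) (auto simp: pairs_upto_def)

lemma partition_on_same_block:
  assumes "partition_on A P" "B \<in> P" "B' \<in> P" "x \<in> B" "x \<in> B'"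
  shows "B = B'"
  using disjointD[OF partition_onD2[OF assms(1)] assms(2,3)] assms(4,5) by blast

lemma arcs_right:
  assumes "partition_on A P" "(i, j) \<in> arcs P" "(i, j') \<in> arcs P"
  shows "j = j'"
proof -
  obtain B where B: "B \<in> P" "i \<in> B" "j \<in> B" "\<forall>m\<in>B. \<not> (i < m \<and> m < j)"
    using assms(2) by (auto simp: arcs_def)
  obtain B' where B': "B' \<in> P" "i \<in> B'" "j' \<in> B'" "\<forall>m\<in>B'. \<not> (i < m \<and> m < j')"
    using assms(3) by (auto simp: arcs_def)
  have "B = B'" using partition_on_same_block[OF assms(1)] B B' by blast
  then show ?thesis using B B' assms(2,3) by (metis arcs_less linorder_neqE_nat)
qed

lemma arcs_left:
  assumes "partition_on A P" "(i, j) \<in> arcs P" "(i', j) \<in> arcs P"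
  shows "i = i'"
proof -
  obtain B where B: "B \<in> P" "i \<in> B" "j \<in> B" "\<forall>m\<in>B. \<not> (i < m \<and> m < j)"
    using assms(2) by (auto simp: arcs_def)
  obtain B' where B': "B' \<in> P" "i' \<in> B'" "j \<in> B'" "\<forall>m\<in>B'. \<not> (i' < m \<and> m < j)"
    using assms(3) by (auto simp: arcs_def)
  have "B = B'" using partition_on_same_block[OF assms(1)] B B' by blast
  then show ?thesis using B B' assms(2,3) by (metis arcs_less linorder_neqE_nat)
qed

lemma arcs_rtrancl_same_block:
  assumes "partition_on A P" "B \<in> P" "i \<in> B" "(i, j) \<in> (arcs P)\<^sup>*"
  shows "j \<in> B"
  using assms(4)
proof (induction rule: rtrancl_induct)
  case (step j k)
  then obtain B' where "B' \<in> P" "j \<in> B'" "k \<in> B'" by (auto simp: arcs_def)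
  then show ?case using partition_on_same_block[OF assms(1)] assms(2) step.IH by blast
qed (rule assms(3))

lemma same_block_arcs_rtrancl:
  "B \<in> P \<Longrightarrow> i \<in> B \<Longrightarrow> j \<in> B \<Longrightarrow> i \<le> j \<Longrightarrow> (i, j) \<in> (arcs P)\<^sup>*"
proof (induction "j - i" arbitrary: i rule: less_induct)
  case less
  show ?case
  proof (cases "i = j")
    case False
    let ?m = "LEAST m. m \<in> B \<and> i < m"
    have ex: "j \<in> B \<and> i < j" using less.prems False by auto
    have m: "?m \<in> B \<and> i < ?m" using ex by (rule LeastI)
    have mj: "?m \<le> j" using ex by (rule Least_le)
    have "(i, ?m) \<in> arcs P"
      using m less.prems not_less_Least[of _ "\<lambda>m. m \<in> B \<and> i < m"] by (auto simp: arcs_def)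
    moreover have "(?m, j) \<in> (arcs P)\<^sup>*"
      using less.hyps[of ?m] less.prems m mj False by auto
    ultimately show ?thesis by (rule converse_rtrancl_into_rtrancl)
  qed simp
qed

text \<open>A block lies in what the arcs reach from its minimum, and arcs never leave a block; so
  equal arcs keep the block of one partition together in the other.\<close>

lemma arcs_eq_imp_refines:
  assumes P: "partition_on A P" and P': "partition_on A P'" and "finite A" and "arcs P = arcs P'"
    and B: "B \<in> P"
  obtains B' where "B' \<in> P'" "B \<subseteq> B'"
proof -
  have ne: "B \<noteq> {}" and BA: "B \<subseteq> A" using P B by (auto simp: partition_on_def)
  then have f: "finite B" using assms(3) finite_subset by blast
  have "Min B \<in> A" using Min_in[OF f ne] BA by blast
  then obtain B' where B': "B' \<in> P'" "Min B \<in> B'" using P' by (auto simp: partition_on_def)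
  have "x \<in> B'" if "x \<in> B" for x
  proof (rule arcs_rtrancl_same_block[OF P' B'])
    show "(Min B, x) \<in> (arcs P')\<^sup>*"
      using same_block_arcs_rtrancl[OF B Min_in[OF f ne] that] f that assms(4) by simp
  qed
  then show thesis using that B' by blast
qed

lemma arcs_inject:
  assumes P: "partition_on A P" and P': "partition_on A P'" and "finite A" and "arcs P = arcs P'"
  shows "P = P'"
proof -
  have "P \<subseteq> P'" if P: "partition_on A P" and P': "partition_on A P'" and eq: "arcs P = arcs P'" for P P'
  proof
    fix B assume B: "B \<in> P"
    obtain B' where B': "B' \<in> P'" "B \<subseteq> B'" using arcs_eq_imp_refines[OF P P' assms(3) eq B] .
    obtain B'' where B'': "B'' \<in> P" "B' \<subseteq> B''" using arcs_eq_imp_refines[OF P' P assms(3) eq[symmetric] B'(1)] .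
    have "B \<noteq> {}" using P B by (auto simp: partition_on_def)
    then have "B = B''" using partition_on_same_block[OF P B B''(1)] B' B'' by blast
    then show "B \<in> P'" using B' B'' by auto
  qed
  then show ?thesis using assms by (metis subset_antisym)
qed

text \<open>Every element is the right end of exactly one arc, except the minimum of each block,
  which is the right end of none.\<close>

lemma card_arcs:
  assumes P: "partition_on A P" and A: "finite A"
  shows "card (arcs P) + card P = card A"
proof -
  have blk: "finite B" "B \<noteq> {}" "B \<subseteq> A" if "B \<in> P" for B
  proof -
    show "B \<subseteq> A" "B \<noteq> {}" using P that by (auto simp: partition_on_def)
    then show "finite B" using A finite_subset by blast
  qed
  have min: "Min B \<in> B" if "B \<in> P" for B using Min_in blk(1,2)[OF that] by blast
  have "inj_on Min P"
    using partition_on_same_block[OF P] min by (metis inj_onI)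
  then have cM: "card (Min ` P) = card P" by (rule card_image)
  have sub: "Min ` P \<subseteq> A" using min blk(3) by blast
  have "inj_on snd (arcs P)" using arcs_left[OF P] by (auto simp: inj_on_def)
  then have "card (arcs P) = card (snd ` arcs P)" by (simp add: card_image)
  also have "snd ` arcs P = A - Min ` P"
  proof (intro set_eqI iffI)
    fix j assume "j \<in> snd ` arcs P"
    then obtain i B where B: "i < j" "B \<in> P" "i \<in> B" "j \<in> B" by (auto simp: arcs_def)
    have "j \<noteq> Min B'" if "B' \<in> P" for B'
    proof
      assume j: "j = Min B'"
      then have "B' = B" using partition_on_same_block[OF P that B(2)] B(4) min[OF that] by metis
      then show False using j B(1,3) Min_le[OF blk(1)[OF B(2)], of i] by simp
    qed
    then show "j \<in> A - Min ` P" using B(2,4) blk(3) by blast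
  next
    fix j assume j: "j \<in> A - Min ` P"
    then obtain B where B: "B \<in> P" "j \<in> B" using P by (auto simp: partition_on_def)
    let ?L = "{i \<in> B. i < j}"
    have "Min B \<noteq> j" using j B(1) by blast
    then have "Min B \<in> ?L" using min[OF B(1)] Min_le[OF blk(1)[OF B(1)] B(2)] by simp
    moreover have fL: "finite ?L" using blk[OF B(1)] by simp
    ultimately have "Max ?L \<in> ?L" using Max_in by blast
    moreover have "\<not> (Max ?L < m \<and> m < j)" if "m \<in> B" for m
    proof
      assume m: "Max ?L < m \<and> m < j"
      then have "m \<le> Max ?L" using Max_ge[OF fL, of m] that by blast
      with m show False by simp
    qed
    ultimately have "Max ?L < j" "\<exists>B\<in>P. Max ?L \<in> B \<and> j \<in> B \<and> (\<forall>m\<in>B. \<not> (Max ?L < m \<and> m < j))"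
      using B by blast+
    then have "(Max ?L, j) \<in> arcs P" unfolding arcs_def by blast
    then show "j \<in> snd ` arcs P" by force
  qed
  also have "card (A - Min ` P) = card A - card P"
    using card_Diff_subset[OF finite_subset[OF sub A] sub] cM by simp
  finally show ?thesis using card_mono[OF A sub] cM by simp
qed

text \<open>The blocks are the chains of \<open>E\<close>. This is what makes the pairs read off
  from the ceilings of a region the arcs of a partition.\<close>

lemma ex_partition_arcs:
  assumes E: "E \<subseteq> pairs_upto n"
    and right: "\<And>i j j'. (i, j) \<in> E \<Longrightarrow> (i, j') \<in> E \<Longrightarrow> j = j'"
    and left: "\<And>i i' j. (i, j) \<in> E \<Longrightarrow> (i', j) \<in> E \<Longrightarrow> i = i'"
  obtains P where "partition_on {1..n} P" "arcs P = E"
proof -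
  have lt: "i < j" "i \<in> {1..n}" "j \<in> {1..n}" if "(i, j) \<in> E" for i j
    using E that by (auto simp: pairs_upto_def)
  have le: "i \<le> j" if "(i, j) \<in> E\<^sup>*" for i j
    using that by (induction rule: rtrancl_induct) (use lt(1) in fastforce)+
  \<comment> \<open>Comparability under reachability is transitive because \<open>E\<close> branches
    neither forwards nor backwards: two points that reach a common point, or are reached from one,
    lie on one chain.\<close>
  define r where "r = {(x, y). x \<in> {1..n} \<and> y \<in> {1..n} \<and> ((x, y) \<in> E\<^sup>* \<or> (y, x) \<in> E\<^sup>*)}"
  have sv: "single_valued E" "single_valued (E\<inverse>)"
    using right left by (auto simp: single_valued_def)
  have "equiv {1..n} r"
  proof (rule equivI)
    show "r \<subseteq> {1..n} \<times> {1..n}" by (auto simp: r_def)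
    show "refl_on {1..n} r" by (auto simp: refl_on_def r_def)
    show "sym r" by (auto simp: sym_def r_def)
    show "trans r"
    proof (rule transI)
      fix x y z assume xy: "(x, y) \<in> r" and yz: "(y, z) \<in> r"
      have "(x, z) \<in> E\<^sup>* \<or> (z, x) \<in> E\<^sup>*"
      proof -
        have 1: "(x, y) \<in> E\<^sup>* \<Longrightarrow> (z, y) \<in> E\<^sup>* \<Longrightarrow> ?thesis"
          using single_valued_confluent[OF sv(2), of y x z] by (auto simp: rtrancl_converse)
        have 2: "(y, x) \<in> E\<^sup>* \<Longrightarrow> (y, z) \<in> E\<^sup>* \<Longrightarrow> ?thesis"
          using single_valued_confluent[OF sv(1), of y x z] by auto
        show ?thesis using xy yz 1 2 unfolding r_def by (auto intro: rtrancl_trans)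
      qed
      then show "(x, z) \<in> r" using xy yz by (auto simp: r_def)
    qed
  qed
  then have P: "partition_on {1..n} ({1..n} // r)" by (rule partition_on_quotient)
  have block: "(\<exists>B\<in>{1..n} // r. i \<in> B \<and> j \<in> B \<and> Q B) \<longleftrightarrow> (i, j) \<in> r \<and> Q (r `` {i})" for i j Q
  proof
    assume "\<exists>B\<in>{1..n} // r. i \<in> B \<and> j \<in> B \<and> Q B"
    then obtain B where B: "B \<in> {1..n} // r" "i \<in> B" "j \<in> B" "Q B" by blast
    then have "B = r `` {i}"
      using \<open>equiv {1..n} r\<close> by (metis Image_singleton_iff equiv_class_eq quotientE)
    then show "(i, j) \<in> r \<and> Q (r `` {i})" using B by auto
  next
    assume a: "(i, j) \<in> r \<and> Q (r `` {i})"
    then have "i \<in> {1..n}" "(i, i) \<in> r" by (auto simp: r_def)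
    then show "\<exists>B\<in>{1..n} // r. i \<in> B \<and> j \<in> B \<and> Q B"
      using a by (intro bexI[of _ "r `` {i}"]) (auto intro: quotientI)
  qed
  have first: "\<exists>m. (i, m) \<in> E \<and> (m, j) \<in> E\<^sup>*" if "(i, j) \<in> r" "i < j" for i j
  proof -
    have "(i, j) \<in> E\<^sup>*" using that le[of j i] by (auto simp: r_def)
    then show ?thesis using that(2) by (auto elim: converse_rtranclE)
  qed
  have "arcs ({1..n} // r) = E"
  proof (intro set_eqI iffI; clarify)
    fix i j assume "(i, j) \<in> arcs ({1..n} // r)"
    then have ij: "i < j" "(i, j) \<in> r" "\<forall>m\<in>r `` {i}. \<not> (i < m \<and> m < j)"
      unfolding arcs_def block by auto
    then obtain m where m: "(i, m) \<in> E" "(m, j) \<in> E\<^sup>*" using first by blast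
    have "m \<in> r `` {i}" using m lt[OF m(1)] by (auto simp: r_def)
    then have "m = j" using ij lt(1)[OF m(1)] le[OF m(2)] by force
    then show "(i, j) \<in> E" using m by simp
  next
    fix i j assume ij: "(i, j) \<in> E"
    have "(i, j) \<in> r" using ij lt[OF ij] by (auto simp: r_def)
    moreover have "\<not> (i < m \<and> m < j)" if mr: "m \<in> r `` {i}" for m
    proof
      assume m: "i < m \<and> m < j"
      then obtain m' where "(i, m') \<in> E" "(m', m) \<in> E\<^sup>*" using first[of i m] mr by auto
      then show False using right[OF ij] le[of m' m] m by auto
    qed
    ultimately show "(i, j) \<in> arcs ({1..n} // r)" using lt(1)[OF ij] unfolding arcs_def block by simp
  qed
  with P show thesis using that by blast
qed

subsection \<open>Regions, walls and recession cones\<close>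

text \<open>Levels are nonnegative, so the origin never lies where \<open>gap\<close> is positive,
  and a ceiling becomes a wall of positive level on which the region has negative
  \<open>gap\<close>.\<close>

definition difference_triples :: "nat \<Rightarrow> (nat \<times> nat \<times> real) set" where
  "difference_triples n = {(i, j, c). (i, j) \<in> pairs_upto n \<and> 0 \<le> c}"

locale difference_arrangement =
  fixes e :: "nat \<Rightarrow> 'n::finite" and n :: nat and T :: "(nat \<times> nat \<times> real) set"
  assumes n_card: "n = CARD('n)"
    and e_bij: "bij_betw e {1..n} UNIV"
    and T_sub: "T \<subseteq> difference_triples n"
    and finite_T: "finite T"
    and Cox_sub: "(i, j) \<in> pairs_upto n \<Longrightarrow> (i, j, 0) \<in> T"
begin

definition level :: "nat \<times> nat \<times> real \<Rightarrow> real" where "level t = snd (snd t)"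

definition normal :: "nat \<times> nat \<times> real \<Rightarrow> real ^ 'n" where
  "normal t = axis (e (fst t)) 1 - axis (e (fst (snd t))) 1"

definition gap :: "nat \<times> nat \<times> real \<Rightarrow> real ^ 'n \<Rightarrow> real" where
  "gap t x = x $ e (fst t) - x $ e (fst (snd t)) - level t"

definition hyp :: "nat \<times> nat \<times> real \<Rightarrow> (real ^ 'n) set" where
  "hyp t = diff_hyperplane e (fst t) (fst (snd t)) (level t)"

definition generic :: "real ^ 'n \<Rightarrow> bool" where
  "generic x \<longleftrightarrow> (\<forall>t\<in>T. gap t x \<noteq> 0)"

definition cell :: "real ^ 'n \<Rightarrow> (real ^ 'n) set" where
  "cell x = {y. \<forall>t\<in>T. sgn (gap t y) = sgn (gap t x)}"

lemma T_triple: "t \<in> T \<Longrightarrow> t \<in> difference_triples n"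
  using T_sub by blast

lemma e_inj: "i \<in> {1..n} \<Longrightarrow> j \<in> {1..n} \<Longrightarrow> e i = e j \<longleftrightarrow> i = j"
  by (rule inj_on_eq_iff[OF bij_betw_imp_inj_on[OF e_bij]])

lemma e_surj: obtains i where "i \<in> {1..n}" "k = e i"
  using bij_betw_imp_surj_on[OF e_bij] by blast

lemma gap_eq_inner: "gap t x = normal t \<bullet> x - level t"
  by (simp add: gap_def normal_def inner_diff_left inner_axis')

lemma gap_simp [simp]: "gap (i, j, c) x = x $ e i - x $ e j - c"
  by (simp add: gap_def level_def)

lemma level_simp [simp]: "level (i, j, c) = c"
  by (simp add: level_def)

lemma hyp_eq: "hyp t = {x. gap t x = 0}" "hyp t = {x. normal t \<bullet> x = level t}"
proof -
  show "hyp t = {x. gap t x = 0}" by (auto simp: hyp_def diff_hyperplane_def gap_def)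
  then show "hyp t = {x. normal t \<bullet> x = level t}" by (simp add: gap_eq_inner)
qed

lemma level_nonneg: "t \<in> difference_triples n \<Longrightarrow> 0 \<le> level t"
  by (auto simp: difference_triples_def)

lemma normal_nonzero:
  assumes "t \<in> difference_triples n"
  shows "normal t \<noteq> 0"
proof -
  obtain i j c where t: "t = (i, j, c)" by (cases t)
  have "e i \<noteq> e j" using assms e_inj[of i j] by (auto simp: t difference_triples_def pairs_upto_def)
  then have "normal t $ e i = 1" by (simp add: t normal_def axis_def)
  then show ?thesis by auto
qed

lemma gap_convex: "gap t ((1 - u) *\<^sub>R x + u *\<^sub>R y) = (1 - u) * gap t x + u * gap t y"
  by (cases t) (simp add: algebra_simps)

lemma continuous_on_gap: "continuous_on S (gap t)"
  unfolding gap_eq_inner[abs_def] by (intro continuous_intros)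

text \<open>Two test vectors decide: \<open>axis (e i) c\<close> lies on the first hyperplane, and
  adding \<open>axis (e k) 1\<close> with \<open>k\<close> different from \<open>i\<close> and
  \<open>j\<close> does not leave it. Both must lie on the second one, which therefore involves no
  coordinate besides \<open>i\<close> and \<open>j\<close>.\<close>

lemma hyp_inject:
  assumes "t \<in> difference_triples n" "t' \<in> difference_triples n" "hyp t = hyp t'"
  shows "t = t'"
proof -
  obtain i j c i' j' c' where t: "t = (i, j, c)" "t' = (i', j', c')" by (cases t, cases t')
  have ij: "i \<in> {1..n}" "j \<in> {1..n}" "i' \<in> {1..n}" "j' \<in> {1..n}" "i < j" "i' < j'"
    using assms by (auto simp: t difference_triples_def pairs_upto_def)
  have *: "x $ e i - x $ e j = c \<longleftrightarrow> x $ e i' - x $ e j' = c'" for x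
    using assms(3) unfolding hyp_eq t by auto
  have p: "c = c'" if "i' = i" "j' = j"
    using *[of "axis (e i) c"] ij that e_inj by (simp add: axis_def)
  have k: "k = i \<or> k = j" if "k = i' \<or> k = j'" for k
  proof (rule ccontr)
    assume n: "\<not> (k = i \<or> k = j)"
    have kn: "k \<in> {1..n}" using that ij by auto
    have "axis (e i) c $ e i' - axis (e i) c $ e j' = c'"
      using *[of "axis (e i) c"] ij e_inj by (simp add: axis_def)
    moreover have "(axis (e i) c + axis (e k) 1) $ e i' - (axis (e i) c + axis (e k) 1) $ e j' = c'"
      using *[of "axis (e i) c + axis (e k) 1"] ij e_inj n kn by (simp add: axis_def)
    ultimately have "axis (e k) (1::real) $ e i' = axis (e k) 1 $ e j'" by simp
    then show False using that ij e_inj kn by (auto simp: axis_def split: if_splits)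
  qed
  have "i' = i" "j' = j" using k[of i'] k[of j'] ij by auto
  with p t show ?thesis by auto
qed

lemma sgn_convex_comb:
  fixes a b :: real
  assumes "0 \<le> u" "u \<le> 1" "sgn a = s" "sgn b = s"
  shows "sgn ((1 - u) * a + u * b) = s"
proof -
  consider "0 < a" "0 < b" | "a < 0" "b < 0" | "a = 0" "b = 0"
    using assms by (auto simp: sgn_if split: if_splits)
  then show ?thesis
  proof cases
    case 1
    then have "min a b \<le> (1 - u) * a + u * b" using assms convex_bound_le[of "-a" "- min a b" "-b" "1 - u" u] by simp
    then show ?thesis using 1 assms by (auto simp: sgn_if)
  next
    case 2
    then have "(1 - u) * a + u * b \<le> max a b" using assms convex_bound_le[of a "max a b" b "1 - u" u] by simp
    then show ?thesis using 2 assms by (auto simp: sgn_if)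
  qed (use assms in auto)
qed

lemma convex_cell: "convex (cell x)"
  unfolding convex_alt cell_def by (simp add: gap_convex sgn_convex_comb)

lemma mem_cell_self: "x \<in> cell x"
  by (simp add: cell_def)

lemma generic_cell: "generic x \<Longrightarrow> y \<in> cell x \<Longrightarrow> generic y"
proof -
  assume "generic x" "y \<in> cell x"
  then have "sgn (gap t y) \<noteq> 0" if "t \<in> T" for t
    using that by (simp add: generic_def cell_def sgn_zero_iff)
  then show "generic y" unfolding generic_def by (simp add: sgn_zero_iff)
qed

lemma mem_cell_iff:
  assumes "generic x"
  shows "y \<in> cell x \<longleftrightarrow> (\<forall>t\<in>T. 0 < sgn (gap t x) * gap t y)"
proof -
  have "sgn (gap t y) = sgn (gap t x) \<longleftrightarrow> 0 < sgn (gap t x) * gap t y" if "t \<in> T" for t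
    using assms that unfolding generic_def by (cases "gap t x" "0::real" rule: linorder_cases) (auto simp: sgn_if)
  then show ?thesis by (simp add: cell_def)
qed

lemma open_cell:
  assumes "generic x"
  shows "open (cell x)"
proof -
  have "cell x = (\<Inter>t\<in>T. {y. 0 < sgn (gap t x) * gap t y})"
    using mem_cell_iff[OF assms] by auto
  moreover have "open {y. 0 < sgn (gap t x) * gap t y}" for t
    by (intro open_Collect_less continuous_intros continuous_on_gap)
  ultimately show ?thesis using finite_T by auto
qed

lemma closure_cell:
  assumes "generic x"
  shows "closure (cell x) = {y. \<forall>t\<in>T. 0 \<le> sgn (gap t x) * gap t y}"
proof (intro subset_antisym closure_minimal subsetI)
  show "y \<in> {y. \<forall>t\<in>T. 0 \<le> sgn (gap t x) * gap t y}" if "y \<in> cell x" for y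
    using that mem_cell_iff[OF assms] by (auto intro: less_imp_le)
  have "{y. \<forall>t\<in>T. 0 \<le> sgn (gap t x) * gap t y} = (\<Inter>t\<in>T. {y. 0 \<le> sgn (gap t x) * gap t y})"
    by auto
  moreover have "closed {y. 0 \<le> sgn (gap t x) * gap t y}" for t
    by (intro closed_Collect_le continuous_intros continuous_on_gap)
  ultimately show "closed {y. \<forall>t\<in>T. 0 \<le> sgn (gap t x) * gap t y}" by auto
next
  fix y assume y: "y \<in> {y. \<forall>t\<in>T. 0 \<le> sgn (gap t x) * gap t y}"
  show "y \<in> closure (cell x)"
    unfolding closure_approachable
  proof (intro allI impI)
    fix \<epsilon> :: real assume \<epsilon>: "0 < \<epsilon>"
    \<comment> \<open>A small move from \<open>y\<close> towards \<open>x\<close>, which satisfies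
      all inequalities strictly. The \<open>+ 1\<close> prevents a division by zero when
      \<open>x = y\<close>.\<close>
    define u where "u = min 1 (\<epsilon> / (norm (x - y) + 1))"
    have u: "0 < u" "u \<le> 1" using \<epsilon> by (auto simp: u_def add_nonneg_pos)
    define z where "z = (1 - u) *\<^sub>R y + u *\<^sub>R x"
    have "0 < sgn (gap t x) * gap t z" if "t \<in> T" for t
    proof -
      have "0 < sgn (gap t x) * gap t x" using assms that by (auto simp: generic_def sgn_if)
      then have "0 < u * (sgn (gap t x) * gap t x)" using u by simp
      moreover have "0 \<le> (1 - u) * (sgn (gap t x) * gap t y)" using y that u by simp
      moreover have "sgn (gap t x) * gap t z = (1 - u) * (sgn (gap t x) * gap t y) + u * (sgn (gap t x) * gap t x)"
        unfolding z_def gap_convex by (simp add: algebra_simps)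
      ultimately show ?thesis by linarith
    qed
    then have "z \<in> cell x" using mem_cell_iff[OF assms] by blast
    moreover have "dist z y < \<epsilon>"
    proof -
      have "z - y = u *\<^sub>R (x - y)" by (simp add: z_def algebra_simps)
      then have "dist z y = u * norm (x - y)" using u by (simp add: dist_norm)
      also have "\<dots> < u * (norm (x - y) + 1)" using u by simp
      also have "\<dots> \<le> \<epsilon> / (norm (x - y) + 1) * (norm (x - y) + 1)"
        by (intro mult_right_mono) (auto simp: u_def)
      also have "\<dots> = \<epsilon>" by (metis add_nonneg_pos less_irrefl nonzero_eq_divide_eq norm_ge_zero zero_less_one)
      finally show ?thesis .
    qed
    ultimately show "\<exists>z\<in>cell x. dist z y < \<epsilon>" by blast
  qed
qed

text \<open>On a connected set without zeros a gap keeps its sign, and a set with prescribed signs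
  is convex, so the components are exactly the sign cells.\<close>

lemma regions_eq: "regions (hyp ` T) = {cell x | x. generic x}"
proof -
  have compl: "- \<Union>(hyp ` T) = {x. generic x}"
    by (auto simp: hyp_eq generic_def)
  have "connected_component_set {x. generic x} x = cell x" if x: "generic x" for x
  proof
    show "cell x \<subseteq> connected_component_set {x. generic x} x"
      using x generic_cell mem_cell_self convex_cell
      by (intro connected_component_maximal convex_connected) auto
    show "connected_component_set {x. generic x} x \<subseteq> cell x"
    proof
      fix y assume "y \<in> connected_component_set {x. generic x} x"
      then obtain C where C: "connected C" "C \<subseteq> {x. generic x}" "x \<in> C" "y \<in> C"
        by (auto simp: connected_component_def)
      have "sgn (gap t y) = sgn (gap t x)" if t: "t \<in> T" for t
      proof -
        have "connected (gap t ` C)" using C(1) continuous_on_gap by (rule connected_continuous_image[rotated])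
        moreover have "0 \<notin> gap t ` C" using C(2) t by (auto simp: generic_def)
        ultimately have "\<not> (gap t x < 0 \<and> 0 < gap t y)" "\<not> (gap t y < 0 \<and> 0 < gap t x)"
          using C(3,4) connectedD_interval[of "gap t ` C"] by (meson image_eqI less_imp_le)+
        moreover have "gap t x \<noteq> 0" "gap t y \<noteq> 0" using C t by (auto simp: generic_def)
        ultimately show ?thesis by (simp add: sgn_if)
      qed
      then show "y \<in> cell x" by (simp add: cell_def)
    qed
  qed
  then show ?thesis unfolding regions_def compl components_def by auto
qed

text \<open>The segment from any \<open>y\<close> in \<open>F\<close> to \<open>z\<close> can be
  prolonged beyond \<open>z\<close> inside \<open>F\<close>. The signed gap is nonnegative on
  \<open>F\<close> and zero at \<open>z\<close>, so it would become negative beyond \<open>z\<close>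
  unless it is zero at \<open>y\<close>.\<close>

lemma rel_interior_facet_gap:
  assumes "generic x" "F \<subseteq> closure (cell x)" "convex F" "z \<in> rel_interior F" "t \<in> T" "gap t z = 0"
  shows "F \<subseteq> hyp t"
proof
  fix y assume y: "y \<in> F"
  have "F \<noteq> {}" using y by blast
  then obtain a where a: "a > 1" "(1 - a) *\<^sub>R y + a *\<^sub>R z \<in> F"
    using convex_rel_interior_iff[OF assms(3)] assms(4) y by blast
  then have "0 \<le> sgn (gap t x) * gap t ((1 - a) *\<^sub>R y + a *\<^sub>R z)"
    using assms closure_cell[OF assms(1)] by blast
  then have "0 \<le> (1 - a) * (sgn (gap t x) * gap t y)"
    unfolding gap_convex assms(6) by (simp add: algebra_simps)
  then have "sgn (gap t x) * gap t y \<le> 0" using a(1) by (simp add: zero_le_mult_iff)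
  moreover have "0 \<le> sgn (gap t x) * gap t y"
    using assms y closure_cell[OF assms(1)] by blast
  ultimately have "sgn (gap t x) * gap t y = 0" by simp
  moreover have "sgn (gap t x) \<noteq> 0" using assms(1,5) by (auto simp: generic_def sgn_zero_iff)
  ultimately show "y \<in> hyp t" by (simp add: hyp_eq)
qed

lemma aff_dim_closure_cell: "generic x \<Longrightarrow> aff_dim (closure (cell x)) = int DIM(real ^ 'n)"
  unfolding closure_aff_dim using mem_cell_self by (intro aff_dim_open[OF open_cell]) auto

lemma aff_dim_hyp: "t \<in> difference_triples n \<Longrightarrow> aff_dim (hyp t) = int DIM(real ^ 'n) - 1"
  using normal_nonzero[of t] by (simp add: hyp_eq(2))

lemma affine_hyp: "affine (hyp t)"
  unfolding hyp_eq(2) by (rule affine_hyperplane)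

text \<open>A relative interior point of a facet is the certificate \<open>z\<close>: every
  hyperplane of the arrangement through it contains the facet, hence is its affine hull, and
  \<open>hyp_inject\<close> leaves only one such triple. Conversely, near a certificate the whole
  hyperplane belongs to the closure of the cell, so the face it cuts out has full dimension in
  it.\<close>

lemma is_wall_cell_iff:
  assumes x: "generic x"
  shows "is_wall (cell x) H \<longleftrightarrow>
    (\<exists>t\<in>T. H = hyp t \<and> (\<exists>z. gap t z = 0 \<and> (\<forall>t'\<in>T - {t}. sgn (gap t' z) = sgn (gap t' x))))"
proof
  assume "is_wall (cell x) H"
  then obtain F where F: "F facet_of closure (cell x)" "H = affine hull F" by (auto simp: is_wall_def)
  have face: "F face_of closure (cell x)" "F \<noteq> {}"
    and dimF: "aff_dim F = int DIM(real ^ 'n) - 1"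
    using F(1) aff_dim_closure_cell[OF x] by (auto simp: facet_of_def)
  have cF: "convex F" using face(1) by (rule face_of_imp_convex)
  have sub: "F \<subseteq> closure (cell x)" using face(1) by (rule face_of_imp_subset)
  obtain z where z: "z \<in> rel_interior F" using rel_interior_eq_empty[OF cF] face(2) by blast
  have zF: "z \<in> F" using z rel_interior_subset by blast
  have ne: "F \<noteq> closure (cell x)" using dimF aff_dim_closure_cell[OF x] by auto
  have "cell x \<subseteq> interior (closure (cell x))" using open_cell[OF x] by (simp add: interior_maximal closure_subset)
  moreover have "F \<inter> interior (closure (cell x)) = {}" using face_of_disjoint_interior[OF face(1) ne] .
  ultimately have "z \<notin> cell x" using zF by blast
  then obtain t where t: "t \<in> T" "\<not> 0 < sgn (gap t x) * gap t z" using mem_cell_iff[OF x] by blast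
  have zle: "0 \<le> sgn (gap s x) * gap s z" if "s \<in> T" for s
    using zF sub closure_cell[OF x] that by blast
  have "sgn (gap t x) * gap t z = 0" using t(2) zle[OF t(1)] by linarith
  then have tz: "gap t z = 0" using x t by (auto simp: generic_def sgn_zero_iff)
  have H_eq: "H = hyp s" if "s \<in> T" "gap s z = 0" for s
  proof -
    have "F \<subseteq> hyp s" using rel_interior_facet_gap[OF x sub cF z that] .
    then have "affine hull F \<subseteq> hyp s" by (simp add: hull_minimal affine_hyp)
    moreover have "aff_dim (affine hull F) = aff_dim (hyp s)"
      using dimF aff_dim_hyp[OF T_triple[OF that(1)]] by simp
    ultimately show ?thesis unfolding F(2)
      using face(2) affine_hyp affine_dim_equal[of "affine hull F" "hyp s"] by simp
  qed
  have "sgn (gap t' z) = sgn (gap t' x)" if t': "t' \<in> T - {t}" for t'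
  proof -
    have T': "t \<in> difference_triples n" "t' \<in> difference_triples n" using t(1) t' T_sub by blast+
    have "gap t' z \<noteq> 0"
    proof
      assume "gap t' z = 0"
      then have "hyp t = hyp t'" using H_eq[of t'] H_eq[OF t(1) tz] t' by simp
      then show False using hyp_inject[OF T'] t' by simp
    qed
    moreover have "gap t' x \<noteq> 0" "0 \<le> sgn (gap t' x) * gap t' z" using x zle[of t'] t' by (auto simp: generic_def)
    ultimately show ?thesis by (simp add: sgn_if zero_le_mult_iff split: if_splits)
  qed
  then show "\<exists>t\<in>T. H = hyp t \<and> (\<exists>z. gap t z = 0 \<and> (\<forall>t'\<in>T - {t}. sgn (gap t' z) = sgn (gap t' x)))"
    using t(1) H_eq[OF t(1) tz] tz by blast
next
  assume "\<exists>t\<in>T. H = hyp t \<and> (\<exists>z. gap t z = 0 \<and> (\<forall>t'\<in>T - {t}. sgn (gap t' z) = sgn (gap t' x)))"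
  then obtain t z where t: "t \<in> T" "H = hyp t" "gap t z = 0"
    and z: "\<And>t'. t' \<in> T - {t} \<Longrightarrow> sgn (gap t' z) = sgn (gap t' x)" by blast
  let ?C = "closure (cell x)"
  \<comment> \<open>An open neighbourhood of \<open>z\<close> in which only the sign of
    \<open>gap t\<close> is left free. Its intersection with \<open>hyp t\<close> is relatively open
    and nonempty, so it spans \<open>hyp t\<close>.\<close>
  define W where "W = (\<Inter>t'\<in>T - {t}. {y. 0 < sgn (gap t' x) * gap t' y})"
  have "open {y. 0 < sgn (gap t' x) * gap t' y}" for t'
    by (intro open_Collect_less continuous_intros continuous_on_gap)
  then have W: "open W" unfolding W_def using finite_T by auto
  have "z \<in> W"
  proof -
    have "0 < sgn (gap t' x) * gap t' z" if "t' \<in> T - {t}" for t'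
      using z[OF that] x that by (auto simp: generic_def sgn_if split: if_splits)
    then show ?thesis by (simp add: W_def)
  qed
  then have ne: "hyp t \<inter> W \<noteq> {}" using t by (auto simp: hyp_eq(1))
  have sub: "hyp t \<inter> W \<subseteq> ?C"
  proof
    fix y assume y: "y \<in> hyp t \<inter> W"
    have "0 \<le> sgn (gap t' x) * gap t' y" if "t' \<in> T" for t'
      using y that by (cases "t' = t") (auto simp: W_def hyp_eq(1) less_imp_le)
    then show "y \<in> ?C" using closure_cell[OF x] by blast
  qed
  let ?s = "sgn (gap t x)"
  have s: "?s \<noteq> 0" using x t(1) by (auto simp: generic_def sgn_zero_iff)
  have Hs: "hyp t = {y. (- ?s *\<^sub>R normal t) \<bullet> y = - ?s * level t}"
    using s by (auto simp: hyp_eq(2))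
  have "(?C \<inter> hyp t) face_of ?C"
    unfolding Hs
  proof (rule face_of_Int_supporting_hyperplane_le)
    show "convex ?C" using convex_cell by (rule convex_closure)
    fix y assume "y \<in> ?C"
    then have "0 \<le> ?s * gap t y" using closure_cell[OF x] t(1) by blast
    then show "(- ?s *\<^sub>R normal t) \<bullet> y \<le> - ?s * level t"
      by (simp add: gap_eq_inner algebra_simps)
  qed
  moreover have hull: "affine hull (?C \<inter> hyp t) = hyp t"
  proof
    show "affine hull (?C \<inter> hyp t) \<subseteq> hyp t" by (simp add: hull_minimal affine_hyp)
    have "hyp t = affine hull (hyp t \<inter> W)"
      using affine_hull_affine_Int_open[OF affine_hyp W ne] affine_hyp by (simp add: hull_same)
    also have "\<dots> \<subseteq> affine hull (?C \<inter> hyp t)" using sub by (intro hull_mono) auto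
    finally show "hyp t \<subseteq> affine hull (?C \<inter> hyp t)" .
  qed
  moreover have "?C \<inter> hyp t \<noteq> {}" using sub ne by blast
  moreover have "aff_dim (?C \<inter> hyp t) = aff_dim ?C - 1"
    using hull aff_dim_affine_hull[of "?C \<inter> hyp t"] aff_dim_hyp[OF T_triple[OF t(1)]] aff_dim_closure_cell[OF x]
    by simp
  ultimately have "(?C \<inter> hyp t) facet_of ?C" by (simp add: facet_of_def)
  with hull t(2) show "is_wall (cell x) H" unfolding is_wall_def by metis
qed

lemma is_ceiling_cell_iff:
  assumes x: "generic x"
  shows "is_ceiling (cell x) H \<longleftrightarrow>
    (\<exists>t\<in>T. H = hyp t \<and> 0 < level t \<and> gap t x < 0 \<and>
       (\<exists>z. gap t z = 0 \<and> (\<forall>t'\<in>T - {t}. sgn (gap t' z) = sgn (gap t' x))))"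
proof
  assume C: "is_ceiling (cell x) H"
  then obtain t where t: "t \<in> T" "H = hyp t"
    and z: "\<exists>z. gap t z = 0 \<and> (\<forall>t'\<in>T - {t}. sgn (gap t' z) = sgn (gap t' x))"
    unfolding is_ceiling_def is_wall_cell_iff[OF x] by blast
  obtain u b where ub: "H = {x. u \<bullet> x = b}" "cell x \<subseteq> {x. u \<bullet> x < b}" "0 \<in> {x. u \<bullet> x < b}"
    and "0 \<notin> H" using C unfolding is_ceiling_def by blast
  have "level t \<noteq> 0" using \<open>0 \<notin> H\<close> t(2) by (simp add: hyp_eq(2))
  then have pos: "0 < level t" using level_nonneg[of t] t(1) T_sub by auto
  have "gap t x < 0"
  proof (rule ccontr)
    assume "\<not> gap t x < 0"
    then have g: "0 < gap t x" using x t(1) by (force simp: generic_def)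
    \<comment> \<open>\<open>a *\<^sub>R x\<close> is the point where the segment from the origin to
      \<open>x\<close> crosses \<open>hyp t\<close>. Both ends lie in the open half-space given by
      \<open>u\<close> and \<open>b\<close>, so the crossing point cannot lie on its boundary
      \<open>H\<close>.\<close>
    define a where "a = level t / (normal t \<bullet> x)"
    have nx: "normal t \<bullet> x > level t" using g by (simp add: gap_eq_inner)
    then have "normal t \<bullet> (a *\<^sub>R x) = level t" using pos by (simp add: a_def)
    then have "a *\<^sub>R x \<in> H" using t(2) by (simp add: hyp_eq(2))
    then have ab: "a * (u \<bullet> x) = b" using ub(1) by simp
    have a01: "0 < a" "a < 1" using pos nx by (auto simp: a_def)
    have "u \<bullet> x < b" using ub(2) mem_cell_self by blast
    then have "a * (u \<bullet> x) < a * b" using a01 by simp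
    moreover have "a * b < b" using a01 ub(3) by simp
    ultimately show False using ab by simp
  qed
  with t pos z show "\<exists>t\<in>T. H = hyp t \<and> 0 < level t \<and> gap t x < 0 \<and>
       (\<exists>z. gap t z = 0 \<and> (\<forall>t'\<in>T - {t}. sgn (gap t' z) = sgn (gap t' x)))" by blast
next
  assume "\<exists>t\<in>T. H = hyp t \<and> 0 < level t \<and> gap t x < 0 \<and>
       (\<exists>z. gap t z = 0 \<and> (\<forall>t'\<in>T - {t}. sgn (gap t' z) = sgn (gap t' x)))"
  then obtain t where t: "t \<in> T" "H = hyp t" "0 < level t" "gap t x < 0"
    and z: "\<exists>z. gap t z = 0 \<and> (\<forall>t'\<in>T - {t}. sgn (gap t' z) = sgn (gap t' x))" by blast
  have "is_wall (cell x) H" using is_wall_cell_iff[OF x] t z by blast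
  moreover have "0 \<notin> H" using t by (simp add: hyp_eq(2))
  moreover have "cell x \<subseteq> {y. normal t \<bullet> y < level t}"
  proof
    fix y assume "y \<in> cell x"
    then have "sgn (gap t y) = sgn (gap t x)" using t(1) by (simp add: cell_def)
    then show "y \<in> {y. normal t \<bullet> y < level t}" using t(4) by (auto simp: gap_eq_inner sgn_if split: if_splits)
  qed
  moreover have "normal t \<noteq> 0" using normal_nonzero t(1) T_sub by blast
  ultimately show "is_ceiling (cell x) H"
    unfolding is_ceiling_def using t(3) by (auto simp: t(2) hyp_eq(2))
qed

lemma recession_cone_cell:
  assumes x: "generic x"
  shows "recession_cone (cell x) = {v. \<forall>t\<in>T. 0 \<le> sgn (gap t x) * (normal t \<bullet> v)}"
proof (intro set_eqI iffI)
  fix v assume "v \<in> recession_cone (cell x)"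
  then have step: "v + y \<in> cell x" if "y \<in> cell x" for y using that by (auto simp: recession_cone_def)
  \<comment> \<open>A direction of the recession cone can be applied any number of times; if it
    decreased some signed gap, enough repetitions would leave the cell.\<close>
  have it: "x + real k *\<^sub>R v \<in> cell x" for k
  proof (induction k)
    case (Suc k)
    then show ?case using step[OF Suc] by (simp add: algebra_simps)
  qed (simp add: mem_cell_self)
  have "0 \<le> sgn (gap t x) * (normal t \<bullet> v)" if t: "t \<in> T" for t
  proof (rule ccontr)
    let ?a = "sgn (gap t x) * (normal t \<bullet> v)" and ?g = "sgn (gap t x) * gap t x"
    assume "\<not> 0 \<le> ?a"
    then have a: "0 < - ?a" by simp
    then obtain k :: nat where k: "?g < real k * - ?a" using reals_Archimedean3 by blast
    have "0 < sgn (gap t x) * gap t (x + real k *\<^sub>R v)" using it mem_cell_iff[OF x] t by blast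
    also have "\<dots> = ?g + real k * ?a" by (simp add: gap_eq_inner inner_add_right algebra_simps)
    finally show False using k by simp
  qed
  then show "v \<in> {v. \<forall>t\<in>T. 0 \<le> sgn (gap t x) * (normal t \<bullet> v)}" by blast
next
  fix v assume v: "v \<in> {v. \<forall>t\<in>T. 0 \<le> sgn (gap t x) * (normal t \<bullet> v)}"
  have "v + y \<in> cell x" if y: "y \<in> cell x" for y
    unfolding mem_cell_iff[OF x]
  proof
    fix t assume t: "t \<in> T"
    have "0 < sgn (gap t x) * gap t y" using y t mem_cell_iff[OF x] by blast
    moreover have "sgn (gap t x) * gap t (v + y) = sgn (gap t x) * gap t y + sgn (gap t x) * (normal t \<bullet> v)"
      by (simp add: gap_eq_inner inner_add_right algebra_simps)
    moreover have "0 \<le> sgn (gap t x) * (normal t \<bullet> v)" using v t by blast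
    ultimately show "0 < sgn (gap t x) * gap t (v + y)" by linarith
  qed
  then show "v \<in> recession_cone (cell x)" by (auto simp: recession_cone_def)
qed

end

subsection \<open>Regions with prescribed ceilings\<close>

definition weakly_prec :: "'a list \<Rightarrow> 'a \<Rightarrow> 'a \<Rightarrow> bool" where
  "weakly_prec xs a b \<longleftrightarrow> a = b \<or> prec xs a b"

lemma weakly_prec_trans:
  "distinct xs \<Longrightarrow> weakly_prec xs a b \<Longrightarrow> weakly_prec xs b c \<Longrightarrow> weakly_prec xs a c"
  unfolding weakly_prec_def using prec_trans by metis

lemma weakly_prec_antisym:
  "distinct xs \<Longrightarrow> weakly_prec xs a b \<Longrightarrow> weakly_prec xs b a \<Longrightarrow> a = b"
  unfolding weakly_prec_def using prec_asym by metis

lemma prec_take: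
  assumes "distinct xs" "prec xs i j" "j \<in> set (take p xs)"
  shows "i \<in> set (take p xs)"
proof -
  obtain a b where ab: "a < b" "b < length xs" "xs ! a = i" "xs ! b = j"
    using assms(2) by (auto simp: prec_def)
  obtain b' where b': "b' < p" "b' < length xs" "xs ! b' = j"
    using assms(3) by (auto simp: in_set_conv_nth)
  have "b' = b" using ab b' assms(1) nth_eq_iff_index_eq by metis
  then have "a < length (take p xs)" "take p xs ! a = i" using ab b' by auto
  then show ?thesis using nth_mem by blast
qed

lemma nth_mem_take_iff:
  assumes "distinct xs" "q < length xs"
  shows "xs ! q \<in> set (take p xs) \<longleftrightarrow> q < p"
proof
  assume "xs ! q \<in> set (take p xs)"
  then obtain b where "b < p" "b < length xs" "xs ! b = xs ! q" by (auto simp: in_set_conv_nth)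
  then show "q < p" using assms nth_eq_iff_index_eq by metis
next
  assume "q < p"
  then have "q < length (take p xs)" "take p xs ! q = xs ! q" using assms by auto
  then show "xs ! q \<in> set (take p xs)" using nth_mem by metis
qed

text \<open>On vectors descending along \<open>xs\<close>, \<open>gap t\<close> is at most
  \<open>gap t'\<close> (\<open>dominated_gap\<close>), so the inequality of \<open>t'\<close>
  implies that of \<open>t\<close>.\<close>

definition dominated :: "nat list \<Rightarrow> nat \<times> nat \<times> real \<Rightarrow> nat \<times> nat \<times> real \<Rightarrow> bool" where
  "dominated xs t t' \<longleftrightarrow> weakly_prec xs (fst t') (fst t) \<and>
     weakly_prec xs (fst (snd t)) (fst (snd t')) \<and> snd (snd t') \<le> snd (snd t)"

text \<open>Antichains of inequalities that go forward along \<open>xs\<close>. Backward ones hold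
  on the whole cone of \<open>xs\<close> (\<open>gap_neg_backward\<close>) and can never be ceilings
  there.\<close>

definition configuration :: "nat list \<Rightarrow> (nat \<times> nat \<times> real) set \<Rightarrow> bool" where
  "configuration xs K \<longleftrightarrow> (\<forall>t\<in>K. prec xs (fst t) (fst (snd t))) \<and>
     (\<forall>t\<in>K. \<forall>t'\<in>K. dominated xs t t' \<longrightarrow> t = t')"

abbreviation ends :: "nat \<times> nat \<times> real \<Rightarrow> nat \<times> nat" where
  "ends t \<equiv> (fst t, fst (snd t))"

lemma dominated_refl: "dominated xs t t"
  by (simp add: dominated_def weakly_prec_def)

lemma dominated_trans:
  "distinct xs \<Longrightarrow> dominated xs t t' \<Longrightarrow> dominated xs t' t'' \<Longrightarrow> dominated xs t t''"
  unfolding dominated_def using weakly_prec_trans[of xs] order_trans by blast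

lemma dominated_antisym:
  "distinct xs \<Longrightarrow> dominated xs t t' \<Longrightarrow> dominated xs t' t \<Longrightarrow> t = t'"
  unfolding dominated_def using weakly_prec_antisym[of xs] by (simp add: prod_eq_iff)

lemma ex_maximal_dominated:
  assumes "distinct xs" "finite B" "t \<in> B"
  shows "\<exists>m\<in>B. dominated xs t m \<and> (\<forall>u\<in>B. dominated xs m u \<longrightarrow> m = u)"
  using assms(3)
proof (induction "card {u \<in> B. dominated xs t u}" arbitrary: t rule: less_induct)
    case less
    show ?case
    proof (cases "\<forall>u\<in>B. dominated xs t u \<longrightarrow> t = u")
      case True
      then show ?thesis using less.prems dominated_refl by blast
    next
      case False
      then obtain u where u: "u \<in> B" "dominated xs t u" "t \<noteq> u" by blast
      have "t \<in> {v \<in> B. dominated xs t v}" "t \<notin> {v \<in> B. dominated xs u v}"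
        using less.prems dominated_refl dominated_antisym[OF assms(1) u(2)] u(3) by auto
      moreover have "{v \<in> B. dominated xs u v} \<subseteq> {v \<in> B. dominated xs t v}"
        using dominated_trans[OF assms(1) u(2)] by auto
      ultimately have "{v \<in> B. dominated xs u v} \<subset> {v \<in> B. dominated xs t v}" by blast
      then have "card {v \<in> B. dominated xs u v} < card {v \<in> B. dominated xs t v}"
        using assms(2) by (intro psubset_card_mono) auto
      from less.hyps[OF this u(1)] show ?thesis
        using dominated_trans[OF assms(1) u(2)] by blast
    qed
qed

section \<open>Ceilings, recession cone and its dimension for a cell inside a Coxeter cone\<close>

context difference_arrangement
begin

definition T_pos :: "(nat \<times> nat \<times> real) set" where "T_pos = {t \<in> T. 0 < level t}"

definition descending :: "nat list \<Rightarrow> real ^ 'n \<Rightarrow> bool" where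
  "descending xs x \<longleftrightarrow> set xs = {1..n} \<and> sorted_wrt (\<lambda>i j. x $ e j < x $ e i) xs"

lemma descending_distinct: "descending xs x \<Longrightarrow> distinct xs"
proof -
  assume "descending xs x"
  then have "sorted_wrt (\<lambda>i j. x $ e j < x $ e i) xs" by (simp add: descending_def)
  then have "sorted_wrt (\<lambda>i j. i \<noteq> j) xs" by (rule sorted_wrt_mono_rel[rotated]) auto
  then show ?thesis by (simp add: distinct_conv_nth sorted_wrt_iff_nth_less) (metis linorder_neqE_nat)
qed

lemma descending_prec:
  assumes "descending xs x" "i \<in> {1..n}" "j \<in> {1..n}"
  shows "prec xs i j \<longleftrightarrow> x $ e j < x $ e i"
proof -
  have *: "x $ e j < x $ e i" if "prec xs i j" for i j
    using that assms(1) unfolding prec_def descending_def sorted_wrt_iff_nth_less by auto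
  show ?thesis
  proof
    assume lt: "x $ e j < x $ e i"
    then have "\<not> prec xs j i" "i \<noteq> j" using *[of j i] by auto
    then show "prec xs i j" using prec_total[of i xs j] assms unfolding descending_def by blast
  qed (rule *)
qed

lemma T_cases:
  assumes "t \<in> T"
  obtains i j c where "t = (i, j, c)" "i \<in> {1..n}" "j \<in> {1..n}" "i < j" "0 \<le> c" "c = 0 \<or> t \<in> T_pos"
proof -
  obtain i j c where t: "t = (i, j, c)" by (cases t)
  have ijc: "i \<in> {1..n}" "j \<in> {1..n}" "i < j" "0 \<le> c"
    using T_triple[OF assms] by (auto simp: t difference_triples_def pairs_upto_def)
  then have "c = 0 \<or> t \<in> T_pos" using assms by (auto simp: t T_pos_def)
  with t ijc show thesis by (rule that)
qed

text \<open>The Coxeter hyperplanes alone fix the order of the coordinates. Only the triples of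
  level \<open>0\<close> are compared, so that this also applies to a point \<open>z\<close> on a
  wall of positive level, which is not generic.\<close>

lemma sgn_order:
  assumes "\<And>t. t \<in> T - T_pos \<Longrightarrow> sgn (gap t y) = sgn (gap t x)" "i \<in> {1..n}" "j \<in> {1..n}"
  shows "y $ e j < y $ e i \<longleftrightarrow> x $ e j < x $ e i"
proof -
  have *: "sgn (y $ e i - y $ e j) = sgn (x $ e i - x $ e j)" if "i < j" "i \<in> {1..n}" "j \<in> {1..n}" for i j
  proof -
    have "(i, j, 0) \<in> T - T_pos" using that Cox_sub[of i j] by (auto simp: pairs_upto_def T_pos_def)
    then show ?thesis using assms(1)[of "(i, j, 0)"] by simp
  qed
  show ?thesis
    using *[of i j] *[of j i] assms(2,3)
    by (cases i j rule: linorder_cases) (auto simp: sgn_if split: if_splits)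
qed

lemma descending_cong:
  assumes "\<And>t. t \<in> T - T_pos \<Longrightarrow> sgn (gap t y) = sgn (gap t x)" "descending xs x"
  shows "descending xs y"
proof -
  have s: "set xs = {1..n}" using assms(2) by (simp add: descending_def)
  show ?thesis unfolding descending_def
  proof
    show "sorted_wrt (\<lambda>i j. y $ e j < y $ e i) xs"
    proof (rule sorted_wrt_mono_rel)
      show "sorted_wrt (\<lambda>i j. x $ e j < x $ e i) xs" using assms(2) by (simp add: descending_def)
      show "y $ e j < y $ e i" if "i \<in> set xs" "j \<in> set xs" "x $ e j < x $ e i" for i j
        using that sgn_order[OF assms(1), of i j] unfolding s by blast
    qed
  qed (rule s)
qed

lemma descending_cell: "descending xs x \<Longrightarrow> y \<in> cell x \<Longrightarrow> descending xs y"
  by (rule descending_cong[of y x xs]) (simp_all add: cell_def)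

lemma ex_descending:
  assumes "generic x"
  obtains xs where "descending xs x"
proof -
  define f where "f = (\<lambda>i. - x $ e i)"
  define xs where "xs = sort_key f [1..<Suc n]"
  have s: "set xs = {1..n}" "distinct xs" "sorted (map f xs)" by (auto simp: xs_def)
  have inj: "f i \<noteq> f j" if "i \<in> {1..n}" "j \<in> {1..n}" "i \<noteq> j" for i j
  proof -
    have *: "x $ e i \<noteq> x $ e j" if "i < j" "i \<in> {1..n}" "j \<in> {1..n}" for i j
      using assms Cox_sub[of i j] that unfolding generic_def by (force simp: pairs_upto_def)
    show ?thesis using *[of i j] *[of j i] that by (cases i j rule: linorder_cases) (auto simp: f_def)
  qed
  have "sorted_wrt (\<lambda>i j. x $ e j < x $ e i) xs"
    unfolding sorted_wrt_iff_nth_less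
  proof (intro allI impI)
    fix p q assume pq: "p < q" "q < length xs"
    then have "f (xs ! p) \<le> f (xs ! q)" using s(3) sorted_nth_mono[of "map f xs" p q] by simp
    moreover have "xs ! p \<noteq> xs ! q" using pq s(2) nth_eq_iff_index_eq[of xs p q] by simp
    moreover have "xs ! p \<in> {1..n}" "xs ! q \<in> {1..n}" using pq s(1) nth_mem[of p xs] nth_mem[of q xs] by auto
    ultimately have "f (xs ! p) < f (xs ! q)" using inj[of "xs ! p" "xs ! q"] by simp
    then show "x $ e (xs ! q) < x $ e (xs ! p)" by (simp add: f_def)
  qed
  then show thesis using that s(1) by (simp add: descending_def)
qed

lemma descending_unique:
  assumes "descending xs x" "descending ys x"
  shows "xs = ys"
proof -
  define f where "f = (\<lambda>i. - x $ e i)"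
  have sorted: "sorted_wrt (<) (map f zs)" if "descending zs x" for zs
    using that by (simp add: descending_def sorted_wrt_map f_def)
  have s: "set xs = {1..n}" "set ys = {1..n}" using assms by (auto simp: descending_def)
  have "map f xs = map f ys"
    by (rule strict_sorted_equal[OF sorted[OF assms(2)] sorted[OF assms(1)]]) (simp add: s)
  moreover have "inj_on f (set xs \<union> set ys)"
  proof (rule inj_onI)
    fix i j assume ij: "i \<in> set xs \<union> set ys" "j \<in> set xs \<union> set ys" "f i = f j"
    then have "\<not> prec xs i j" "\<not> prec xs j i"
      using descending_prec[OF assms(1)] s by (auto simp: f_def)
    then show "i = j" using prec_total[of i xs j] ij s by auto
  qed
  ultimately show ?thesis using map_inj_on by blast
qed

definition ceilings :: "real ^ 'n \<Rightarrow> (nat \<times> nat \<times> real) set" where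
  "ceilings x = {t \<in> T_pos. gap t x < 0 \<and>
     (\<exists>z. gap t z = 0 \<and> (\<forall>t'\<in>T - {t}. sgn (gap t' z) = sgn (gap t' x)))}"

lemma is_ceiling_hyp_iff:
  assumes "generic x" "t \<in> difference_triples n"
  shows "is_ceiling (cell x) (hyp t) \<longleftrightarrow> t \<in> ceilings x"
proof
  assume "is_ceiling (cell x) (hyp t)"
  then obtain s where s: "s \<in> T" "hyp t = hyp s" "0 < level s" "gap s x < 0"
    "\<exists>z. gap s z = 0 \<and> (\<forall>t'\<in>T - {s}. sgn (gap t' z) = sgn (gap t' x))"
    unfolding is_ceiling_cell_iff[OF assms(1)] by blast
  then have "t = s" using hyp_inject[OF assms(2) T_triple[OF s(1)]] by simp
  then show "t \<in> ceilings x" using s by (simp add: ceilings_def T_pos_def)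
next
  assume "t \<in> ceilings x"
  then show "is_ceiling (cell x) (hyp t)"
    unfolding is_ceiling_cell_iff[OF assms(1)] by (auto simp: ceilings_def T_pos_def)
qed

lemma ceilings_hyperplanes: "generic x \<Longrightarrow> {H. is_ceiling (cell x) H} = hyp ` ceilings x"
  by (auto simp: is_ceiling_cell_iff ceilings_def T_pos_def)

lemma card_ceilings: "generic x \<Longrightarrow> card {H. is_ceiling (cell x) H} = card (ceilings x)"
proof -
  assume x: "generic x"
  have "inj_on hyp (ceilings x)"
    using hyp_inject T_triple by (auto simp: inj_on_def ceilings_def T_pos_def)
  then show ?thesis unfolding ceilings_hyperplanes[OF x] by (rule card_image)
qed

lemma dominated_gap:
  assumes "descending xs z" "dominated xs t t'" "t \<in> T" "t' \<in> T"
  shows "gap t z \<le> gap t' z"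
proof -
  obtain i j c where t: "t = (i, j, c)" "i \<in> {1..n}" "j \<in> {1..n}" using T_cases[OF assms(3)] by metis
  obtain i' j' c' where t': "t' = (i', j', c')" "i' \<in> {1..n}" "j' \<in> {1..n}" using T_cases[OF assms(4)] by metis
  have w: "weakly_prec xs a b \<Longrightarrow> z $ e b \<le> z $ e a" if "a \<in> {1..n}" "b \<in> {1..n}" for a b
    using descending_prec[OF assms(1) that] by (auto simp: weakly_prec_def)
  have "z $ e i \<le> z $ e i'" "z $ e j' \<le> z $ e j" "c' \<le> c"
    using assms(2) w t t' by (auto simp: dominated_def)
  then show ?thesis by (simp add: t t')
qed

text \<open>The inequalities that are not automatic in the cone of \<open>xs\<close> and hold at
  \<open>x\<close>; the ceilings will be the maximal ones.\<close>

definition below :: "nat list \<Rightarrow> real ^ 'n \<Rightarrow> (nat \<times> nat \<times> real) set" where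
  "below xs x = {t \<in> T_pos. prec xs (fst t) (fst (snd t)) \<and> gap t x < 0}"

lemma gap_neg_backward:
  assumes "descending xs x" "t \<in> T" "\<not> prec xs (fst t) (fst (snd t))"
  shows "gap t x < 0"
proof -
  obtain i j c where t: "t = (i, j, c)" "i \<in> {1..n}" "j \<in> {1..n}" "i < j" "0 \<le> c"
    using T_cases[OF assms(2)] by metis
  have "prec xs j i" using assms t prec_total[of i xs j] by (auto simp: descending_def)
  then show ?thesis using descending_prec[OF assms(1)] t by auto
qed

text \<open>Along a ceiling from \<open>i'\<close> to \<open>j'\<close> the order gives one
  inequality between the two coordinates of \<open>v\<close> and the negative gap gives the other,
  so they agree. Any other forward inequality that holds at \<open>x\<close> lies inside some
  ceiling, and monotonicity squeezes \<open>v\<close> between two equal values.\<close>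

lemma recession_cone_eq:
  assumes x: "generic x" and xs: "descending xs x"
    and dom: "\<And>t. t \<in> T_pos \<Longrightarrow> prec xs (fst t) (fst (snd t)) \<Longrightarrow> gap t x < 0 \<Longrightarrow> \<exists>t'\<in>ceilings x. dominated xs t t'"
    and cfg: "configuration xs (ceilings x)"
  shows "recession_cone (cell x) =
    {v. (\<forall>i j. prec xs i j \<longrightarrow> v $ e j \<le> v $ e i) \<and> (\<forall>t\<in>ceilings x. v $ e (fst t) = v $ e (fst (snd t)))}"
    (is "_ = ?C")
proof -
  have nv: "normal t \<bullet> v = v $ e (fst t) - v $ e (fst (snd t))" for t v
    by (simp add: normal_def inner_diff_left inner_axis')
  have sx: "set xs = {1..n}" using xs by (simp add: descending_def)
  have "v \<in> ?C" if v: "\<forall>t\<in>T. 0 \<le> sgn (gap t x) * (normal t \<bullet> v)" for v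
  proof -
    have mono: "v $ e j \<le> v $ e i" if p: "prec xs i j" for i j
    proof -
      have ij: "i \<in> {1..n}" "j \<in> {1..n}" using prec_in_set[OF p] sx by auto
      have lt: "x $ e j < x $ e i" using p descending_prec[OF xs ij] by simp
      consider "i < j" | "j < i" using lt by (cases i j rule: linorder_cases) auto
      then show ?thesis
      proof cases
        case 1
        then have "(i, j, 0) \<in> T" using ij Cox_sub by (auto simp: pairs_upto_def)
        from v[rule_format, OF this] lt show ?thesis by (simp add: nv)
      next
        case 2
        then have "(j, i, 0) \<in> T" using ij Cox_sub by (auto simp: pairs_upto_def)
        from v[rule_format, OF this] lt show ?thesis by (simp add: nv)
      qed
    qed
    moreover have "v $ e (fst t) = v $ e (fst (snd t))" if t: "t \<in> ceilings x" for t
    proof -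
      have "t \<in> T" "gap t x < 0" using t by (auto simp: ceilings_def T_pos_def)
      then have "v $ e (fst t) \<le> v $ e (fst (snd t))" using v by (auto simp: nv)
      moreover have "v $ e (fst (snd t)) \<le> v $ e (fst t)"
        using mono t cfg by (auto simp: configuration_def)
      ultimately show ?thesis by simp
    qed
    ultimately show ?thesis by blast
  qed
  moreover have "0 \<le> sgn (gap t x) * (normal t \<bullet> v)" if v: "v \<in> ?C" and t: "t \<in> T" for v t
  proof -
    obtain i j c where ijc: "t = (i, j, c)" "i \<in> {1..n}" "j \<in> {1..n}" "i < j" "0 \<le> c" "c = 0 \<or> t \<in> T_pos"
      using T_cases[OF t] by blast
    have w: "weakly_prec xs a b \<Longrightarrow> v $ e b \<le> v $ e a" for a b
      using v by (auto simp: weakly_prec_def)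
    show ?thesis
    proof (cases "prec xs i j")
      case True
      then have vij: "v $ e j \<le> v $ e i" using v by blast
      show ?thesis
      proof (cases "gap t x < 0")
        case neg: True
        have "x $ e j < x $ e i" using True descending_prec[OF xs] ijc by blast
        then have "c \<noteq> 0" using neg ijc by auto
        then have "t \<in> T_pos" using ijc by blast
        then obtain t' where t': "t' \<in> ceilings x" "dominated xs t t'" using dom[of t] neg True unfolding ijc(1) fst_conv snd_conv by blast
        have "v $ e i \<le> v $ e (fst t')" "v $ e (fst (snd t')) \<le> v $ e j"
          using t'(2) w ijc(1) by (auto simp: dominated_def)
        moreover have "v $ e (fst t') = v $ e (fst (snd t'))" using v t'(1) by blast
        ultimately have "v $ e i \<le> v $ e j" by simp
        then show ?thesis using neg by (simp add: nv ijc(1))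
      next
        case False
        then have "0 \<le> sgn (gap t x)" by (simp add: sgn_if)
        then show ?thesis using vij by (simp add: nv ijc(1))
      qed
    next
      case False
      then have "gap t x < 0" using gap_neg_backward[OF xs t] ijc(1) by simp
      moreover have "prec xs j i" using False prec_total[of i xs j] ijc sx by auto
      then have "v $ e i \<le> v $ e j" using v by blast
      ultimately show ?thesis by (simp add: nv ijc(1))
    qed
  qed
  ultimately show ?thesis unfolding recession_cone_cell[OF x] by blast
qed

definition tail_vector :: "nat list \<Rightarrow> nat \<Rightarrow> real ^ 'n" where
  "tail_vector xs p = (\<chi> k. if k \<in> e ` set (take p xs) then 0 else 1)"

lemma tail_vector_nth:
  assumes "set xs = {1..n}" "i \<in> {1..n}"
  shows "tail_vector xs p $ e i = (if i \<in> set (take p xs) then 0 else 1)"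
proof -
  have "e i \<in> e ` set (take p xs) \<longleftrightarrow> i \<in> set (take p xs)"
    using assms set_take_subset[of p xs] e_inj by auto
  then show ?thesis by (simp add: tail_vector_def)
qed

text \<open>The increments of \<open>v\<close> along \<open>xs\<close> are its coordinates with
  respect to the tail vectors, and the increment at a crossed place vanishes. So the tail vectors at
  the uncrossed places form a basis of the span of the cone; \<open>tail_vector xs 0\<close> is the
  all-ones vector.\<close>

lemma dim_monotone_cone:
  assumes xs: "set xs = {1..n}" "distinct xs" and K: "\<And>t. t \<in> K \<Longrightarrow> prec xs (fst t) (fst (snd t))"
  shows "dim {v :: real ^ 'n. (\<forall>i j. prec xs i j \<longrightarrow> v $ e j \<le> v $ e i) \<and>
      (\<forall>t\<in>K. v $ e (fst t) = v $ e (fst (snd t)))} = card (uncrossed (ends ` K) xs)"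
    (is "dim ?C = card ?U")
proof -
  let ?b = "tail_vector xs"
  have len: "length xs = n" using xs distinct_card[of xs] by simp
  have Un: "?U \<subseteq> {..<n}" by (auto simp: uncrossed_def len)
  then have fU: "finite ?U" by (rule finite_subset) simp
  have mem: "xs ! q \<in> {1..n}" if "q < n" for q using that nth_mem[of q xs] len xs by simp
  have b: "?b p $ e (xs ! q) = (if p \<le> q then 1 else 0)" if "q < n" for p q
    using tail_vector_nth[OF xs(1) mem[OF that]] nth_mem_take_iff[OF xs(2), of q p] that len by auto
  have vec_eq: "v = w" if "\<And>q. q < n \<Longrightarrow> v $ e (xs ! q) = w $ e (xs ! q)" for v w :: "real ^ 'n"
  proof (rule vec_eq_iff[THEN iffD2, rule_format])
    fix k obtain i where "i \<in> {1..n}" "k = e i" by (rule e_surj)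
    then obtain q where "q < n" "xs ! q = i" using xs(1) len by (metis in_set_conv_nth)
    then show "v $ k = w $ k" using that \<open>k = e i\<close> by blast
  qed
  have comb: "(\<Sum>p\<in>?U. a p *\<^sub>R ?b p) $ e (xs ! q) = (\<Sum>p\<le>q. a p)"
    if "q < n" "\<And>p. p < n \<Longrightarrow> p \<notin> ?U \<Longrightarrow> a p = 0" for a q
  proof -
    have "(\<Sum>p\<in>?U. a p *\<^sub>R ?b p) $ e (xs ! q) = (\<Sum>p\<in>?U. a p * (if p \<le> q then 1 else 0))"
      using b[OF that(1)] by simp
    also have "\<dots> = (\<Sum>p<n. a p * (if p \<le> q then 1 else 0))"
      using Un that(2) by (intro sum.mono_neutral_left) auto
    also have "\<dots> = (\<Sum>p\<le>q. a p)"
      using that(1) by (intro sum.mono_neutral_cong_right) auto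
    finally show ?thesis .
  qed
  have inj: "inj_on ?b ?U"
  proof (rule inj_onI, rule ccontr)
    fix p p' assume p: "p \<in> ?U" "p' \<in> ?U" "?b p = ?b p'" "p \<noteq> p'"
    then have "p < n" "p' < n" using Un by auto
    then show False using b[of p p] b[of p p'] b[of p' p] b[of p' p'] p(3,4) by (auto split: if_splits)
  qed
  have indep: "independent (?b ` ?U)"
  proof (rule real_vector.independent_if_scalars_zero)
    show "finite (?b ` ?U)" using fU by simp
    fix f w assume s: "(\<Sum>w\<in>?b ` ?U. f w *\<^sub>R w) = 0" and "w \<in> ?b ` ?U"
    then obtain p where p: "p \<in> ?U" "w = ?b p" by blast
    define a where "a = (\<lambda>p. if p \<in> ?U then f (?b p) else 0)"
    have "(\<Sum>p\<in>?U. a p *\<^sub>R ?b p) = (\<Sum>w\<in>?b ` ?U. f w *\<^sub>R w)"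
      by (simp add: sum.reindex[OF inj] a_def)
    then have z: "(\<Sum>p\<le>q. a p) = 0" if "q < n" for q
      using comb[OF that, of a] s by (simp add: a_def)
    have "a q = 0" if "q < n" for q
    proof (cases q)
      case 0
      then show ?thesis using z[OF that] by simp
    next
      case (Suc r)
      then show ?thesis using z[OF that] z[of r] that by simp
    qed
    then have "a p = 0" using p(1) Un by auto
    then show "f w = 0" using p by (simp add: a_def)
  qed
  have "?b p \<in> span ?C" if p: "p \<in> ?U" for p
  proof -
    \<comment> \<open>A tail vector increases along \<open>xs\<close>, whereas the cone asks for
      decreasing vectors; its negative has the same span.\<close>
    have "- ?b p \<in> ?C"
    proof (intro CollectI conjI allI impI ballI)
      fix i j assume ij: "prec xs i j"
      then have m: "i \<in> {1..n}" "j \<in> {1..n}" using prec_in_set[OF ij] xs(1) by auto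
      show "(- ?b p) $ e j \<le> (- ?b p) $ e i"
        using prec_take[OF xs(2) ij, of p] tail_vector_nth[OF xs(1) m(1), of p] tail_vector_nth[OF xs(1) m(2), of p] by simp
    next
      fix t assume t: "t \<in> K"
      have m: "fst t \<in> {1..n}" "fst (snd t) \<in> {1..n}" using prec_in_set[OF K[OF t]] xs(1) by auto
      have "fst t \<in> set (take p xs) \<Longrightarrow> fst (snd t) \<in> set (take p xs)"
        using p t by (auto simp: uncrossed_def)
      then show "(- ?b p) $ e (fst t) = (- ?b p) $ e (fst (snd t))"
        using prec_take[OF xs(2) K[OF t], of p] tail_vector_nth[OF xs(1) m(1), of p]
          tail_vector_nth[OF xs(1) m(2), of p] by auto
    qed
    from span_neg[OF span_base[OF this]] show ?thesis by simp
  qed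
  moreover have "v \<in> span (?b ` ?U)" if v: "v \<in> ?C" for v
  proof -
    define a where "a = (\<lambda>p. if p = 0 then v $ e (xs ! 0) else v $ e (xs ! p) - v $ e (xs ! (p - 1)))"
    \<comment> \<open>Some \<open>t\<close> straddles place \<open>p\<close>. As \<open>v\<close> is
      weakly decreasing from one end of \<open>t\<close> to the other and equal at both, it cannot
      drop from entry \<open>p - 1\<close> to entry \<open>p\<close>.\<close>
    have a0: "a p = 0" if p: "p < n" "p \<notin> ?U" for p
    proof -
      obtain t where t: "t \<in> K" "fst t \<in> set (take p xs)" "fst (snd t) \<notin> set (take p xs)"
        using p by (auto simp: uncrossed_def len)
      then obtain r where r: "p = Suc r" by (cases p) auto
      have m: "fst t \<in> set xs" "fst (snd t) \<in> set xs" using prec_in_set[OF K[OF t(1)]] by auto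
      have sr: "r < n" "p < n" using p(1) r by auto
      have in1: "xs ! r \<in> set (take p xs)" and in2: "xs ! p \<notin> set (take p xs)"
        using nth_mem_take_iff[OF xs(2), of r p] nth_mem_take_iff[OF xs(2), of p p] sr len r by auto
      have w: "v $ e j \<le> v $ e i" if "i \<in> set xs" "j \<in> set xs" "i \<noteq> j \<Longrightarrow> \<not> prec xs j i" for i j
      proof (cases "i = j")
        case False
        then have "prec xs i j" using prec_total[OF that(1,2)] that(3) by blast
        then show ?thesis using v by blast
      qed simp
      have x: "xs ! r \<in> set xs" "xs ! p \<in> set xs" using sr len by auto
      have "\<not> prec xs (xs ! r) (fst t)" if "fst t \<noteq> xs ! r"
      proof
        assume "prec xs (xs ! r) (fst t)"
        then obtain c d where cd: "c < d" "d < length xs" "xs ! c = xs ! r" "xs ! d = fst t"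
          by (auto simp: prec_def)
        then have "c = r" using xs(2) sr len by (metis nth_eq_iff_index_eq order_less_trans)
        then have "\<not> d < p" using cd r by simp
        then show False using nth_mem_take_iff[OF xs(2) cd(2), of p] cd t(2) by simp
      qed
      then have 1: "v $ e (xs ! r) \<le> v $ e (fst t)" using w[OF m(1) x(1)] by blast
      have "\<not> prec xs (fst (snd t)) (xs ! p)" if "fst (snd t) \<noteq> xs ! p"
      proof
        assume "prec xs (fst (snd t)) (xs ! p)"
        then obtain c d where cd: "c < d" "d < length xs" "xs ! c = fst (snd t)" "xs ! d = xs ! p"
          by (auto simp: prec_def)
        then have "d = p" using xs(2) sr len by (metis nth_eq_iff_index_eq)
        then show False using nth_mem_take_iff[OF xs(2), of c p] cd t(3) by simp
      qed
      then have 2: "v $ e (fst (snd t)) \<le> v $ e (xs ! p)" using w[OF x(2) m(2)] by metis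
      have "prec xs (xs ! r) (xs ! p)" unfolding prec_def using r sr len by blast
      then have 3: "v $ e (xs ! p) \<le> v $ e (xs ! r)" using v by blast
      have "v $ e (fst t) = v $ e (fst (snd t))" using v t(1) by blast
      then show ?thesis using 1 2 3 by (simp add: a_def r)
    qed
    have tel: "(\<Sum>p\<le>q. a p) = v $ e (xs ! q)" for q
      by (induction q) (auto simp: a_def)
    have "v = (\<Sum>p\<in>?U. a p *\<^sub>R ?b p)"
    proof (rule vec_eq)
      fix q assume "q < n"
      from comb[OF this a0] tel show "v $ e (xs ! q) = (\<Sum>p\<in>?U. a p *\<^sub>R ?b p) $ e (xs ! q)" by simp
    qed
    also have "\<dots> \<in> span (?b ` ?U)" by (intro span_sum span_scale span_base) auto
    finally show ?thesis .
  qed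
  ultimately have "span ?C = span (?b ` ?U)" by (intro span_eq[THEN iffD2] conjI subsetI) auto
  then have "dim ?C = dim (?b ` ?U)" using dim_span[of ?C] dim_span[of "?b ` ?U"] by argo
  also have "\<dots> = card (?b ` ?U)" using indep by (rule dim_eq_card_independent)
  finally show ?thesis using card_image[OF inj] by simp
qed

end

text \<open>\<open>S\<close> is the set of inequalities made tight: \<open>S = {}\<close> yields a point of a region, a singleton \<open>S\<close> a
  point showing that an undominated inequality is a wall.\<close>

locale realizable_arrangement = difference_arrangement e n T
  for e :: "nat \<Rightarrow> 'n::finite" and n T +
  assumes realize: "\<lbrakk>distinct xs; set xs = {1..n}; K \<subseteq> T_pos; configuration xs K; S \<subseteq> K\<rbrakk> \<Longrightarrow>
    \<exists>x. descending xs x \<and> (\<forall>t\<in>T_pos. prec xs (fst t) (fst (snd t)) \<longrightarrow>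
      (if t \<in> S then gap t x = 0 else if \<exists>t'\<in>K. dominated xs t t' then gap t x < 0 else 0 < gap t x))"
begin

text \<open>If \<open>t'\<close> dominates \<open>t\<close> and holds at \<open>x\<close>, then at a
  certificate \<open>z\<close> for \<open>t\<close> the gap of \<open>t'\<close> would be both
  negative and at least \<open>gap t z = 0\<close>. Conversely, for a maximal \<open>t\<close> the
  realization of all maximal inequalities with only \<open>t\<close> tight is a certificate.\<close>

lemma ceilings_eq_maximal:
  assumes x: "generic x" and xs: "descending xs x"
  shows "ceilings x = {t \<in> below xs x. \<forall>t'\<in>below xs x. dominated xs t t' \<longrightarrow> t = t'}" (is "_ = ?M")
proof (intro set_eqI iffI)
  fix t assume "t \<in> ceilings x"
  then obtain z where t: "t \<in> T_pos" "t \<in> T" "gap t x < 0" "gap t z = 0"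
    and z: "\<And>t'. t' \<in> T - {t} \<Longrightarrow> sgn (gap t' z) = sgn (gap t' x)"
    by (auto simp: ceilings_def T_pos_def)
  have zs: "descending xs z" using z t(1) by (intro descending_cong[OF _ xs]) auto
  have "prec xs (fst t) (fst (snd t))" using gap_neg_backward[OF zs t(2)] t(4) by force
  then have tb: "t \<in> below xs x" using t by (simp add: below_def)
  moreover have "t = t'" if t': "t' \<in> below xs x" "dominated xs t t'" for t'
  proof (rule ccontr)
    assume "t \<noteq> t'"
    then have "t' \<in> T - {t}" "gap t' x < 0" using t' by (auto simp: below_def T_pos_def)
    then have "gap t' z < 0" using z[of t'] by (auto simp: sgn_if split: if_splits)
    moreover have "gap t z \<le> gap t' z" using dominated_gap[OF zs t'(2) t(2)] \<open>t' \<in> T - {t}\<close> by blast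
    ultimately show False using t(4) by simp
  qed
  ultimately show "t \<in> ?M" by blast
next
  have d: "distinct xs" "set xs = {1..n}" using xs descending_distinct by (auto simp: descending_def)
  fix t assume t: "t \<in> ?M"
  have cfg: "configuration xs ?M" by (auto simp: configuration_def below_def)
  have "?M \<subseteq> T_pos" by (auto simp: below_def)
  from realize[OF d this cfg, of "{t}"] t obtain z where z: "descending xs z"
    "\<And>s. s \<in> T_pos \<Longrightarrow> prec xs (fst s) (fst (snd s)) \<Longrightarrow>
      (if s \<in> {t} then gap s z = 0 else if \<exists>t'\<in>?M. dominated xs s t' then gap s z < 0 else 0 < gap s z)"
    by blast
  have tb: "t \<in> T_pos" "prec xs (fst t) (fst (snd t))" "gap t x < 0" using t by (auto simp: below_def)
  have "gap t z = 0" using z(2)[OF tb(1,2)] by simp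
  moreover have "sgn (gap s z) = sgn (gap s x)" if s: "s \<in> T - {t}" for s
  proof (cases "prec xs (fst s) (fst (snd s))")
    case False
    then have "gap s x < 0" "gap s z < 0" using gap_neg_backward xs z(1) s by auto
    then show ?thesis by simp
  next
    case True
    have sT: "s \<in> T" using s by blast
    show ?thesis
    proof (cases "s \<in> T_pos")
      case pos: True
      have "gap s x < 0 \<longleftrightarrow> (\<exists>t'\<in>?M. dominated xs s t')"
      proof
        assume "gap s x < 0"
        then have sb: "s \<in> below xs x" using pos True by (simp add: below_def)
        have "below xs x \<subseteq> T" by (auto simp: below_def T_pos_def)
        then have "finite (below xs x)" using finite_T by (rule finite_subset)
        from ex_maximal_dominated[OF d(1) this sb] show "\<exists>t'\<in>?M. dominated xs s t'" by blast
      next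
        assume "\<exists>t'\<in>?M. dominated xs s t'"
        then obtain t' where t': "t' \<in> T" "gap t' x < 0" "dominated xs s t'" by (auto simp: below_def T_pos_def)
        then show "gap s x < 0" using dominated_gap[OF xs t'(3) sT t'(1)] by simp
      qed
      moreover have "gap s x \<noteq> 0" using x sT by (simp add: generic_def)
      ultimately show ?thesis using z(2)[OF pos True] s by (auto simp: sgn_if split: if_splits)
    next
      case False
      obtain i j c where ijc: "s = (i, j, c)" "i \<in> {1..n}" "j \<in> {1..n}" "c = 0"
        using T_cases[OF sT] False by metis
      then have "0 < gap s x" "0 < gap s z"
        using True descending_prec[OF xs ijc(2,3)] descending_prec[OF z(1) ijc(2,3)] by auto
      then show ?thesis by simp
    qed
  qed
  ultimately show "t \<in> ceilings x" using tb unfolding ceilings_def by blast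
qed

text \<open>Every inequality holding at \<open>x\<close> is dominated by a maximal one, and those
  are the ceilings. Hence the order and the ceilings determine all signs, which gives
  \<open>cell_eqI\<close>.\<close>

lemma gap_neg_iff_dominated:
  assumes x: "generic x" and xs: "descending xs x" and t: "t \<in> T_pos" "prec xs (fst t) (fst (snd t))"
  shows "gap t x < 0 \<longleftrightarrow> (\<exists>t'\<in>ceilings x. dominated xs t t')"
proof
  assume "gap t x < 0"
  then have tb: "t \<in> below xs x" using t by (simp add: below_def)
  have "below xs x \<subseteq> T" by (auto simp: below_def T_pos_def)
  then have "finite (below xs x)" using finite_T by (rule finite_subset)
  from ex_maximal_dominated[OF descending_distinct[OF xs] this tb]
  show "\<exists>t'\<in>ceilings x. dominated xs t t'" unfolding ceilings_eq_maximal[OF x xs] by blast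
next
  assume "\<exists>t'\<in>ceilings x. dominated xs t t'"
  then obtain t' where t': "t' \<in> T" "gap t' x < 0" "dominated xs t t'" by (auto simp: ceilings_def T_pos_def)
  moreover have "t \<in> T" using t by (simp add: T_pos_def)
  ultimately show "gap t x < 0" using dominated_gap[OF xs t'(3) _ t'(1)] by force
qed

lemma configuration_ceilings:
  assumes x: "generic x" and xs: "descending xs x"
  shows "configuration xs (ceilings x)"
  unfolding ceilings_eq_maximal[OF x xs] by (auto simp: configuration_def below_def)

lemma ex_cell_with_ceilings:
  assumes xs: "distinct xs" "set xs = {1..n}" and K: "K \<subseteq> T_pos" "configuration xs K"
  obtains x where "generic x" "descending xs x" "ceilings x = K"
proof -
  obtain x where x: "descending xs x"
    "\<And>t. t \<in> T_pos \<Longrightarrow> prec xs (fst t) (fst (snd t)) \<Longrightarrow>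
      (if \<exists>t'\<in>K. dominated xs t t' then gap t x < 0 else 0 < gap t x)"
    using realize[OF xs K, of "{}"] by auto
  have gen: "generic x" unfolding generic_def
  proof
    fix t assume t: "t \<in> T"
    show "gap t x \<noteq> 0"
    proof (cases "prec xs (fst t) (fst (snd t))")
      case False
      then show ?thesis using gap_neg_backward[OF x(1) t] by simp
    next
      case True
      show ?thesis
      proof (cases "t \<in> T_pos")
        case pos: True
        then show ?thesis using x(2)[OF pos True] by (auto split: if_splits)
      next
        case False
        obtain i j c where ijc: "t = (i, j, c)" "i \<in> {1..n}" "j \<in> {1..n}" "c = 0"
          using T_cases[OF t] False by metis
        then show ?thesis using True descending_prec[OF x(1) ijc(2,3)] by auto
      qed
    qed
  qed
  have B: "t \<in> below xs x \<longleftrightarrow> t \<in> T_pos \<and> prec xs (fst t) (fst (snd t)) \<and> (\<exists>t'\<in>K. dominated xs t t')" for t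
    using x(2)[of t] by (auto simp: below_def split: if_splits)
  have KB: "k \<in> below xs x" if "k \<in> K" for k
    using that K dominated_refl[of xs k] unfolding B by (auto simp: configuration_def)
  have anti: "k = k'" if "k \<in> K" "k' \<in> K" "dominated xs k k'" for k k'
    using that K(2) by (auto simp: configuration_def)
  have "ceilings x = K" unfolding ceilings_eq_maximal[OF gen x(1)]
  proof (intro set_eqI iffI CollectI conjI ballI impI)
    fix t assume "t \<in> {t \<in> below xs x. \<forall>t'\<in>below xs x. dominated xs t t' \<longrightarrow> t = t'}"
    then show "t \<in> K" using B KB by blast
  next
    fix t assume t: "t \<in> K"
    then show "t \<in> below xs x" by (rule KB)
    fix t' assume t': "t' \<in> below xs x" "dominated xs t t'"
    then obtain k where k: "k \<in> K" "dominated xs t' k" using B by blast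
    then have "t = k" using anti[OF t] dominated_trans[OF xs(1) t'(2)] by blast
    then show "t = t'" using dominated_antisym[OF xs(1) t'(2)] k by blast
  qed
  with gen x(1) show thesis using that by blast
qed

lemma cell_eqI:
  assumes "generic x" "generic y" and xs: "descending xs x" "descending xs y" and "ceilings x = ceilings y"
  shows "cell x = cell y"
proof -
  have "sgn (gap t x) = sgn (gap t y)" if t: "t \<in> T" for t
  proof (cases "prec xs (fst t) (fst (snd t))")
    case False
    then have "gap t x < 0" "gap t y < 0" using gap_neg_backward xs t by auto
    then show ?thesis by simp
  next
    case True
    show ?thesis
    proof (cases "t \<in> T_pos")
      case pos: True
      then have "gap t x < 0 \<longleftrightarrow> gap t y < 0"
        using gap_neg_iff_dominated[OF assms(1) xs(1) pos True]
          gap_neg_iff_dominated[OF assms(2) xs(2) pos True] assms(5) by simp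
      moreover have "gap t x \<noteq> 0" "gap t y \<noteq> 0" using assms(1,2) t by (simp_all add: generic_def)
      ultimately show ?thesis by (auto simp: sgn_if)
    next
      case False
      obtain i j c where ijc: "t = (i, j, c)" "i \<in> {1..n}" "j \<in> {1..n}" "c = 0"
        using T_cases[OF t] False by metis
      then have "0 < gap t x" "0 < gap t y"
        using True descending_prec[OF xs(1) ijc(2,3)] descending_prec[OF xs(2) ijc(2,3)] by auto
      then show ?thesis by simp
    qed
  qed
  then show ?thesis by (simp add: cell_def)
qed

lemma degrees_of_freedom_cell:
  assumes x: "generic x" and xs: "descending xs x"
  shows "degrees_of_freedom (cell x) = card (uncrossed (ends ` ceilings x) xs)"
proof -
  have cfg: "configuration xs (ceilings x)" by (rule configuration_ceilings[OF x xs])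
  have "recession_cone (cell x) = {v. (\<forall>i j. prec xs i j \<longrightarrow> v $ e j \<le> v $ e i) \<and>
      (\<forall>t\<in>ceilings x. v $ e (fst t) = v $ e (fst (snd t)))}"
    using gap_neg_iff_dominated[OF x xs] cfg by (intro recession_cone_eq[OF x xs]) auto
  then show ?thesis unfolding degrees_of_freedom_def
    using cfg xs descending_distinct[OF xs]
    by (simp add: dim_monotone_cone configuration_def descending_def)
qed

definition region_ceilings :: "(real ^ 'n) set \<Rightarrow> (nat \<times> nat \<times> real) set" where
  "region_ceilings R = {t \<in> difference_triples n. is_ceiling R (hyp t)}"

lemma region_ceilings_cell: "generic x \<Longrightarrow> region_ceilings (cell x) = ceilings x"
  using is_ceiling_hyp_iff T_triple by (auto simp: region_ceilings_def ceilings_def T_pos_def)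

lemma region_configuration:
  assumes "R \<in> regions (hyp ` T)"
  obtains xs where "distinct xs" "set xs = {1..n}" "configuration xs (region_ceilings R)"
    "region_ceilings R \<subseteq> T_pos"
proof -
  obtain x where x: "generic x" "R = cell x" using assms unfolding regions_eq by blast
  obtain xs where xs: "descending xs x" using ex_descending[OF x(1)] .
  show thesis
  proof (rule that)
    show "distinct xs" using xs by (rule descending_distinct)
    show "set xs = {1..n}" using xs by (simp add: descending_def)
    show "configuration xs (region_ceilings R)"
      unfolding x(2) region_ceilings_cell[OF x(1)] by (rule configuration_ceilings[OF x(1) xs])
    show "region_ceilings R \<subseteq> T_pos"
      unfolding x(2) region_ceilings_cell[OF x(1)] by (auto simp: ceilings_def)
  qed
qed

lemma card_ceilings_region:
  assumes "R \<in> regions (hyp ` T)"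
  shows "card {H. is_ceiling R H} = card (region_ceilings R)"
  using assms card_ceilings region_ceilings_cell unfolding regions_eq by auto

text \<open>Each order for which \<open>K\<close> is a configuration carries exactly one region with
  ceilings \<open>K\<close>: existence is \<open>ex_cell_with_ceilings\<close>, uniqueness is
  \<open>cell_eqI\<close>, and a region determines its order. The predicate \<open>Q\<close> lets
  the plain count and the count by degrees of freedom come from one bijection.\<close>

theorem card_regions_with_ceilings:
  assumes K: "K \<subseteq> T_pos"
  shows "card {R \<in> regions (hyp ` T). region_ceilings R = K \<and> Q (degrees_of_freedom R)} =
    card {xs. distinct xs \<and> set xs = {1..n} \<and> configuration xs K \<and> Q (card (uncrossed (ends ` K) xs))}"
    (is "card ?R = card ?X")
proof -
  define pt where "pt xs = (SOME x. generic x \<and> descending xs x \<and> ceilings x = K)" for xs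
  have pt: "generic (pt xs)" "descending xs (pt xs)" "ceilings (pt xs) = K" if "xs \<in> ?X" for xs
  proof -
    have "\<exists>x. generic x \<and> descending xs x \<and> ceilings x = K"
      using ex_cell_with_ceilings[OF _ _ K] that by blast
    from someI_ex[OF this] show "generic (pt xs)" "descending xs (pt xs)" "ceilings (pt xs) = K"
      by (auto simp: pt_def)
  qed
  have "bij_betw (\<lambda>xs. cell (pt xs)) ?X ?R"
  proof (rule bij_betw_imageI)
    show "inj_on (\<lambda>xs. cell (pt xs)) ?X"
    proof (rule inj_onI)
      fix xs ys assume a: "xs \<in> ?X" "ys \<in> ?X" "cell (pt xs) = cell (pt ys)"
      then have "pt ys \<in> cell (pt xs)" using mem_cell_self by simp
      then have "descending xs (pt ys)" using descending_cell[OF pt(2)[OF a(1)]] by blast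
      then show "xs = ys" using descending_unique pt(2)[OF a(2)] by blast
    qed
    show "(\<lambda>xs. cell (pt xs)) ` ?X = ?R"
    proof (intro set_eqI iffI)
      fix R assume "R \<in> (\<lambda>xs. cell (pt xs)) ` ?X"
      then obtain xs where xs: "xs \<in> ?X" "R = cell (pt xs)" by blast
      note p = pt[OF xs(1)]
      show "R \<in> ?R" using xs p region_ceilings_cell[OF p(1)] degrees_of_freedom_cell[OF p(1,2)]
        by (auto simp: regions_eq)
    next
      fix R assume R: "R \<in> ?R"
      then obtain x where x: "generic x" "R = cell x" unfolding regions_eq by blast
      obtain xs where xs: "descending xs x" using ex_descending[OF x(1)] .
      have cx: "ceilings x = K" using R x region_ceilings_cell by auto
      have X: "xs \<in> ?X"
        using R x xs descending_distinct[OF xs] configuration_ceilings[OF x(1) xs]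
          degrees_of_freedom_cell[OF x(1) xs] cx by (auto simp: descending_def)
      have "cell (pt xs) = cell x" using pt[OF X] x xs cx by (intro cell_eqI) auto
      then show "R \<in> (\<lambda>xs. cell (pt xs)) ` ?X" using X x(2) by blast
    qed
  qed
  from bij_betw_same_card[OF this] show ?thesis by (rule sym)
qed

end

lemma (in difference_arrangement) finite_regions: "finite (regions (hyp ` T))"
proof -
  let ?F = "\<lambda>s. {y. \<forall>t\<in>T. sgn (gap t y) = s t}"
  have "regions (hyp ` T) \<subseteq> ?F ` (T \<rightarrow>\<^sub>E {-1, 0, 1})"
  proof
    fix R assume "R \<in> regions (hyp ` T)"
    then obtain x where x: "R = cell x" unfolding regions_eq by blast
    have "R = ?F (restrict (\<lambda>t. sgn (gap t x)) T)" by (auto simp: x cell_def)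
    moreover have "restrict (\<lambda>t. sgn (gap t x)) T \<in> T \<rightarrow>\<^sub>E {-1, 0, 1}"
      by (intro restrict_PiE_iff[THEN iffD2] ballI) (simp add: sgn_if)
    ultimately show "R \<in> ?F ` (T \<rightarrow>\<^sub>E {-1, 0, 1})" by (rule image_eqI)
  qed
  moreover have "finite (?F ` (T \<rightarrow>\<^sub>E {-1, 0, 1}))" using finite_T by (intro finite_imageI finite_PiE) auto
  ultimately show ?thesis by (rule finite_subset)
qed

section \<open>Regions counted by ceiling partition, for an abstract deformation\<close>

definition deformation :: "nat \<Rightarrow> (nat \<times> nat) set \<Rightarrow> (nat \<times> nat \<Rightarrow> nat \<times> nat \<times> real) \<Rightarrow> (nat \<times> nat \<times> real) set" where
  "deformation n G f = (\<lambda>(i, j). (i, j, 0)) ` pairs_upto n \<union> f ` G"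

text \<open>Besides realizability, two things are left to the concrete arrangement:
  \<open>matching\<close>, by which the edges of the ceilings of a region are the arcs of a
  partition, and \<open>path\<close>, which turns the orders compatible with a given partition into
  nonnesting orders of a path system with equally many arcs and the same uncrossed places.\<close>

locale ceiling_arrangement = realizable_arrangement e n "deformation n G f"
  for e :: "nat \<Rightarrow> 'n::finite" and n G f +
  assumes G_sub: "G \<subseteq> pairs_upto n"
    and f_inj: "inj_on f (pairs_upto n)"
    and f_triple: "p \<in> pairs_upto n \<Longrightarrow> f p \<in> difference_triples n"
    and f_pos: "p \<in> pairs_upto n \<Longrightarrow> 0 < snd (snd (f p))"
    and matching: "\<lbrakk>distinct xs; set xs = {1..n}; K \<subseteq> G; configuration xs (f ` K); (i, j) \<in> K; (i', j') \<in> K\<rbrakk>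
      \<Longrightarrow> i = i' \<longleftrightarrow> j = j'"
    and path: "\<lbrakk>partition_on {1..n} P; arcs P \<subseteq> G\<rbrakk> \<Longrightarrow>
      \<exists>E. path_system {1..n} E \<and> card E = card (arcs P) \<and>
        (\<forall>xs. distinct xs \<longrightarrow> set xs = {1..n} \<longrightarrow>
           (configuration xs (f ` arcs P) \<longleftrightarrow> nonnesting {1..n} E xs) \<and>
           (nonnesting {1..n} E xs \<longrightarrow> uncrossed (ends ` f ` arcs P) xs = uncrossed E xs))"
begin

lemma T_pos_eq: "T_pos = f ` G"
proof (intro set_eqI iffI)
  fix t assume "t \<in> T_pos"
  then have t: "t \<in> deformation n G f" "0 < snd (snd t)" by (simp_all add: T_pos_def level_def)
  then have "t \<notin> (\<lambda>(i, j). (i, j, 0)) ` pairs_upto n" by auto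
  with t(1) show "t \<in> f ` G" by (simp add: deformation_def)
next
  fix t assume "t \<in> f ` G"
  then obtain p where p: "p \<in> G" "t = f p" by blast
  then have "0 < snd (snd t)" "t \<in> deformation n G f" using f_pos[of p] G_sub by (auto simp: deformation_def)
  then show "t \<in> T_pos" by (simp add: T_pos_def level_def)
qed

definition ceiling_pairs :: "(real ^ 'n) set \<Rightarrow> (nat \<times> nat) set" where
  "ceiling_pairs R = {p \<in> pairs_upto n. is_ceiling R (hyp (f p))}"

definition ceiling_partition :: "(real ^ 'n) set \<Rightarrow> nat set set \<Rightarrow> bool" where
  "ceiling_partition R P \<longleftrightarrow> partition_on {1..n} P \<and> arcs P = ceiling_pairs R"

abbreviation "Reg \<equiv> regions (hyp ` deformation n G f)"

text \<open>\<open>ceiling_pairs\<close> tests all pairs and not only the edges. Ceilings have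
  positive level and so come from \<open>G\<close>; injectivity of \<open>f\<close> on all pairs
  then excludes the non-edges.\<close>

lemma region_ceilings_eq:
  assumes "R \<in> Reg"
  shows "region_ceilings R = f ` ceiling_pairs R" "ceiling_pairs R \<subseteq> G"
proof -
  have sub: "region_ceilings R \<subseteq> f ` G"
    using region_configuration[OF assms] unfolding T_pos_eq by blast
  show eq: "region_ceilings R = f ` ceiling_pairs R"
  proof (intro set_eqI iffI)
    fix t assume t: "t \<in> region_ceilings R"
    then obtain p where "p \<in> G" "t = f p" using sub by blast
    then show "t \<in> f ` ceiling_pairs R" using t G_sub by (auto simp: region_ceilings_def ceiling_pairs_def)
  next
    fix t assume "t \<in> f ` ceiling_pairs R"
    then obtain p where "p \<in> pairs_upto n" "is_ceiling R (hyp (f p))" "t = f p"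
      unfolding ceiling_pairs_def by blast
    then show "t \<in> region_ceilings R" using f_triple unfolding region_ceilings_def by blast
  qed
  show "ceiling_pairs R \<subseteq> G"
  proof
    fix p assume p: "p \<in> ceiling_pairs R"
    then obtain q where q: "q \<in> G" "f p = f q" using eq sub by blast
    have "p \<in> pairs_upto n" using p by (simp add: ceiling_pairs_def)
    then have "p = q" using q G_sub inj_onD[OF f_inj] by blast
    then show "p \<in> G" using q by simp
  qed
qed

lemma ceiling_partition_iff:
  assumes "R \<in> Reg" "partition_on {1..n} P"
  shows "ceiling_partition R P \<longleftrightarrow> region_ceilings R = f ` arcs P"
proof -
  have "ceiling_pairs R \<subseteq> pairs_upto n" by (auto simp: ceiling_pairs_def)
  then have "f ` ceiling_pairs R = f ` arcs P \<longleftrightarrow> ceiling_pairs R = arcs P"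
    by (rule inj_on_image_eq_iff[OF f_inj _ arcs_subset_pairs[OF assms(2)]])
  then show ?thesis using assms(2) unfolding ceiling_partition_def region_ceilings_eq(1)[OF assms(1)] by auto
qed

lemma card_pairs_image: "K \<subseteq> pairs_upto n \<Longrightarrow> card (f ` K) = card K"
  using inj_on_subset[OF f_inj] by (rule card_image)

lemma ex_ceiling_partition:
  assumes "R \<in> Reg"
  obtains P where "ceiling_partition R P" "P \<in> G_partitions n G" "card P + card {H. is_ceiling R H} = n"
proof -
  obtain xs where xs: "distinct xs" "set xs = {1..n}" "configuration xs (region_ceilings R)"
    using region_configuration[OF assms] .
  note K = region_ceilings_eq[OF assms]
  note m = matching[OF xs(1,2) K(2) xs(3)[unfolded K(1)]]
  have sub: "ceiling_pairs R \<subseteq> pairs_upto n" using K(2) G_sub by blast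
  obtain P where P: "partition_on {1..n} P" "arcs P = ceiling_pairs R"
    using ex_partition_arcs[OF sub] m by metis
  have "card (arcs P) = card {H. is_ceiling R H}"
    unfolding card_ceilings_region[OF assms] K(1) P(2) card_pairs_image[OF sub] ..
  moreover have "card (arcs P) + card P = n" using card_arcs[OF P(1)] by simp
  ultimately show thesis using that[of P] P K(2) by (simp add: ceiling_partition_def G_partitions_def)
qed

lemma ceiling_partition_unique:
  assumes "ceiling_partition R P" "ceiling_partition R P'"
  shows "P = P'"
  using assms arcs_inject[of "{1..n}" P P'] by (simp add: ceiling_partition_def)

lemma card_regions_with_partition:
  assumes P: "partition_on {1..n} P" "arcs P \<subseteq> G" "card P = k"
  shows "real (card {R \<in> Reg. ceiling_partition R P}) = fact n / fact (n - k + 1)"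
    and "1 \<le> d \<Longrightarrow> d \<le> k \<Longrightarrow>
      real (card {R \<in> Reg. ceiling_partition R P \<and> degrees_of_freedom R = d}) = freedom_count n k d"
proof -
  obtain E where E: "path_system {1..n} E" "card E = card (arcs P)"
    and iff: "\<And>xs. distinct xs \<Longrightarrow> set xs = {1..n} \<Longrightarrow>
      (configuration xs (f ` arcs P) \<longleftrightarrow> nonnesting {1..n} E xs) \<and>
           (nonnesting {1..n} E xs \<longrightarrow> uncrossed (ends ` f ` arcs P) xs = uncrossed E xs)"
    using path[OF P(1,2)] by blast
  interpret path_system "{1..n}" E by (rule E(1))
  have k: "card E = n - k" "k \<le> n" using card_arcs[OF P(1)] E(2) P(3) by auto
  have K: "f ` arcs P \<subseteq> T_pos" using P(2) by (auto simp: T_pos_eq)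
  have C: "card {R \<in> Reg. ceiling_partition R P \<and> Q (degrees_of_freedom R)} =
      card {xs. nonnesting {1..n} E xs \<and> Q (card (uncrossed E xs))}" for Q
  proof -
    have "card {R \<in> Reg. ceiling_partition R P \<and> Q (degrees_of_freedom R)} =
        card {R \<in> Reg. region_ceilings R = f ` arcs P \<and> Q (degrees_of_freedom R)}"
      by (rule arg_cong[where f = card]) (use ceiling_partition_iff[OF _ P(1)] in blast)
    also have "\<dots> = card {xs. distinct xs \<and> set xs = {1..n} \<and> configuration xs (f ` arcs P) \<and>
        Q (card (uncrossed (ends ` f ` arcs P) xs))}"
      by (rule card_regions_with_ceilings[OF K])
    also have "{xs. distinct xs \<and> set xs = {1..n} \<and> configuration xs (f ` arcs P) \<and>
        Q (card (uncrossed (ends ` f ` arcs P) xs))} =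
        {xs. nonnesting {1..n} E xs \<and> Q (card (uncrossed E xs))}"
    proof (rule Collect_cong)
      fix xs
      have "nonnesting {1..n} E xs \<Longrightarrow> distinct xs \<and> set xs = {1..n}" by (simp add: nonnesting_def)
      then show "(distinct xs \<and> set xs = {1..n} \<and> configuration xs (f ` arcs P) \<and>
          Q (card (uncrossed (ends ` f ` arcs P) xs))) =
          (nonnesting {1..n} E xs \<and> Q (card (uncrossed E xs)))"
        using iff[of xs] by (cases "distinct xs \<and> set xs = {1..n}"; cases "nonnesting {1..n} E xs") auto
    qed
    finally show ?thesis .
  qed
  show "real (card {R \<in> Reg. ceiling_partition R P}) = fact n / fact (n - k + 1)"
    using C[of "\<lambda>_. True"] card_nonnesting(1)[of n k] k by simp
  assume "1 \<le> d" "d \<le> k"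
  then show "real (card {R \<in> Reg. ceiling_partition R P \<and> degrees_of_freedom R = d}) = freedom_count n k d"
    using C[of "\<lambda>m. m = d"] card_nonnesting(2)[of n k d] k by simp
qed

theorem ceiling_partition_counts:
  "(\<forall>P k a b. partition_on {1..n} P \<and> card P = k \<and> endpoint_notation P a b \<longrightarrow>
     ((\<exists>R\<in>Reg. ceiling_partition R P) \<longleftrightarrow> (\<forall>i<length a. (a ! i, b ! i) \<in> G)) \<and>
     ((\<forall>i<length a. (a ! i, b ! i) \<in> G) \<longrightarrow>
        real (card {R \<in> Reg. ceiling_partition R P}) = fact n / fact (n - k + 1) \<and>
        (\<forall>d. 1 \<le> d \<and> d \<le> k \<longrightarrow>
           real (card {R \<in> Reg. ceiling_partition R P \<and> degrees_of_freedom R = d}) = freedom_count n k d)))"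
proof (intro allI impI, elim conjE)
  fix P k a b
  assume P: "partition_on {1..n} P" "card P = k" and ab: "endpoint_notation P a b"
  have "(\<forall>i<length a. (a ! i, b ! i) \<in> G) \<longleftrightarrow> set (zip a b) \<subseteq> G"
    using ab by (auto simp: endpoint_notation_def set_zip)
  also have "\<dots> \<longleftrightarrow> arcs P \<subseteq> G" using ab by (simp add: endpoint_notation_def)
  finally have iff: "(\<forall>i<length a. (a ! i, b ! i) \<in> G) \<longleftrightarrow> arcs P \<subseteq> G" .
  have "arcs P \<subseteq> G" if "R \<in> Reg" "ceiling_partition R P" for R
    using region_ceilings_eq(2)[OF that(1)] that(2) by (simp add: ceiling_partition_def)
  moreover have "\<exists>R\<in>Reg. ceiling_partition R P" if "arcs P \<subseteq> G"
  proof -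
    \<comment> \<open>Existence is read off from the count, since \<open>n! / (n-k+1)!\<close> is
      not zero.\<close>
    have "real (card {R \<in> Reg. ceiling_partition R P}) \<noteq> 0"
      using card_regions_with_partition(1)[OF P(1) that P(2)] by simp
    then have "{R \<in> Reg. ceiling_partition R P} \<noteq> {}" by (metis card.empty of_nat_0)
    then show ?thesis by blast
  qed
  ultimately show "((\<exists>R\<in>Reg. ceiling_partition R P) \<longleftrightarrow> (\<forall>i<length a. (a ! i, b ! i) \<in> G)) \<and>
     ((\<forall>i<length a. (a ! i, b ! i) \<in> G) \<longrightarrow>
        real (card {R \<in> Reg. ceiling_partition R P}) = fact n / fact (n - k + 1) \<and>
        (\<forall>d. 1 \<le> d \<and> d \<le> k \<longrightarrow>
           real (card {R \<in> Reg. ceiling_partition R P \<and> degrees_of_freedom R = d}) = freedom_count n k d))"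
    unfolding iff using card_regions_with_partition[OF P(1) _ P(2)] by blast
qed

text \<open>Each region has exactly one ceiling partition, and its number of blocks is
  \<open>n\<close> minus the number of ceilings; so the regions split disjointly over the
  \<open>G\<close>-partitions with \<open>n - c\<close> blocks.\<close>

theorem ceiling_number_counts:
  assumes "1 \<le> d" "d \<le> n - c"
  shows "real (card {R \<in> Reg. card {H. is_ceiling R H} = c \<and> degrees_of_freedom R = d}) =
    (\<Sum>P\<in>{P \<in> G_partitions n G. card P = n - c}. freedom_count n (n - c) d)"
proof -
  let ?Ps = "{P \<in> G_partitions n G. card P = n - c}"
  let ?S = "\<lambda>P. {R \<in> Reg. ceiling_partition R P \<and> degrees_of_freedom R = d}"
  have eq: "{R \<in> Reg. card {H. is_ceiling R H} = c \<and> degrees_of_freedom R = d} = (\<Union>P\<in>?Ps. ?S P)"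
  proof (intro set_eqI iffI)
    fix R assume R: "R \<in> {R \<in> Reg. card {H. is_ceiling R H} = c \<and> degrees_of_freedom R = d}"
    then obtain P where P: "ceiling_partition R P" "P \<in> G_partitions n G" "card P + card {H. is_ceiling R H} = n"
      using ex_ceiling_partition[of R] by blast
    then have "P \<in> ?Ps" using R by auto
    then show "R \<in> (\<Union>P\<in>?Ps. ?S P)" using P(1) R by blast
  next
    fix R assume "R \<in> (\<Union>P\<in>?Ps. ?S P)"
    then obtain P where P: "P \<in> ?Ps" "R \<in> Reg" "ceiling_partition R P" "degrees_of_freedom R = d" by blast
    obtain P' where P': "ceiling_partition R P'" "card P' + card {H. is_ceiling R H} = n"
      using ex_ceiling_partition[OF P(2)] .
    have "P' = P" using ceiling_partition_unique P'(1) P(3) by blast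
    \<comment> \<open>The subtraction \<open>n - c\<close> is truncated;
      \<open>1 <= d <= n - c\<close> forces \<open>c < n\<close>, so it can be inverted.\<close>
    then have "card {H. is_ceiling R H} = c" using P'(2) P(1) assms by auto
    then show "R \<in> {R \<in> Reg. card {H. is_ceiling R H} = c \<and> degrees_of_freedom R = d}" using P by blast
  qed
  have card: "card (\<Union>P\<in>?Ps. ?S P) = (\<Sum>P\<in>?Ps. card (?S P))"
  proof (rule card_UN_disjoint)
    have "G_partitions n G \<subseteq> Pow (Pow {1..n})" by (auto simp: G_partitions_def partition_on_def)
    then have "finite (G_partitions n G)" by (rule finite_subset) simp
    then show "finite ?Ps" by simp
    show "\<forall>P\<in>?Ps. finite (?S P)" using finite_regions by simp
    show "\<forall>P\<in>?Ps. \<forall>P'\<in>?Ps. P \<noteq> P' \<longrightarrow> ?S P \<inter> ?S P' = {}" using ceiling_partition_unique by blast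
  qed
  have "real (\<Sum>P\<in>?Ps. card (?S P)) = (\<Sum>P\<in>?Ps. real (card (?S P)))" by (rule of_nat_sum)
  also have "\<dots> = (\<Sum>P\<in>?Ps. freedom_count n (n - c) d)"
  proof (rule sum.cong)
    fix P assume "P \<in> ?Ps"
    then have "partition_on {1..n} P" "arcs P \<subseteq> G" "card P = n - c" unfolding G_partitions_def by blast+
    then show "real (card (?S P)) = freedom_count n (n - c) d"
      using assms by (rule card_regions_with_partition(2))
  qed (rule refl)
  finally show ?thesis unfolding eq card .
qed

end

subsection \<open>The Shi arrangement\<close>

lemma prec_nth_iff:
  assumes "distinct xs" "p < length xs" "q < length xs"
  shows "prec xs (xs ! p) (xs ! q) \<longleftrightarrow> p < q"
proof
  assume "prec xs (xs ! p) (xs ! q)"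
  then obtain a b where ab: "a < b" "b < length xs" "xs ! a = xs ! p" "xs ! b = xs ! q"
    by (auto simp: prec_def)
  then have "a = p" "b = q" using assms nth_eq_iff_index_eq[OF assms(1)] by auto
  then show "p < q" using ab by simp
next
  assume "p < q"
  then show "prec xs (xs ! p) (xs ! q)" using assms by (auto simp: prec_def)
qed

lemma weakly_prec_nth_iff:
  assumes "distinct xs" "p < length xs" "q < length xs"
  shows "weakly_prec xs (xs ! p) (xs ! q) \<longleftrightarrow> p \<le> q"
  unfolding weakly_prec_def prec_nth_iff[OF assms] nth_eq_iff_index_eq[OF assms] by auto

lemma weakly_prec_total: "a \<in> set xs \<Longrightarrow> b \<in> set xs \<Longrightarrow> weakly_prec xs a b \<or> weakly_prec xs b a"
  using prec_total[of a xs b] by (auto simp: weakly_prec_def)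

context difference_arrangement
begin

lemma ex_descending_point:
  fixes h :: "nat \<Rightarrow> real"
  assumes xs: "distinct xs" "set xs = {1..n}" and h: "\<And>p q. p < q \<Longrightarrow> q < n \<Longrightarrow> h p < h q"
  shows "\<exists>x. descending xs x \<and> (\<forall>p<n. x $ e (xs ! p) = - h p)"
proof -
  have len: "length xs = n" using xs distinct_card[of xs] by simp
  define x :: "real ^ 'n" where "x = (\<chi> k. - h (THE p. p < n \<and> e (xs ! p) = k))"
  have x: "x $ e (xs ! p) = - h p" if "p < n" for p
  proof -
    have m: "xs ! q \<in> {1..n}" if "q < n" for q using that nth_mem[of q xs] len xs(2) by simp
    have "q = p" if "q < n" "e (xs ! q) = e (xs ! p)" for q
      using that \<open>p < n\<close> e_inj[OF m m] nth_eq_iff_index_eq[OF xs(1)] len by auto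
    then have "(THE q. q < n \<and> e (xs ! q) = e (xs ! p)) = p" using that by (intro the_equality) auto
    then show ?thesis by (simp add: x_def)
  qed
  have "descending xs x"
    unfolding descending_def sorted_wrt_iff_nth_less using x h xs len by auto
  with x show ?thesis by blast
qed

end

lemma difference_arrangement_deformation:
  fixes e :: "nat \<Rightarrow> 'n::finite"
  assumes "n = CARD('n)" "bij_betw e {1..n} UNIV" "G \<subseteq> pairs_upto n"
    and f: "\<And>p. p \<in> pairs_upto n \<Longrightarrow> f p \<in> difference_triples n"
  shows "difference_arrangement e n (deformation n G f)"
proof
  show "deformation n G f \<subseteq> difference_triples n"
  proof
    fix t assume "t \<in> deformation n G f"
    then consider "t \<in> (\<lambda>(i, j). (i, j, 0)) ` pairs_upto n" | p where "p \<in> G" "t = f p"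
      unfolding deformation_def by blast
    then show "t \<in> difference_triples n"
    proof cases
      case 1
      then show ?thesis by (auto simp: difference_triples_def)
    next
      case 2
      then show ?thesis using f assms(3) by blast
    qed
  qed
  have "finite G" using assms(3) finite_pairs_upto finite_subset by blast
  then show "finite (deformation n G f)" using finite_pairs_upto by (simp add: deformation_def)
  show "(i, j, 0) \<in> deformation n G f" if "(i, j) \<in> pairs_upto n" for i j
    using that by (force simp: deformation_def)
qed (use assms in auto)

text \<open>The points are placed one after the other; \<open>q\<close> has to stay within distance 1 of exactly those
  earlier points that share an interval of \<open>K\<close> with it, and these form a final segment.\<close>

lemma unit_interval_realization:
  fixes K S :: "(nat \<times> nat) set"
  assumes anti: "\<And>p q p' q'. (p, q) \<in> K \<Longrightarrow> (p', q') \<in> K \<Longrightarrow> p' \<le> p \<Longrightarrow> q \<le> q' \<Longrightarrow> p = p' \<and> q = q'"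
    and S: "S \<subseteq> K"
  shows "\<exists>h :: nat \<Rightarrow> real. \<forall>p q. p < q \<and> q < N \<longrightarrow> h p < h q \<and>
    (if (p, q) \<in> S then h q = h p + 1
     else if \<exists>p' q'. (p', q') \<in> K \<and> p' \<le> p \<and> q \<le> q' then h q < h p + 1 else h p + 1 < h q)"
proof (induction N)
  case (Suc N)
  let ?cov = "\<lambda>p q. \<exists>p' q'. (p', q') \<in> K \<and> p' \<le> p \<and> q \<le> q'"
  let ?ok = "\<lambda>h p q. (h p :: real) < h q \<and> (if (p, q) \<in> S then h q = h p + 1
     else if ?cov p q then h q < h p + 1 else h p + 1 < h q)"
  obtain h where h: "\<And>p q. p < q \<Longrightarrow> q < N \<Longrightarrow> ?ok h p q" using Suc.IH by blast
  have mono: "h p < h q" if "p < q" "q < N" for p q using h[OF that] by blast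
  have Scov: "?cov p q" if "(p, q) \<in> S" for p q using that S by blast
  have "\<exists>y. \<forall>p<N. h p < y \<and> (if (p, N) \<in> S then y = h p + 1
     else if ?cov p N then y < h p + 1 else h p + 1 < y)"
  proof (cases "\<exists>p<N. ?cov p N")
    case False
    \<comment> \<open>No earlier point has to be near, so the new one goes more than
      \<open>1\<close> beyond all of them. The \<open>0\<close> keeps the maximum defined when there
      are none.\<close>
    define y where "y = Max (insert 0 (h ` {..<N})) + 2"
    have "h p + 1 < y" if "p < N" for p
    proof -
      have "h p \<le> Max (insert 0 (h ` {..<N}))" using that by (intro Max_ge) auto
      then show ?thesis by (simp add: y_def)
    qed
    moreover have "\<not> ?cov p N" "(p, N) \<notin> S" if "p < N" for p using False that Scov by blast+
    ultimately show ?thesis by (intro exI[of _ y]) force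
  next
    case True
    \<comment> \<open>The leftmost earlier point that the new one has to stay close to.\<close>
    define l where "l = (LEAST p. p < N \<and> ?cov p N)"
    have l: "l < N" "?cov l N" using LeastI_ex[OF True] unfolding l_def by blast+
    have least: "l \<le> p" if "p < N" "?cov p N" for p unfolding l_def using that by (intro Least_le) blast
    have up: "?cov p N" if "l \<le> p" for p using l(2) that order_trans by blast
    \<comment> \<open>A tight pair ending in \<open>N\<close> is itself in the antichain
      \<open>K\<close>, so the interval that covers \<open>(l, N)\<close> cannot be strictly longer
      than it.\<close>
    have Sl: "p = l" if "(p, N) \<in> S" "p < N" for p
    proof -
      have "l \<le> p" using least[OF that(2) Scov[OF that(1)]] .
      moreover obtain p' q' where "(p', q') \<in> K" "p' \<le> l" "N \<le> q'" using l(2) by blast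
      ultimately show ?thesis using anti[of p N p' q'] that S by auto
    qed
    \<comment> \<open>An interval of \<open>K\<close> that covers \<open>(l, N)\<close> also covers
      \<open>(l, p)\<close> and ends strictly later, so \<open>(l, p)\<close> is covered but, by the
      antichain property, not tight.\<close>
    have lt: "h p < h l + 1" if p: "p < N" for p
    proof (cases "l < p")
      case True
      obtain p' q' where pq: "(p', q') \<in> K" "p' \<le> l" "N \<le> q'" using l(2) by blast
      have "(l, p) \<notin> S"
      proof
        assume "(l, p) \<in> S"
        then have "p = q'" using anti[of l p p' q'] pq p S by auto
        then show False using p pq by simp
      qed
      moreover have "?cov l p" using pq p by (intro exI[of _ p'] exI[of _ q']) auto
      ultimately show ?thesis using h[OF True p] by simp
    next
      case False
      then have "h p \<le> h l" using mono[of p l] l(1) by (cases "p = l") auto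
      then show ?thesis by simp
    qed
    have hl: "h l < h p" if "l < p" "p < N" for p using mono[OF that] .
    show ?thesis
    proof (cases "(l, N) \<in> S")
      case True
      have "h p < h l + 1 \<and> (if (p, N) \<in> S then h l + 1 = h p + 1
          else if ?cov p N then h l + 1 < h p + 1 else h p + 1 < h l + 1)" if p: "p < N" for p
      proof (cases p l rule: linorder_cases)
        case less
        then have "\<not> ?cov p N" "(p, N) \<notin> S" "h p < h l" using least[OF p] Sl[OF _ p] mono[OF _ l(1)] by auto
        then show ?thesis using lt[OF p] by auto
      next
        case equal
        then show ?thesis using True by simp
      next
        case greater
        then have "?cov p N" "(p, N) \<notin> S" "h l < h p" using up[of p] Sl[OF _ p] mono[OF _ p] by auto
        then show ?thesis using lt[OF p] by auto
      qed
      then show ?thesis by blast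
    next
      case False
      \<comment> \<open>Lower bounds for the new point: all earlier points, and those left of
        \<open>l\<close> shifted by \<open>1\<close>. The facts \<open>lt\<close> and
        \<open>mono\<close> place all of them below \<open>h l + 1\<close>, so there is room in
        between.\<close>
      let ?F = "h ` {..<N} \<union> (\<lambda>p. h p + 1) ` {..<l}"
      have F: "finite ?F" "?F \<noteq> {}" using l(1) by auto
      have "Max ?F < h l + 1"
        unfolding Max_less_iff[OF F] using lt mono[OF _ l(1)] by auto
      then obtain y where y: "Max ?F < y" "y < h l + 1" using dense by blast
      have yF: "a < y" if "a \<in> ?F" for a using Max_ge[OF F(1) that] y(1) by simp
      have "h p < y \<and> (if (p, N) \<in> S then y = h p + 1
          else if ?cov p N then y < h p + 1 else h p + 1 < y)" if p: "p < N" for p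
      proof -
        have 1: "h p < y" using yF p by blast
        have 2: "(p, N) \<notin> S" using Sl[OF _ p] False by blast
        show ?thesis
        proof (cases "p < l")
          case True
          then have "\<not> ?cov p N" using least[OF p] by auto
          moreover have "h p + 1 < y" using yF True by blast
          ultimately show ?thesis using 1 2 by auto
        next
          case False
          then have "?cov p N" using up[of p] by simp
          moreover have "h l \<le> h p" using False mono[of l p] p by (cases "p = l") auto
          then have "y < h p + 1" using y(2) by simp
          ultimately show ?thesis using 1 2 by auto
        qed
      qed
      then show ?thesis by blast
    qed
  qed
  then obtain y where y: "\<And>p. p < N \<Longrightarrow> h p < y \<and> (if (p, N) \<in> S then y = h p + 1
     else if ?cov p N then y < h p + 1 else h p + 1 < y)" by blast
  have "?ok (h(N := y)) p q" if "p < q" "q < Suc N" for p q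
  proof (cases "q = N")
    case True
    then show ?thesis using y[of p] that by simp
  next
    case False
    then show ?thesis using h[of p q] that by simp
  qed
  then show ?case by blast
qed simp

definition shi_triple :: "nat \<times> nat \<Rightarrow> nat \<times> nat \<times> real" where
  "shi_triple = (\<lambda>(i, j). (i, j, 1))"

text \<open>All levels are \<open>1\<close>, so domination is containment of intervals along
  \<open>xs\<close>; two arcs of a partition with the same left end coincide, which leaves only
  strict nesting to be excluded.\<close>

lemma shi_configuration_iff:
  assumes xs: "distinct xs" "set xs = {1..n}" and P: "partition_on {1..n} P"
  shows "configuration xs (shi_triple ` arcs P) \<longleftrightarrow> nonnesting {1..n} (arcs P) xs"
proof
  assume c: "configuration xs (shi_triple ` arcs P)"
  have fwd: "prec xs a b" if "(a, b) \<in> arcs P" for a b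
    using c that by (force simp: configuration_def shi_triple_def)
  have anti: "(a, b) = (a', b')"
    if "(a, b) \<in> arcs P" "(a', b') \<in> arcs P" "weakly_prec xs a' a" "weakly_prec xs b b'" for a b a' b'
  proof -
    have "dominated xs (shi_triple (a, b)) (shi_triple (a', b'))"
      using that by (simp add: dominated_def shi_triple_def)
    then have "shi_triple (a, b) = shi_triple (a', b')" using c that unfolding configuration_def by blast
    then show ?thesis by (simp add: shi_triple_def)
  qed
  have "prec xs b b'" if E: "(a, b) \<in> arcs P" "(a', b') \<in> arcs P" "prec xs a a'" for a b a' b'
  proof (rule ccontr)
    assume "\<not> prec xs b b'"
    moreover have "b \<in> set xs" "b' \<in> set xs" using fwd[OF E(1)] fwd[OF E(2)] prec_in_set by metis+
    ultimately have "weakly_prec xs b' b" using prec_total[of b xs b'] by (auto simp: weakly_prec_def)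
    then have "(a', b') = (a, b)" using anti[OF E(2,1)] E(3) by (simp add: weakly_prec_def)
    then show False using E(3) prec_irrefl[OF xs(1)] by simp
  qed
  with fwd xs show "nonnesting {1..n} (arcs P) xs" unfolding nonnesting_def by blast
next
  assume nn: "nonnesting {1..n} (arcs P) xs"
  have "t = t'" if t: "t \<in> shi_triple ` arcs P" "t' \<in> shi_triple ` arcs P" "dominated xs t t'" for t t'
  proof -
    obtain a b a' b' where ab: "(a, b) \<in> arcs P" "t = (a, b, 1)" "(a', b') \<in> arcs P" "t' = (a', b', 1)"
      using t by (auto simp: shi_triple_def)
    then have w: "weakly_prec xs a' a" "weakly_prec xs b b'" using t(3) by (auto simp: dominated_def)
    have "\<not> prec xs a' a"
    proof
      assume "prec xs a' a"
      then have "prec xs b' b" using nn ab unfolding nonnesting_def by blast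
      then show False using w(2) prec_irrefl[OF xs(1)] prec_asym[OF xs(1)] by (auto simp: weakly_prec_def)
    qed
    then have "a = a'" using w(1) by (simp add: weakly_prec_def)
    then show ?thesis using arcs_right[OF P ab(1)] ab by simp
  qed
  moreover have "prec xs (fst t) (fst (snd t))" if "t \<in> shi_triple ` arcs P" for t
    using that nn by (auto simp: shi_triple_def nonnesting_def)
  ultimately show "configuration xs (shi_triple ` arcs P)" unfolding configuration_def by blast
qed

lemma path_system_arcs:
  assumes "partition_on {1..n} P"
  shows "path_system {1..n} (arcs P)"
proof
  show "arcs P \<subseteq> {1..n} \<times> {1..n}" using arcs_subset_pairs[OF assms] by (auto simp: pairs_upto_def)
  have "arcs P \<subseteq> less_than" using arcs_less by auto
  then show "acyclic (arcs P)" using wf_acyclic[OF wf_less_than] acyclic_subset by blast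
qed (use arcs_right[OF assms] arcs_left[OF assms] in auto)

lemma shi_ceiling_arrangement:
  fixes e :: "nat \<Rightarrow> 'n::finite"
  assumes n: "n = CARD('n)" and e: "bij_betw e {1..n} UNIV" and G: "G \<subseteq> pairs_upto n"
  shows "ceiling_arrangement e n G shi_triple"
proof -
  have f: "shi_triple p \<in> difference_triples n" "0 < snd (snd (shi_triple p))" if "p \<in> pairs_upto n" for p
    using that by (cases p; simp add: shi_triple_def difference_triples_def)+
  interpret difference_arrangement e n "deformation n G shi_triple"
    using n e G f(1) by (rule difference_arrangement_deformation)
  have Tp: "\<exists>i j. t = (i, j, 1)" if "t \<in> T_pos" for t
  proof -
    have "t \<in> deformation n G shi_triple" "0 < snd (snd t)" using that by (simp_all add: T_pos_def level_def)
    then show ?thesis by (auto simp: deformation_def shi_triple_def)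
  qed
  show ?thesis
  proof unfold_locales
    fix xs K S assume xs: "distinct xs" "set xs = {1..n}" and K: "K \<subseteq> T_pos" "configuration xs K" and S: "S \<subseteq> K"
    have len: "length xs = n" using xs distinct_card[of xs] by simp
    \<comment> \<open>In terms of positions, domination is containment of intervals of
      integers.\<close>
    define pos where "pos K = {(p, q). p < n \<and> q < n \<and> (xs ! p, xs ! q, 1) \<in> K}" for K :: "(nat \<times> nat \<times> real) set"
    have dom: "dominated xs (xs ! p, xs ! q, 1) (xs ! p', xs ! q', 1) \<longleftrightarrow> p' \<le> p \<and> q \<le> q'"
      if "p < n" "q < n" "p' < n" "q' < n" for p q p' q'
      using that weakly_prec_nth_iff[OF xs(1)] len by (simp add: dominated_def)
    have anti: "p = p' \<and> q = q'" if "(p, q) \<in> pos K" "(p', q') \<in> pos K" "p' \<le> p" "q \<le> q'" for p q p' q'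
    proof -
      have m: "p < n" "q < n" "p' < n" "q' < n" using that by (auto simp: pos_def)
      have "(xs ! p, xs ! q, 1 :: real) = (xs ! p', xs ! q', 1)"
        using that dom[OF m] K(2) unfolding pos_def configuration_def by blast
      then show ?thesis using nth_eq_iff_index_eq[OF xs(1)] m len by simp
    qed
    have sub: "pos S \<subseteq> pos K" using S by (auto simp: pos_def)
    have "\<exists>h :: nat \<Rightarrow> real. \<forall>p q. p < q \<and> q < n \<longrightarrow> h p < h q \<and>
      (if (p, q) \<in> pos S then h q = h p + 1
       else if \<exists>p' q'. (p', q') \<in> pos K \<and> p' \<le> p \<and> q \<le> q' then h q < h p + 1 else h p + 1 < h q)"
      by (rule unit_interval_realization[OF anti sub])
    then obtain h :: "nat \<Rightarrow> real" where h: "\<And>p q. p < q \<Longrightarrow> q < n \<Longrightarrow> h p < h q \<and>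
      (if (p, q) \<in> pos S then h q = h p + 1
       else if \<exists>p' q'. (p', q') \<in> pos K \<and> p' \<le> p \<and> q \<le> q' then h q < h p + 1 else h p + 1 < h q)"
      by blast
    have "\<exists>x. descending xs x \<and> (\<forall>p<n. x $ e (xs ! p) = - h p)"
      using h by (intro ex_descending_point[OF xs]) blast
    then obtain x where x: "descending xs x" "\<And>p. p < n \<Longrightarrow> x $ e (xs ! p) = - h p" by blast
    have "if t \<in> S then gap t x = 0 else if \<exists>t'\<in>K. dominated xs t t' then gap t x < 0 else 0 < gap t x"
      if t: "t \<in> T_pos" "prec xs (fst t) (fst (snd t))" for t
    proof -
      obtain i j where ij: "t = (i, j, 1)" using Tp[OF t(1)] by blast
      obtain p q where pq: "p < q" "q < n" "xs ! p = i" "xs ! q = j"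
        using t(2) len by (auto simp: prec_def ij)
      have m: "p < n" using pq by simp
      have g: "gap t x = h q - h p - 1" using x(2)[OF m] x(2)[OF pq(2)] pq(3,4) by (simp add: ij)
      have S_iff: "t \<in> S \<longleftrightarrow> (p, q) \<in> pos S" using m pq by (simp add: pos_def ij)
      have K_iff: "(\<exists>t'\<in>K. dominated xs t t') \<longleftrightarrow> (\<exists>p' q'. (p', q') \<in> pos K \<and> p' \<le> p \<and> q \<le> q')"
      proof
        assume "\<exists>t'\<in>K. dominated xs t t'"
        then obtain t' where t': "t' \<in> K" "dominated xs t t'" by blast
        obtain i' j' where ij': "t' = (i', j', 1)" using Tp t'(1) K(1) by blast
        have "prec xs (fst t') (fst (snd t'))" using t'(1) K(2) unfolding configuration_def by blast
        then have "prec xs i' j'" by (simp add: ij')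
        then obtain p' q' where pq': "p' < q'" "q' < n" "xs ! p' = i'" "xs ! q' = j'"
          using len by (auto simp: prec_def)
        then have "p' < n" by simp
        then have "(p', q') \<in> pos K" "p' \<le> p \<and> q \<le> q'"
          using dom[OF m pq(2) _ pq'(2), of p'] t' pq pq' by (auto simp: pos_def ij ij')
        then show "\<exists>p' q'. (p', q') \<in> pos K \<and> p' \<le> p \<and> q \<le> q'" by blast
      next
        assume "\<exists>p' q'. (p', q') \<in> pos K \<and> p' \<le> p \<and> q \<le> q'"
        then obtain p' q' where pq': "(p', q') \<in> pos K" "p' \<le> p" "q \<le> q'" by blast
        then have m': "p' < n" "q' < n" "(xs ! p', xs ! q', 1) \<in> K" by (auto simp: pos_def)
        have "dominated xs t (xs ! p', xs ! q', 1)"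
          using dom[OF m pq(2) m'(1,2)] pq' pq(3,4) by (simp add: ij)
        then show "\<exists>t'\<in>K. dominated xs t t'" using m'(3) by blast
      qed
      show ?thesis unfolding S_iff K_iff g using h[OF pq(1,2)] by (auto split: if_splits)
    qed
    with x(1) show "\<exists>x. descending xs x \<and> (\<forall>t\<in>T_pos. prec xs (fst t) (fst (snd t)) \<longrightarrow>
      (if t \<in> S then gap t x = 0 else if \<exists>t'\<in>K. dominated xs t t' then gap t x < 0 else 0 < gap t x))" by blast
  next
    show "G \<subseteq> pairs_upto n" by fact
    show "inj_on shi_triple (pairs_upto n)" by (auto simp: inj_on_def shi_triple_def)
    show "shi_triple p \<in> difference_triples n" "0 < snd (snd (shi_triple p))" if "p \<in> pairs_upto n" for p
      using f[OF that] by simp_all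
  next
    fix xs K i j i' j'
    assume xs: "distinct xs" "set xs = {1..n}" and K: "K \<subseteq> G" "configuration xs (shi_triple ` K)"
      and ij: "(i, j) \<in> K" "(i', j') \<in> K"
    have mem: "i \<in> set xs" "j \<in> set xs" "i' \<in> set xs" "j' \<in> set xs"
      using ij K(1) G xs by (auto simp: pairs_upto_def)
    have anti: "(a, b) = (a', b')"
      if "(a, b) \<in> K" "(a', b') \<in> K" "weakly_prec xs a' a" "weakly_prec xs b b'" for a b a' b'
    proof -
      have "dominated xs (shi_triple (a, b)) (shi_triple (a', b'))"
        using that by (simp add: dominated_def shi_triple_def)
      then have "shi_triple (a, b) = shi_triple (a', b')" using K(2) that unfolding configuration_def by blast
      then show ?thesis by (simp add: shi_triple_def)
    qed
    \<comment> \<open>The other ends of two intervals with a common end are ordered by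
      \<open>xs\<close>, so one interval contains the other and the antichain property identifies
      them.\<close>
    show "i = i' \<longleftrightarrow> j = j'"
    proof
      assume "i = i'"
      then show "j = j'" using anti[OF ij] anti[OF ij(2,1)] weakly_prec_total[OF mem(2,4)]
        by (auto simp: weakly_prec_def)
    next
      assume "j = j'"
      then show "i = i'" using anti[OF ij] anti[OF ij(2,1)] weakly_prec_total[OF mem(1,3)]
        by (auto simp: weakly_prec_def)
    qed
  next
    fix P assume P: "partition_on {1..n} P"
    have "ends ` shi_triple ` arcs P = arcs P" by (force simp: shi_triple_def)
    then show "\<exists>E. path_system {1..n} E \<and> card E = card (arcs P) \<and>
        (\<forall>xs. distinct xs \<longrightarrow> set xs = {1..n} \<longrightarrow>
           (configuration xs (shi_triple ` arcs P) \<longleftrightarrow> nonnesting {1..n} E xs) \<and>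
           (nonnesting {1..n} E xs \<longrightarrow> uncrossed (ends ` shi_triple ` arcs P) xs = uncrossed E xs))"
      using path_system_arcs[OF P] shi_configuration_iff[OF _ _ P] by (intro exI[of _ "arcs P"]) auto
  qed
qed

subsection \<open>The Ish arrangement\<close>

definition ish_triple :: "nat \<times> nat \<Rightarrow> nat \<times> nat \<times> real" where
  "ish_triple = (\<lambda>(i, j). (1, j, real i))"

lemma ish_dominated_iff:
  "dominated xs (ish_triple (a, b)) (ish_triple (a', b')) \<longleftrightarrow> weakly_prec xs b b' \<and> a' \<le> a"
  by (simp add: dominated_def ish_triple_def weakly_prec_def)

text \<open>For \<open>Ish\<close> the ceilings \<open>x\<^sub>1 - x\<^sub>b = a\<close> say that \<open>1\<close> and the right endpoints \<open>b\<close> occur in the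
  order of the left endpoints \<open>a\<close>. Listing \<open>1\<close> as the right endpoint of a virtual arc with left
  endpoint \<open>0\<close>, this is a single path, and a single path never nests.\<close>

definition right_endpoint :: "nat set set \<Rightarrow> nat \<Rightarrow> nat" where
  "right_endpoint P a = (if a = 0 then 1 else (THE b. (a, b) \<in> arcs P))"

definition left_endpoints :: "nat set set \<Rightarrow> nat set" where
  "left_endpoints P = insert 0 (fst ` arcs P)"

text \<open>The arcs of the one-block partition of a set join its consecutive elements. The path
  thus visits \<open>1\<close> and then the right ends in the order of their left ends.\<close>

definition endpoint_path :: "nat set set \<Rightarrow> (nat \<times> nat) set" where
  "endpoint_path P = map_prod (right_endpoint P) (right_endpoint P) ` arcs {left_endpoints P}"

context
  fixes n :: nat and P :: "nat set set"
  assumes P: "partition_on {1..n} P" and n_pos: "1 \<le> n"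
begin

lemma arcs_bounds: "(a, b) \<in> arcs P \<Longrightarrow> 1 \<le> a \<and> a < b \<and> b \<le> n"
  using arcs_subset_pairs[OF P] by (auto simp: pairs_upto_def)

lemma right_endpoint_arc: "(a, b) \<in> arcs P \<Longrightarrow> right_endpoint P a = b"
proof -
  assume ab: "(a, b) \<in> arcs P"
  then have "a \<noteq> 0" using arcs_bounds by force
  moreover have "(THE b. (a, b) \<in> arcs P) = b" using ab arcs_right[OF P] by (intro the_equality) auto
  ultimately show ?thesis by (simp add: right_endpoint_def)
qed

lemma right_endpoint_0: "right_endpoint P 0 = 1"
  by (simp add: right_endpoint_def)

lemma left_endpoints_arc: "a \<in> left_endpoints P \<Longrightarrow> a \<noteq> 0 \<Longrightarrow> (a, right_endpoint P a) \<in> arcs P"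
  using right_endpoint_arc by (auto simp: left_endpoints_def)

lemma finite_left_endpoints: "finite (left_endpoints P)"
  using finite_subset[OF arcs_subset_pairs[OF P] finite_pairs_upto] by (simp add: left_endpoints_def)

lemma partition_left_endpoints: "partition_on (left_endpoints P) {left_endpoints P}"
  by (rule partition_on_space) (simp add: left_endpoints_def)

lemma right_endpoint_inj: "inj_on (right_endpoint P) (left_endpoints P)"
proof (rule inj_onI)
  \<comment> \<open>A genuine arc ends at \<open>2\<close> or later, so the virtual arc ending at
    \<open>1\<close> meets no other.\<close>
  have not1: "right_endpoint P a \<noteq> 1" if "a \<in> left_endpoints P" "a \<noteq> 0" for a
    using arcs_bounds[OF left_endpoints_arc[OF that]] by auto
  fix a a' assume a: "a \<in> left_endpoints P" "a' \<in> left_endpoints P" "right_endpoint P a = right_endpoint P a'"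
  show "a = a'"
  proof (cases "a = 0 \<or> a' = 0")
    case True
    then show ?thesis using not1 a right_endpoint_0 by metis
  next
    case False
    then have "(a, right_endpoint P a) \<in> arcs P" "(a', right_endpoint P a) \<in> arcs P"
      using left_endpoints_arc[OF a(1)] left_endpoints_arc[OF a(2)] a(3) by auto
    then show ?thesis by (rule arcs_left[OF P])
  qed
qed

lemma right_endpoint_mem: "a \<in> left_endpoints P \<Longrightarrow> right_endpoint P a \<in> {1..n}"
  using arcs_bounds[OF left_endpoints_arc, of a] right_endpoint_0 n_pos by (cases "a = 0") auto

lemma arcs_left_endpoints:
  "(a, a') \<in> arcs {left_endpoints P} \<Longrightarrow> a \<in> left_endpoints P \<and> a' \<in> left_endpoints P \<and> a < a'"
  by (auto simp: arcs_def)

lemma endpoint_pathE: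
  assumes "(u, v) \<in> endpoint_path P"
  obtains a a' where "(a, a') \<in> arcs {left_endpoints P}" "u = right_endpoint P a" "v = right_endpoint P a'"
    "a \<in> left_endpoints P" "a' \<in> left_endpoints P" "a < a'"
  using assms arcs_left_endpoints unfolding endpoint_path_def by fastforce

lemma path_system_endpoint_path: "path_system {1..n} (endpoint_path P)"
proof
  show "endpoint_path P \<subseteq> {1..n} \<times> {1..n}"
  proof (intro subsetI, clarify)
    fix u v assume "(u, v) \<in> endpoint_path P"
    then show "u \<in> {1..n} \<and> v \<in> {1..n}" by (elim endpoint_pathE) (simp only: right_endpoint_mem)
  qed
  show "b = b'" if "(a, b) \<in> endpoint_path P" "(a, b') \<in> endpoint_path P" for a b b'
  proof -
    from that(1) obtain p q where pq: "(p, q) \<in> arcs {left_endpoints P}" "a = right_endpoint P p"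
      "b = right_endpoint P q" "p \<in> left_endpoints P" by (rule endpoint_pathE)
    from that(2) obtain p' q' where pq': "(p', q') \<in> arcs {left_endpoints P}" "a = right_endpoint P p'"
      "b' = right_endpoint P q'" "p' \<in> left_endpoints P" by (rule endpoint_pathE)
    have "p = p'" using right_endpoint_inj pq pq' by (auto dest: inj_onD)
    then have "q = q'" using arcs_right[OF partition_left_endpoints pq(1)] pq'(1) by simp
    then show ?thesis using pq pq' by simp
  qed
  show "a = a'" if "(a, b) \<in> endpoint_path P" "(a', b) \<in> endpoint_path P" for a a' b
  proof -
    from that(1) obtain p q where pq: "(p, q) \<in> arcs {left_endpoints P}" "a = right_endpoint P p"
      "b = right_endpoint P q" "p \<in> left_endpoints P" "q \<in> left_endpoints P" by (rule endpoint_pathE)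
    from that(2) obtain p' q' where pq': "(p', q') \<in> arcs {left_endpoints P}" "a' = right_endpoint P p'"
      "b = right_endpoint P q'" "p' \<in> left_endpoints P" "q' \<in> left_endpoints P" by (rule endpoint_pathE)
    have "q = q'" using right_endpoint_inj pq pq' by (auto dest: inj_onD)
    then have "p = p'" using arcs_left[OF partition_left_endpoints pq(1)] pq'(1) by simp
    then show ?thesis using pq pq' by simp
  qed
  \<comment> \<open>The path may go up and down in the labels of the right ends; it is increasing
    only when labelled by the left ends.\<close>
  let ?r = "inv_into (left_endpoints P) (right_endpoint P)"
  have "endpoint_path P \<subseteq> inv_image less_than ?r"
  proof (intro subsetI, clarify)
    fix u v assume "(u, v) \<in> endpoint_path P"
    then show "(u, v) \<in> inv_image less_than ?r"
      by (elim endpoint_pathE) (simp add: inv_into_f_f[OF right_endpoint_inj])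
  qed
  then show "acyclic (endpoint_path P)" using wf_acyclic[OF wf_inv_image[OF wf_less_than]] acyclic_subset by blast
qed simp

text \<open>The virtual left endpoint \<open>0\<close> adds one element, and the path through a
  finite nonempty set has one arc less than the set has elements.\<close>

lemma card_endpoint_path: "card (endpoint_path P) = card (arcs P)"
proof -
  have "inj_on (map_prod (right_endpoint P) (right_endpoint P)) (left_endpoints P \<times> left_endpoints P)"
    using right_endpoint_inj right_endpoint_inj by (rule map_prod_inj_on)
  moreover have "arcs {left_endpoints P} \<subseteq> left_endpoints P \<times> left_endpoints P"
    by (auto simp: arcs_def)
  ultimately have "card (endpoint_path P) = card (arcs {left_endpoints P})"
    unfolding endpoint_path_def using inj_on_subset card_image by blast
  moreover have "card (arcs {left_endpoints P}) + 1 = card (left_endpoints P)"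
    using card_arcs[OF partition_left_endpoints finite_left_endpoints] by simp
  moreover have "card (left_endpoints P) = card (arcs P) + 1"
  proof -
    have "inj_on fst (arcs P)" using arcs_right[OF P] by (auto simp: inj_on_def)
    then have "card (fst ` arcs P) = card (arcs P)" by (rule card_image)
    moreover have "0 \<notin> fst ` arcs P" using arcs_bounds by force
    moreover have "finite (fst ` arcs P)" using finite_left_endpoints by (simp add: left_endpoints_def)
    ultimately show ?thesis by (simp add: left_endpoints_def)
  qed
  ultimately show ?thesis by simp
qed

lemma left_endpoints_trancl:
  assumes "a \<in> left_endpoints P" "a' \<in> left_endpoints P" "a < a'"
  shows "(a, a') \<in> (arcs {left_endpoints P})\<^sup>+"
  using same_block_arcs_rtrancl[of "left_endpoints P" "{left_endpoints P}" a a'] assms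
  by (auto simp: rtrancl_eq_or_trancl)

context
  fixes xs :: "nat list"
  assumes xs: "distinct xs" "set xs = {1..n}"
begin

definition endpoints_ordered :: bool where
  "endpoints_ordered \<longleftrightarrow> (\<forall>a\<in>left_endpoints P. \<forall>a'\<in>left_endpoints P. a < a' \<longrightarrow>
     prec xs (right_endpoint P a) (right_endpoint P a'))"

text \<open>All Ish intervals start at \<open>1\<close>, so domination compares only right ends
  along \<open>xs\<close> and levels. An antichain must therefore list the right ends by increasing
  left ends; the element \<open>0\<close> adds that \<open>1\<close> precedes them all, that is,
  that the triples go forward.\<close>

lemma configuration_iff_ordered: "configuration xs (ish_triple ` arcs P) \<longleftrightarrow> endpoints_ordered"
proof
  assume c: "configuration xs (ish_triple ` arcs P)"
  have fwd: "prec xs 1 b" if "(a, b) \<in> arcs P" for a b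
    using c that by (force simp: configuration_def ish_triple_def)
  have anti: "(a, b) = (a', b')"
    if "(a, b) \<in> arcs P" "(a', b') \<in> arcs P" "weakly_prec xs b b'" "a' \<le> a" for a b a' b'
  proof -
    have "ish_triple (a, b) = ish_triple (a', b')"
      using c that ish_dominated_iff unfolding configuration_def by blast
    then show ?thesis by (simp add: ish_triple_def)
  qed
  show endpoints_ordered unfolding endpoints_ordered_def
  proof (intro ballI impI)
    fix a a' assume a: "a \<in> left_endpoints P" "a' \<in> left_endpoints P" "a < a'"
    have a': "(a', right_endpoint P a') \<in> arcs P" using left_endpoints_arc a by simp
    show "prec xs (right_endpoint P a) (right_endpoint P a')"
    proof (cases "a = 0")
      case True
      then show ?thesis using fwd[OF a'] by (simp add: right_endpoint_0)
    next
      case False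
      then have ab: "(a, right_endpoint P a) \<in> arcs P" using left_endpoints_arc a by simp
      have "\<not> weakly_prec xs (right_endpoint P a') (right_endpoint P a)" using anti[OF a' ab] a(3) by auto
      moreover have "right_endpoint P a \<in> set xs" "right_endpoint P a' \<in> set xs"
        using right_endpoint_mem a xs by auto
      ultimately show ?thesis using prec_total[of _ xs] by (auto simp: weakly_prec_def)
    qed
  qed
next
  assume ord: endpoints_ordered
  have mem: "a \<in> left_endpoints P" if "(a, b) \<in> arcs P" for a b
    using that by (force simp: left_endpoints_def)
  have "t = t'" if t: "t \<in> ish_triple ` arcs P" "t' \<in> ish_triple ` arcs P" "dominated xs t t'" for t t'
  proof -
    obtain a b a' b' where ab: "(a, b) \<in> arcs P" "t = ish_triple (a, b)" "(a', b') \<in> arcs P" "t' = ish_triple (a', b')"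
      using t by auto
    then have w: "weakly_prec xs b b'" "a' \<le> a" using t(3) by (simp_all add: ish_dominated_iff)
    have "\<not> a' < a"
    proof
      assume "a' < a"
      then have "prec xs b' b" using ord mem[OF ab(1)] mem[OF ab(3)] right_endpoint_arc[OF ab(1)]
          right_endpoint_arc[OF ab(3)] unfolding endpoints_ordered_def by metis
      then show False using w(1) prec_irrefl[OF xs(1)] prec_asym[OF xs(1)] by (auto simp: weakly_prec_def)
    qed
    then have "a = a'" using w(2) by simp
    then show ?thesis using arcs_right[OF P ab(1)] ab by simp
  qed
  moreover have "prec xs (fst t) (fst (snd t))" if t: "t \<in> ish_triple ` arcs P" for t
  proof -
    obtain a b where ab: "(a, b) \<in> arcs P" "t = (1, b, real a)" using t by (auto simp: ish_triple_def)
    have "0 \<in> left_endpoints P" "0 < a" using arcs_bounds[OF ab(1)] by (auto simp: left_endpoints_def)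
    then have "prec xs 1 b" using ord mem[OF ab(1)] right_endpoint_arc[OF ab(1)] right_endpoint_0
      unfolding endpoints_ordered_def by metis
    then show ?thesis by (simp add: ab)
  qed
  ultimately show "configuration xs (ish_triple ` arcs P)" unfolding configuration_def by blast
qed

text \<open>Transitivity extends the order from consecutive points to the whole path. Conversely, if
  one point of the path precedes another along \<open>xs\<close>, its successor on the path is at
  most that other point and hence precedes the other's successor.\<close>

lemma nonnesting_iff_ordered: "nonnesting {1..n} (endpoint_path P) xs \<longleftrightarrow> endpoints_ordered"
proof
  assume nn: "nonnesting {1..n} (endpoint_path P) xs"
  have step: "prec xs (right_endpoint P a) (right_endpoint P a')" if "(a, a') \<in> arcs {left_endpoints P}" for a a'
  proof -
    have "(right_endpoint P a, right_endpoint P a') \<in> endpoint_path P"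
      using that unfolding endpoint_path_def by force
    then show ?thesis using nn unfolding nonnesting_def by blast
  qed
  have "prec xs (right_endpoint P a) (right_endpoint P a')" if "(a, a') \<in> (arcs {left_endpoints P})\<^sup>+" for a a'
    using that by (induction rule: trancl_induct) (use step prec_trans[OF xs(1)] in blast)+
  then show endpoints_ordered unfolding endpoints_ordered_def using left_endpoints_trancl by blast
next
  assume ord: endpoints_ordered
  have mono: "prec xs (right_endpoint P a) (right_endpoint P a')"
    if "a \<in> left_endpoints P" "a' \<in> left_endpoints P" "a < a'" for a a'
    using ord that unfolding endpoints_ordered_def by blast
  have "prec xs u v" if "(u, v) \<in> endpoint_path P" for u v
    using that by (elim endpoint_pathE) (simp add: mono)
  moreover have "prec xs v v'" if uv: "(u, v) \<in> endpoint_path P" "(u', v') \<in> endpoint_path P" "prec xs u u'" for u v u' v'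
  proof -
    from uv(1) obtain a b where a: "(a, b) \<in> arcs {left_endpoints P}" "u = right_endpoint P a"
      "v = right_endpoint P b" "a \<in> left_endpoints P" "b \<in> left_endpoints P" "a < b" by (rule endpoint_pathE)
    from uv(2) obtain c d where c: "(c, d) \<in> arcs {left_endpoints P}" "u' = right_endpoint P c"
      "v' = right_endpoint P d" "c \<in> left_endpoints P" "d \<in> left_endpoints P" "c < d" by (rule endpoint_pathE)
    have "\<not> c \<le> a"
    proof
      assume "c \<le> a"
      then have "weakly_prec xs u' u" using mono[OF c(4) a(4)] a(2) c(2) by (cases "c = a") (auto simp: weakly_prec_def)
      then show False using uv(3) prec_irrefl[OF xs(1)] prec_asym[OF xs(1)] by (auto simp: weakly_prec_def)
    qed
    then have "b \<le> c" using a(1) c(4) by (force simp: arcs_def)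
    then have "b < d" using c(6) by simp
    then show ?thesis using mono[OF a(5) c(5)] a(3) c(3) by simp
  qed
  ultimately show "nonnesting {1..n} (endpoint_path P) xs" unfolding nonnesting_def using xs by blast
qed

text \<open>The intervals from \<open>1\<close> to the right ends have a common left end, and their
  union is the stretch that the steps of the path cover one after the other. So both systems leave
  the same places uncrossed.\<close>

lemma uncrossed_endpoint_path:
  assumes ord: endpoints_ordered
  shows "uncrossed (ends ` ish_triple ` arcs P) xs = uncrossed (endpoint_path P) xs"
proof -
  have "ends ` ish_triple ` arcs P = {(1, b) | a b. (a, b) \<in> arcs P}" by (force simp: ish_triple_def)
  then have L: "p \<in> uncrossed (ends ` ish_triple ` arcs P) xs \<longleftrightarrow>
      p < length xs \<and> (\<forall>a b. (a, b) \<in> arcs P \<longrightarrow> 1 \<in> set (take p xs) \<longrightarrow> b \<in> set (take p xs))" for p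
    by (auto simp: uncrossed_def)
  have "p \<in> uncrossed (ends ` ish_triple ` arcs P) xs \<longleftrightarrow> p \<in> uncrossed (endpoint_path P) xs" for p
  proof
    assume p: "p \<in> uncrossed (ends ` ish_triple ` arcs P) xs"
    have "v \<in> set (take p xs)" if uv: "(u, v) \<in> endpoint_path P" "u \<in> set (take p xs)" for u v
    proof -
      from uv(1) obtain a b where a: "u = right_endpoint P a" "v = right_endpoint P b"
        "a \<in> left_endpoints P" "b \<in> left_endpoints P" "a < b" by (rule endpoint_pathE)
      have "1 \<in> set (take p xs)"
      proof (cases "a = 0")
        case True
        then show ?thesis using uv(2) a(1) by (simp add: right_endpoint_0)
      next
        case False
        moreover have "0 \<in> left_endpoints P" by (simp add: left_endpoints_def)
        ultimately have "prec xs 1 u" using ord a(1,3) right_endpoint_0 unfolding endpoints_ordered_def by (metis neq0_conv)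
        then show ?thesis using prec_take[OF xs(1)] uv(2) by blast
      qed
      moreover have "(b, v) \<in> arcs P" using left_endpoints_arc[OF a(4)] a by simp
      ultimately show ?thesis using p unfolding L by blast
    qed
    moreover have "p < length xs" using p unfolding L by blast
    ultimately show "p \<in> uncrossed (endpoint_path P) xs" unfolding uncrossed_def by blast
  next
    assume p: "p \<in> uncrossed (endpoint_path P) xs"
    have "b \<in> set (take p xs)" if ab: "(a, b) \<in> arcs P" "1 \<in> set (take p xs)" for a b
    proof -
      have "(0, a) \<in> (arcs {left_endpoints P})\<^sup>+"
        using arcs_bounds[OF ab(1)] ab(1) by (intro left_endpoints_trancl) (force simp: left_endpoints_def)+
      then have "right_endpoint P a \<in> set (take p xs)"
      proof (induction rule: trancl_induct)
        case (base y)
        then have "(right_endpoint P 0, right_endpoint P y) \<in> endpoint_path P"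
          unfolding endpoint_path_def by force
        then show ?case using p ab(2) unfolding uncrossed_def right_endpoint_0 by blast
      next
        case (step y z)
        then have "(right_endpoint P y, right_endpoint P z) \<in> endpoint_path P"
          unfolding endpoint_path_def by force
        then show ?case using p step.IH unfolding uncrossed_def by blast
      qed
      then show ?thesis using right_endpoint_arc[OF ab(1)] by simp
    qed
    moreover have "p < length xs" using p by (simp add: uncrossed_def)
    ultimately show "p \<in> uncrossed (ends ` ish_triple ` arcs P) xs" unfolding L by blast
  qed
  then show ?thesis by blast
qed

end

end

text \<open>Position \<open>p\<close> is that of the coordinate \<open>1\<close>, put at height
  \<open>0\<close>. A later \<open>q\<close> is bounded by the least level that \<open>K\<close>
  imposes at \<open>q\<close> or beyond, called \<open>cap q\<close>. Since levels are integers, a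
  height strictly between \<open>cap q - 1\<close> and \<open>cap q\<close> satisfies exactly the
  inequalities implied by \<open>K\<close>.\<close>

lemma ish_realization:
  fixes K S :: "(nat \<times> nat) set"
  assumes K: "\<And>q a. (q, a) \<in> K \<Longrightarrow> p < q \<and> q < n \<and> 1 \<le> a \<and> a < n"
    and anti: "\<And>q a q' a'. (q, a) \<in> K \<Longrightarrow> (q', a') \<in> K \<Longrightarrow> q \<le> q' \<Longrightarrow> a' \<le> a \<Longrightarrow> q = q' \<and> a = a'"
    and S: "S \<subseteq> K"
  shows "\<exists>h :: nat \<Rightarrow> real. h p = 0 \<and> (\<forall>q q'. q < q' \<and> q' < n \<longrightarrow> h q < h q') \<and>
    (\<forall>q a. p < q \<and> q < n \<and> a < n \<longrightarrow> (if (q, a) \<in> S then h q = real a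
       else if \<exists>q' a'. (q', a') \<in> K \<and> q \<le> q' \<and> a' \<le> a then h q < real a else real a < h q))"
proof -
  \<comment> \<open>The value \<open>n\<close> exceeds every level; it serves as bound where
    \<open>K\<close> imposes none and keeps the minimum defined.\<close>
  define A where "A q = insert n {a. \<exists>q'\<ge>q. (q', a) \<in> K}" for q
  define cap where "cap q = Min (A q)" for q
  have fin: "finite (A q)" for q
  proof -
    have "A q \<subseteq> {..n}" using K by (force simp: A_def)
    then show ?thesis by (rule finite_subset) simp
  qed
  have cap_in: "cap q \<in> A q" for q unfolding cap_def by (rule Min_in[OF fin]) (simp add: A_def)
  have cap_le: "cap q \<le> a" if "a \<in> A q" for a q unfolding cap_def by (rule Min_le[OF fin that])
  have cap1: "1 \<le> cap q" if "q < n" for q using cap_in[of q] K that by (force simp: A_def)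
  have cap_mono: "cap q \<le> cap q'" if "q \<le> q'" for q q'
    using cap_in[of q'] that by (intro cap_le) (auto simp: A_def intro: order_trans)
  have cap_K: "cap q = a" if qa: "(q, a) \<in> K" for q a
  proof (rule antisym)
    show "cap q \<le> a" using qa by (intro cap_le) (auto simp: A_def)
    show "a \<le> cap q"
    proof (cases "cap q = n")
      case True
      then show ?thesis using K[OF qa] by simp
    next
      case False
      then obtain q' where "q \<le> q'" "(q', cap q) \<in> K" using cap_in[of q] by (auto simp: A_def)
      then show ?thesis using anti[OF qa, of q' "cap q"] by (cases "cap q \<le> a") auto
    qed
  qed
  have cap_K_less: "a < cap q'" if qa: "(q, a) \<in> K" "q < q'" for q a q'
  proof (cases "cap q' = n")
    case True
    then show ?thesis using K[OF qa(1)] by simp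
  next
    case False
    then obtain q'' where q'': "q' \<le> q''" "(q'', cap q') \<in> K" using cap_in[of q'] by (auto simp: A_def)
    show ?thesis
    proof (rule ccontr)
      assume "\<not> a < cap q'"
      then have "q = q''" using anti[OF qa(1) q''(2)] q''(1) qa(2) by simp
      then show False using q''(1) qa(2) by simp
    qed
  qed
  \<comment> \<open>Positions with the same \<open>cap\<close> still have to increase strictly, so
    they stay below it by an offset in \<open>(0, 1)\<close> that shrinks with
    \<open>q\<close>.\<close>
  define \<delta> where "\<delta> q = real (n - q) / real (n + 1)" for q
  have \<delta>: "0 < \<delta> q" "\<delta> q < 1" if "q < n" for q using that by (auto simp: \<delta>_def)
  have \<delta>_less: "\<delta> q' < \<delta> q" if "q < q'" "q' < n" for q q'
    unfolding \<delta>_def using that by (intro divide_strict_right_mono) auto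
  \<comment> \<open>Positions up to \<open>p\<close> take the integers \<open>q - p\<close>, which
    are at most \<open>0\<close>. A tight position sits exactly on its \<open>cap\<close>, which is
    its level by \<open>cap_K\<close>.\<close>
  define h where "h q = (if q \<le> p then real q - real p
      else if \<exists>a. (q, a) \<in> S then real (cap q) else real (cap q) - \<delta> q)" for q
  have h_le: "h q \<le> real (cap q)" and h_gt: "real (cap q) - 1 < h q" if "p < q" "q < n" for q
    using \<delta>[OF that(2)] that by (auto simp: h_def)
  show ?thesis
  proof (intro exI[of _ h] conjI allI impI; (elim conjE)?)
    show "h p = 0" by (simp add: h_def)
  next
    fix q q' assume q: "q < q'" "q' < n"
    show "h q < h q'"
    proof (cases "p < q")
      case False
      show ?thesis
      proof (cases "p < q'")
        case True
        have "h q \<le> 0" using False by (simp add: h_def)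
        moreover have "0 < h q'" using h_gt[OF True q(2)] cap1[OF q(2)] by linarith
        ultimately show ?thesis by simp
      next
        case False
        then show ?thesis using q by (simp add: h_def)
      qed
    next
      case pq: True
      show ?thesis
      proof (cases "\<exists>a. (q, a) \<in> S")
        case True
        then obtain a where a: "(q, a) \<in> K" using S by blast
        have "h q \<le> real a" using h_le[of q] pq q cap_K[OF a] by simp
        \<comment> \<open>Past a tight position the cap grows by at least \<open>1\<close>, so later
          heights, which exceed their cap minus \<open>1\<close>, stay strictly above.\<close>
        moreover have "real a + 1 \<le> real (cap q')" using cap_K_less[OF a q(1)] by simp
        ultimately show ?thesis using h_gt[of q'] pq q by simp
      next
        case False
        then have "h q = real (cap q) - \<delta> q" using pq by (simp add: h_def)
        also have "\<dots> < real (cap q') - \<delta> q'" using cap_mono[of q q'] \<delta>_less[OF q] q(1) by simp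
        also have "\<dots> \<le> h q'" using \<delta>[OF q(2)] pq q by (simp add: h_def)
        finally show ?thesis .
      qed
    qed
  next
    fix q a assume q: "p < q" "q < n" "a < n"
    show "if (q, a) \<in> S then h q = real a
       else if \<exists>q' a'. (q', a') \<in> K \<and> q \<le> q' \<and> a' \<le> a then h q < real a else real a < h q"
    proof (cases "(q, a) \<in> S")
      case True
      then have "cap q = a" using cap_K S by blast
      then show ?thesis using True q by (auto simp: h_def)
    next
      case notS: False
      show ?thesis
      proof (cases "\<exists>q' a'. (q', a') \<in> K \<and> q \<le> q' \<and> a' \<le> a")
        case True
        then obtain q' a' where qa': "(q', a') \<in> K" "q \<le> q'" "a' \<le> a" by blast
        have "cap q \<le> a'" using qa' by (intro cap_le) (auto simp: A_def)
        then have c: "cap q \<le> a" using qa' by simp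
        have "h q < real a"
        proof (cases "\<exists>b. (q, b) \<in> S")
          case True
          then obtain b where b: "(q, b) \<in> S" by blast
          then have "cap q = b" using cap_K S by blast
          then have "cap q < a" using c b notS by (cases "b = a") auto
          then show ?thesis using h_le[OF q(1,2)] by simp
        next
          case False
          then have "h q = real (cap q) - \<delta> q" using q by (simp add: h_def)
          then show ?thesis using c \<delta>[OF q(2)] by simp
        qed
        then show ?thesis using notS True by simp
      next
        case False
        have "a < cap q"
        proof (cases "cap q = n")
          case True
          then show ?thesis using q by simp
        next
          case neq: False
          then obtain q' where "q \<le> q'" "(q', cap q) \<in> K" using cap_in[of q] by (auto simp: A_def)
          then have "\<not> cap q \<le> a" using False by blast
          then show ?thesis by simp
        qed
        then have "real a < h q" using h_gt[OF q(1,2)] by linarith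
        then show ?thesis using notS False by simp
      qed
    qed
  qed
qed

lemma ish_ceiling_arrangement:
  fixes e :: "nat \<Rightarrow> 'n::finite"
  assumes n: "n = CARD('n)" and e: "bij_betw e {1..n} UNIV" and G: "G \<subseteq> pairs_upto n"
  shows "ceiling_arrangement e n G ish_triple"
proof -
  have n1: "1 \<le> n" using n zero_less_card_finite[where 'a = 'n] by linarith
  have f: "ish_triple p \<in> difference_triples n" "0 < snd (snd (ish_triple p))" if "p \<in> pairs_upto n" for p
    using that by (cases p; auto simp: ish_triple_def difference_triples_def pairs_upto_def)+
  interpret difference_arrangement e n "deformation n G ish_triple"
    using n e G f(1) by (rule difference_arrangement_deformation)
  have Tp: "\<exists>a j. t = (1, j, real a) \<and> 1 \<le> a \<and> a < n" if "t \<in> T_pos" for t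
  proof -
    have "t \<in> deformation n G ish_triple" "0 < snd (snd t)" using that by (simp_all add: T_pos_def level_def)
    then obtain a j where "(a, j) \<in> G" "t = (1, j, real a)" by (auto simp: deformation_def ish_triple_def)
    then show ?thesis using G by (force simp: pairs_upto_def)
  qed
  show ?thesis
  proof unfold_locales
    fix xs K S assume xs: "distinct xs" "set xs = {1..n}" and K: "K \<subseteq> T_pos" "configuration xs K" and S: "S \<subseteq> K"
    have len: "length xs = n" using xs distinct_card[of xs] by simp
    obtain p where p: "p < n" "xs ! p = 1" using n1 xs(2) len by (metis atLeastAtMost_iff in_set_conv_nth order_refl)
    \<comment> \<open>A position together with a level: the left end is always \<open>1\<close>, so
      an inequality is given by where its right end stands and by its level.\<close>
    define pos where "pos K = {(q, a). q < n \<and> (1, xs ! q, real a) \<in> K}" for K :: "(nat \<times> nat \<times> real) set"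
    have dom: "dominated xs (1, xs ! q, real a) (1, xs ! q', real a') \<longleftrightarrow> q \<le> q' \<and> a' \<le> a"
      if "q < n" "q' < n" for q q' a a'
      using that weakly_prec_nth_iff[OF xs(1), of q q'] len by (simp add: dominated_def weakly_prec_def)
    have posK: "p < q \<and> q < n \<and> 1 \<le> a \<and> a < n" if qa: "(q, a) \<in> pos K" for q a
    proof -
      have m: "q < n" "(1, xs ! q, real a) \<in> K" using qa by (auto simp: pos_def)
      have "prec xs (xs ! p) (xs ! q)" using K(2) m(2) p(2) unfolding configuration_def by force
      moreover have "prec xs (xs ! p) (xs ! q) \<longleftrightarrow> p < q" using p(1) m(1) len by (intro prec_nth_iff[OF xs(1)]) auto
      ultimately have "p < q" by blast
      moreover have "1 \<le> a \<and> a < n" using Tp[of "(1, xs ! q, real a)"] K(1) m(2) by force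
      ultimately show ?thesis using m by simp
    qed
    have anti: "q = q' \<and> a = a'" if "(q, a) \<in> pos K" "(q', a') \<in> pos K" "q \<le> q'" "a' \<le> a" for q a q' a'
    proof -
      have m: "q < n" "q' < n" using that by (auto simp: pos_def)
      have "(1 :: nat, xs ! q, real a) = (1, xs ! q', real a')"
        using that dom[OF m] K(2) unfolding pos_def configuration_def by blast
      then show ?thesis using nth_eq_iff_index_eq[OF xs(1)] m len by simp
    qed
    have sub: "pos S \<subseteq> pos K" using S by (auto simp: pos_def)
    have "\<exists>h :: nat \<Rightarrow> real. h p = 0 \<and> (\<forall>q q'. q < q' \<and> q' < n \<longrightarrow> h q < h q') \<and>
      (\<forall>q a. p < q \<and> q < n \<and> a < n \<longrightarrow> (if (q, a) \<in> pos S then h q = real a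
       else if \<exists>q' a'. (q', a') \<in> pos K \<and> q \<le> q' \<and> a' \<le> a then h q < real a else real a < h q))"
      by (rule ish_realization[OF posK anti sub])
    then obtain h :: "nat \<Rightarrow> real" where h: "h p = 0" "\<And>q q'. q < q' \<Longrightarrow> q' < n \<Longrightarrow> h q < h q'"
      "\<And>q a. p < q \<Longrightarrow> q < n \<Longrightarrow> a < n \<Longrightarrow> if (q, a) \<in> pos S then h q = real a
       else if \<exists>q' a'. (q', a') \<in> pos K \<and> q \<le> q' \<and> a' \<le> a then h q < real a else real a < h q"
      by blast
    have "\<exists>x. descending xs x \<and> (\<forall>p<n. x $ e (xs ! p) = - h p)"
      using h(2) by (rule ex_descending_point[OF xs])
    then obtain x where x: "descending xs x" "\<And>p. p < n \<Longrightarrow> x $ e (xs ! p) = - h p" by blast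
    have "if t \<in> S then gap t x = 0 else if \<exists>t'\<in>K. dominated xs t t' then gap t x < 0 else 0 < gap t x"
      if t: "t \<in> T_pos" "prec xs (fst t) (fst (snd t))" for t
    proof -
      obtain a j where ij: "t = (1, j, real a)" "a < n" using Tp[OF t(1)] by blast
      have "j \<in> set xs" using prec_in_set[OF t(2)] by (simp add: ij)
      then obtain q where q: "q < n" "xs ! q = j" using len by (auto simp: in_set_conv_nth)
      have pq: "p < q" using t(2) prec_nth_iff[OF xs(1), of p q] p q len by (simp add: ij)
      have g: "gap t x = h q - real a" using x(2)[OF p(1)] x(2)[OF q(1)] p(2) q(2) h(1) by (simp add: ij)
      have S_iff: "t \<in> S \<longleftrightarrow> (q, a) \<in> pos S" using q by (simp add: pos_def ij)
      have K_iff: "(\<exists>t'\<in>K. dominated xs t t') \<longleftrightarrow> (\<exists>q' a'. (q', a') \<in> pos K \<and> q \<le> q' \<and> a' \<le> a)"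
      proof
        assume "\<exists>t'\<in>K. dominated xs t t'"
        then obtain t' where t': "t' \<in> K" "dominated xs t t'" by blast
        obtain a' j' where ij': "t' = (1, j', real a')" using Tp t'(1) K(1) by blast
        have "prec xs (fst t') (fst (snd t'))" using t'(1) K(2) unfolding configuration_def by blast
        then have "j' \<in> set xs" using prec_in_set by (force simp: ij')
        then obtain q' where q': "q' < n" "xs ! q' = j'" using len by (auto simp: in_set_conv_nth)
        have "(q', a') \<in> pos K" using t'(1) q' by (simp add: pos_def ij')
        moreover have "q \<le> q' \<and> a' \<le> a" using dom[OF q(1) q'(1)] t'(2) q(2) q'(2) by (simp add: ij ij')
        ultimately show "\<exists>q' a'. (q', a') \<in> pos K \<and> q \<le> q' \<and> a' \<le> a" by blast
      next
        assume "\<exists>q' a'. (q', a') \<in> pos K \<and> q \<le> q' \<and> a' \<le> a"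
        then obtain q' a' where qa': "(q', a') \<in> pos K" "q \<le> q'" "a' \<le> a" by blast
        then have m': "q' < n" "(1, xs ! q', real a') \<in> K" by (auto simp: pos_def)
        have "dominated xs t (1, xs ! q', real a')"
          using dom[OF q(1) m'(1)] qa' q(2) by (simp add: ij)
        then show "\<exists>t'\<in>K. dominated xs t t'" using m'(2) by blast
      qed
      show ?thesis unfolding S_iff K_iff g using h(3)[OF pq q(1) ij(2)] by (auto split: if_splits)
    qed
    with x(1) show "\<exists>x. descending xs x \<and> (\<forall>t\<in>T_pos. prec xs (fst t) (fst (snd t)) \<longrightarrow>
      (if t \<in> S then gap t x = 0 else if \<exists>t'\<in>K. dominated xs t t' then gap t x < 0 else 0 < gap t x))" by blast
  next
    show "G \<subseteq> pairs_upto n" by fact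
    show "inj_on ish_triple (pairs_upto n)" by (auto simp: inj_on_def ish_triple_def)
    show "ish_triple p \<in> difference_triples n" "0 < snd (snd (ish_triple p))" if "p \<in> pairs_upto n" for p
      using f[OF that] by simp_all
  next
    fix xs K i j i' j'
    assume xs: "distinct xs" "set xs = {1..n}" and K: "K \<subseteq> G" "configuration xs (ish_triple ` K)"
      and ij: "(i, j) \<in> K" "(i', j') \<in> K"
    have mem: "j \<in> set xs" "j' \<in> set xs" using ij K(1) G xs by (auto simp: pairs_upto_def)
    have anti: "(a, b) = (a', b')"
      if "(a, b) \<in> K" "(a', b') \<in> K" "weakly_prec xs b b'" "a' \<le> a" for a b a' b'
    proof -
      have "ish_triple (a, b) = ish_triple (a', b')"
        using K(2) that ish_dominated_iff unfolding configuration_def by blast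
      then show ?thesis by (simp add: ish_triple_def)
    qed
    \<comment> \<open>Equal levels leave right ends that are comparable along \<open>xs\<close>, and
      equal right ends leave comparable levels; either way one triple dominates the other.\<close>
    show "i = i' \<longleftrightarrow> j = j'"
    proof
      assume "i = i'"
      then show "j = j'" using anti[OF ij] anti[OF ij(2,1)] weakly_prec_total[OF mem] by auto
    next
      assume "j = j'"
      then show "i = i'" using anti[OF ij] anti[OF ij(2,1)] by (cases "i' \<le> i") (auto simp: weakly_prec_def)
    qed
  next
    fix P assume P: "partition_on {1..n} P"
    show "\<exists>E. path_system {1..n} E \<and> card E = card (arcs P) \<and>
        (\<forall>xs. distinct xs \<longrightarrow> set xs = {1..n} \<longrightarrow>
           (configuration xs (ish_triple ` arcs P) \<longleftrightarrow> nonnesting {1..n} E xs) \<and>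
           (nonnesting {1..n} E xs \<longrightarrow> uncrossed (ends ` ish_triple ` arcs P) xs = uncrossed E xs))"
      using path_system_endpoint_path[OF P n1] card_endpoint_path[OF P n1]
        configuration_iff_ordered[OF P n1] nonnesting_iff_ordered[OF P n1] uncrossed_endpoint_path[OF P n1]
      by (intro exI[of _ "endpoint_path P"]) simp
  qed
qed

section \<open>Both arrangements as instances of the common count\<close>

theorem theorem5p2:
  fixes e :: "nat \<Rightarrow> 'n::finite" and n :: nat and G :: "(nat \<times> nat) set"
    and A :: "(real ^ 'n) set set"
    and has_ceiling_partition :: "(real ^ 'n) set \<Rightarrow> nat set set \<Rightarrow> bool"
  assumes n: "n = CARD('n)"
    and e: "bij_betw e {1..n} UNIV"
    and G: "G \<subseteq> pairs_upto n"
    and A: "(A = Shi e G \<and> has_ceiling_partition = Shi_ceiling_partition e) \<or>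
            (A = Ish e G \<and> has_ceiling_partition = Ish_ceiling_partition e)"
  shows "(\<forall>P k a b. partition_on {1..n} P \<and> card P = k \<and> endpoint_notation P a b \<longrightarrow>
            ((\<exists>R\<in>regions A. has_ceiling_partition R P) \<longleftrightarrow> (\<forall>i<length a. (a ! i, b ! i) \<in> G)) \<and>
            ((\<forall>i<length a. (a ! i, b ! i) \<in> G) \<longrightarrow>
               real (card {R \<in> regions A. has_ceiling_partition R P}) = fact n / fact (n - k + 1) \<and>
               (\<forall>d. 1 \<le> d \<and> d \<le> k \<longrightarrow>
                  real (card {R \<in> regions A. has_ceiling_partition R P \<and> degrees_of_freedom R = d})
                    = freedom_count n k d))) \<and>
         (\<forall>c d. 1 \<le> d \<and> d \<le> n - c \<longrightarrow>
            real (card {R \<in> regions A. card {H. is_ceiling R H} = c \<and> degrees_of_freedom R = d})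
              = (\<Sum>P\<in>{P \<in> G_partitions n G. card P = n - c}. freedom_count n (n - c) d))"
  using A
proof (elim disjE conjE)
  assume A: "A = Shi e G" and h: "has_ceiling_partition = Shi_ceiling_partition e"
  interpret ceiling_arrangement e n G shi_triple using n e G by (rule shi_ceiling_arrangement)
  have hyp_shi: "hyp (shi_triple (i, j)) = diff_hyperplane e i j 1" for i j
    by (simp add: hyp_def shi_triple_def)
  have A_eq: "A = hyp ` deformation n G shi_triple"
    unfolding A Shi_def Cox_def n[symmetric] deformation_def image_Un
    by (force simp: hyp_def shi_triple_def image_iff)
  have h_eq: "has_ceiling_partition = ceiling_partition"
    unfolding h Shi_ceiling_partition_def[abs_def] ceiling_partition_def[abs_def] ceiling_pairs_def n[symmetric]
    by (intro ext arg_cong2[where f = "(\<and>)"] refl arg_cong2[where f = "(=)"]) (auto simp: hyp_shi)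
  show ?thesis unfolding A_eq h_eq using ceiling_partition_counts ceiling_number_counts by blast
next
  assume A: "A = Ish e G" and h: "has_ceiling_partition = Ish_ceiling_partition e"
  interpret ceiling_arrangement e n G ish_triple using n e G by (rule ish_ceiling_arrangement)
  have hyp_ish: "hyp (ish_triple (i, j)) = diff_hyperplane e 1 j (real i)" for i j
    by (simp add: hyp_def ish_triple_def)
  have A_eq: "A = hyp ` deformation n G ish_triple"
    unfolding A Ish_def Cox_def n[symmetric] deformation_def image_Un
    by (force simp: hyp_def ish_triple_def image_iff)
  have h_eq: "has_ceiling_partition = ceiling_partition"
    unfolding h Ish_ceiling_partition_def[abs_def] ceiling_partition_def[abs_def] ceiling_pairs_def n[symmetric]
    by (intro ext arg_cong2[where f = "(\<and>)"] refl arg_cong2[where f = "(=)"]) (auto simp: hyp_ish)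
  show ?thesis unfolding A_eq h_eq using ceiling_partition_counts ceiling_number_counts by blast
qed

end
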